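(* Let $\Gamma < G = G_+ \times G_-$ be a twin building lattice. Then $\Gamma$ is undistorted in $G$: for any finite generating set $\Sigma$ of $\Gamma$ and any compact generating set $\widehat{\Sigma}$ of $G$, the inclusion $(\Gamma, d_\Sigma) \to (G, d_{\widehat{\Sigma}})$ is a quasi-isometric embedding.
   Context: Word metrics. If $G$ is a locally compact group containing a finitely generated lattice $\Gamma$, then $G$ is compactly generated. For a compact generating set $\widehat{\Sigma}$ of $G$ and a finite generating set $\Sigma$ of $\Gamma$, $d_{\widehat{\Sigma}}$ and $d_\Sigma$ denote the associated word metrics, well defined up to quasi-isometry. The lattice $\Gamma$ is called undistorted (or non-distorted) in $G$ if $d_\Sigma$ is quasi-isometric to the restriction of $d_{\widehat{\Sigma}}$ to $\Gamma$, i.e. if the inclusion $(\Gamma,d_\Sigma)\to(G,d_{\widehat{\Sigma}})$ is a quasi-isometric embedding. Twin building lattices. A twin building lattice is an irreducible lattice $\Gamma < G = G_+ \times G_-$ in a product of two locally compact groups $G_+$ and $G_-$ acting continuously, properly and strongly transitively on locally finite buildings $X_+$ and $X_-$ respectively, such that $\Gamma$ (acting diagonally) preserves a twinning between $X_+$ and $X_-$. Irreducible means that each of the projections of $\Gamma$ to $G_+$ and $G_-$ is dense. Such a $\Gamma$ is finitely generated. Standing assumption: the twin building $(X_+,X_-)$, with Weyl group $W$ and (finite) canonical generating set $S$, is the one associated with a root group datum on $\Gamma$. That is, letting $\Phi$ be the set of roots of $(W,S)$ and $\alpha_s$ the simple root attached to $s\in S$, there are a subgroup $T<\Gamma$ and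 subgroups $(U_\alpha)_{\alpha\in\Phi}$ of $\Gamma$ such that, with $U_\pm=\langle U_\alpha : \alpha\in\Phi_\pm\rangle$: each $U_\alpha$ is nontrivial; $[U_\alpha,U_\beta]\subset\langle U_\gamma:\gamma\in\,]\alpha,\beta[\,\rangle$ for every prenilpotent pair $\{\alpha,\beta\}$ with $\alpha\neq\beta$; for each $s\in S$ and $u\in U_{\alpha_s}\setminus\{1\}$ there is $m(u)\in U_{-\alpha_s}uU_{-\alpha_s}$ with $m(u)U_\beta m(u)^{-1}=U_{s\beta}$ for all $\beta\in\Phi$, and $m(u)^{-1}m(v)\in T$ for $u,v\in U_{\alpha_s}\setminus\{1\}$; $U_{-\alpha_s}\not\subset U_+$ for all $s \in S$; $\Gamma=T\langle U_\alpha:\alpha\in\Phi\rangle$; and $T$ normalizes each $U_\alpha$. The chamber set of $X_\pm$ is $\Gamma/B_\pm$ with $B_\pm=TU_\pm$, with the standard twinning; local finiteness means the $U_\alpha$ are finite. In particular $\Gamma$ acts strongly transitively on the twin building. *)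

theory Defs
  imports
    "HOL-Analysis.Analysis"
    "HOL-Algebra.Generated_Groups"
    "HOL-Algebra.Left_Coset"
    "HOL-Algebra.Group_Action"
    "HOL-Algebra.Multiplicative_Group"
begin

section \<open>Word metrics and quasi-isometric embeddings\<close>

abbreviation list_mult :: "('a, 'b) monoid_scheme \<Rightarrow> 'a list \<Rightarrow> 'a" where
  "list_mult G xs \<equiv> foldr (mult G) xs (one G)"

text \<open>The word length is only meaningful on the subgroup generated by the set; elsewhere
  the \<open>LEAST\<close> is unspecified.\<close>

definition word_length :: "('a, 'b) monoid_scheme \<Rightarrow> 'a set \<Rightarrow> 'a \<Rightarrow> nat" where
  "word_length G A g =
     (LEAST n. \<exists>xs. length xs = n \<and> set xs \<subseteq> A \<union> m_inv G ` A \<and> list_mult G xs = g)"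

definition word_dist :: "('a, 'b) monoid_scheme \<Rightarrow> 'a set \<Rightarrow> 'a \<Rightarrow> 'a \<Rightarrow> real" where
  "word_dist G A g h = real (word_length G A (inv\<^bsub>G\<^esub> g \<otimes>\<^bsub>G\<^esub> h))"

definition quasi_isometric_embedding ::
  "'a set \<Rightarrow> ('a \<Rightarrow> 'a \<Rightarrow> real) \<Rightarrow> 'b set \<Rightarrow> ('b \<Rightarrow> 'b \<Rightarrow> real) \<Rightarrow> ('a \<Rightarrow> 'b) \<Rightarrow> bool" where
  "quasi_isometric_embedding X dX Y dY f \<longleftrightarrow>
     f \<in> X \<rightarrow> Y \<and>
     (\<exists>L\<ge>1. \<exists>C\<ge>0. \<forall>x\<in>X. \<forall>y\<in>X.
        dX x y / L - C \<le> dY (f x) (f y) \<and> dY (f x) (f y) \<le> L * dX x y + C)"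

section \<open>Locally compact groups and lattices\<close>

locale topological_group = group G for G (structure) +
  fixes X :: "'a topology"
  assumes topspace_eq: "topspace X = carrier G"
    and continuous_mult: "continuous_map (prod_topology X X) X (\<lambda>(x, y). x \<otimes> y)"
    and continuous_inv: "continuous_map X X (\<lambda>x. inv x)"

locale locally_compact_group = topological_group +
  assumes locally_compact: "locally_compact_space X"
    and Hausdorff: "Hausdorff_space X"

text \<open>A lattice is a discrete subgroup \<open>H\<close> such that \<open>G/H\<close>, with the quotient topology \<open>Q\<close>,
  carries a nonzero finite \<open>G\<close>-invariant Radon measure \<open>M\<close>.\<close>

definition lattice_subgroup ::
  "('a, 'b) monoid_scheme \<Rightarrow> 'a topology \<Rightarrow> 'a set \<Rightarrow> bool" where
  "lattice_subgroup G X H \<longleftrightarrow>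
     subgroup H G \<and> subtopology X H = discrete_topology H \<and>
     (\<exists>Q M. quotient_map X Q (\<lambda>g. g <#\<^bsub>G\<^esub> H) \<and>
        space M = topspace Q \<and>
        sets M = sigma_sets (topspace Q) {V. openin Q V} \<and>
        finite_measure M \<and>
        emeasure M (space M) \<noteq> 0 \<and>
        (\<forall>A\<in>sets M. emeasure M A = (SUP K\<in>{K. compactin Q K \<and> K \<subseteq> A}. emeasure M K)) \<and>
        (\<forall>g\<in>carrier G. \<forall>A\<in>sets M. emeasure M ((\<lambda>x. g <#\<^bsub>G\<^esub> x) ` A) = emeasure M A))"

section \<open>Coxeter systems and their roots\<close>

text \<open>Words in the generators modulo the congruence generated by the Coxeter relations.  The
  case \<open>s = t\<close> gives the relation \<open>s\<^sup>2 = 1\<close>, so this monoid presentation is the usual group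
  presentation.  The order \<open>group.ord\<close> is \<open>0\<close> for an element of infinite order, in which case
  the relation is empty.\<close>

inductive coxeter_cong :: "('w, 'b) monoid_scheme \<Rightarrow> 'w set \<Rightarrow> 'w list \<Rightarrow> 'w list \<Rightarrow> bool"
  for W S where
  refl: "coxeter_cong W S u u"
| sym: "coxeter_cong W S u v \<Longrightarrow> coxeter_cong W S v u"
| trans: "coxeter_cong W S u v \<Longrightarrow> coxeter_cong W S v w \<Longrightarrow> coxeter_cong W S u w"
| rel: "s \<in> S \<Longrightarrow> t \<in> S \<Longrightarrow>
    coxeter_cong W S (u @ concat (replicate (group.ord W (s \<otimes>\<^bsub>W\<^esub> t)) [s, t]) @ v) (u @ v)"

locale coxeter_system = group W for W (structure) +
  fixes S :: "'a set"
  assumes gens_closed: "S \<subseteq> carrier W"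
    and gens_involutions: "s \<in> S \<Longrightarrow> ord s = 2"
    and gens_generate: "generate W S = carrier W"
    and presentation: "set u \<subseteq> S \<Longrightarrow> set v \<subseteq> S \<Longrightarrow> list_mult W u = list_mult W v
      \<Longrightarrow> coxeter_cong W S u v"

text \<open>Roots are viewed as half-spaces, that is, as subsets of \<open>W\<close>.\<close>

definition simple_root :: "('w, 'b) monoid_scheme \<Rightarrow> 'w set \<Rightarrow> 'w \<Rightarrow> 'w set" where
  "simple_root W S s =
     {w \<in> carrier W. word_length W S w < word_length W S (s \<otimes>\<^bsub>W\<^esub> w)}"

definition roots :: "('w, 'b) monoid_scheme \<Rightarrow> 'w set \<Rightarrow> 'w set set" where
  "roots W S = {w <#\<^bsub>W\<^esub> simple_root W S s | w s. w \<in> carrier W \<and> s \<in> S}"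

definition opp_root :: "('w, 'b) monoid_scheme \<Rightarrow> 'w set \<Rightarrow> 'w set" where
  "opp_root W \<alpha> = carrier W - \<alpha>"

definition pos_roots :: "('w, 'b) monoid_scheme \<Rightarrow> 'w set \<Rightarrow> 'w set set" where
  "pos_roots W S = {\<alpha> \<in> roots W S. \<one>\<^bsub>W\<^esub> \<in> \<alpha>}"

definition neg_roots :: "('w, 'b) monoid_scheme \<Rightarrow> 'w set \<Rightarrow> 'w set set" where
  "neg_roots W S = roots W S - pos_roots W S"

definition prenilpotent :: "('w, 'b) monoid_scheme \<Rightarrow> 'w set \<Rightarrow> 'w set \<Rightarrow> bool" where
  "prenilpotent W \<alpha> \<beta> \<longleftrightarrow> \<alpha> \<inter> \<beta> \<noteq> {} \<and> opp_root W \<alpha> \<inter> opp_root W \<beta> \<noteq> {}"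

definition open_root_interval ::
  "('w, 'b) monoid_scheme \<Rightarrow> 'w set \<Rightarrow> 'w set \<Rightarrow> 'w set \<Rightarrow> 'w set set" where
  "open_root_interval W S \<alpha> \<beta> =
     {\<gamma> \<in> roots W S. \<alpha> \<inter> \<beta> \<subseteq> \<gamma> \<and> opp_root W \<alpha> \<inter> opp_root W \<beta> \<subseteq> opp_root W \<gamma>} - {\<alpha>, \<beta>}"

section \<open>Buildings and twin buildings\<close>

locale building = coxeter_system W S for W (structure) and S +
  fixes C :: "'c set" and \<delta> :: "'c \<Rightarrow> 'c \<Rightarrow> 'a"
  assumes nonempty: "C \<noteq> {}"
    and dist_closed: "x \<in> C \<Longrightarrow> y \<in> C \<Longrightarrow> \<delta> x y \<in> carrier W"
    and WD1: "x \<in> C \<Longrightarrow> y \<in> C \<Longrightarrow> \<delta> x y = \<one> \<longleftrightarrow> x = y"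
    and WD2: "x \<in> C \<Longrightarrow> y \<in> C \<Longrightarrow> x' \<in> C \<Longrightarrow> s \<in> S \<Longrightarrow> \<delta> x' x = s
      \<Longrightarrow> \<delta> x' y \<in> {s \<otimes> \<delta> x y, \<delta> x y}"
    and WD2': "x \<in> C \<Longrightarrow> y \<in> C \<Longrightarrow> x' \<in> C \<Longrightarrow> s \<in> S \<Longrightarrow> \<delta> x' x = s
      \<Longrightarrow> word_length W S (s \<otimes> \<delta> x y) = word_length W S (\<delta> x y) + 1
      \<Longrightarrow> \<delta> x' y = s \<otimes> \<delta> x y"
    and WD3: "x \<in> C \<Longrightarrow> y \<in> C \<Longrightarrow> s \<in> S
      \<Longrightarrow> \<exists>x'\<in>C. \<delta> x' x = s \<and> \<delta> x' y = s \<otimes> \<delta> x y"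

locale locally_finite_building = building +
  assumes panels_finite: "x \<in> C \<Longrightarrow> s \<in> S \<Longrightarrow> finite {y \<in> C. \<delta> x y \<in> {\<one>, s}}"

text \<open>The axioms of a twinning for moving the first argument of the codistance.\<close>

definition codist_axioms ::
  "('w, 'b) monoid_scheme \<Rightarrow> 'w set \<Rightarrow> 'c set \<Rightarrow> ('c \<Rightarrow> 'c \<Rightarrow> 'w) \<Rightarrow> 'd set
     \<Rightarrow> ('c \<Rightarrow> 'd \<Rightarrow> 'w) \<Rightarrow> bool" where
  "codist_axioms W S C \<delta> D \<delta>' \<longleftrightarrow>
     (\<forall>x\<in>C. \<forall>y\<in>D. \<delta>' x y \<in> carrier W) \<and>
     (\<forall>x\<in>C. \<forall>y\<in>D. \<forall>x'\<in>C. \<forall>s\<in>S.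
        \<delta> x' x = s \<and> word_length W S (s \<otimes>\<^bsub>W\<^esub> \<delta>' x y) < word_length W S (\<delta>' x y)
        \<longrightarrow> \<delta>' x' y = s \<otimes>\<^bsub>W\<^esub> \<delta>' x y) \<and>
     (\<forall>x\<in>C. \<forall>y\<in>D. \<forall>s\<in>S. \<exists>x'\<in>C. \<delta> x' x = s \<and> \<delta>' x' y = s \<otimes>\<^bsub>W\<^esub> \<delta>' x y)"

text \<open>The codistance is given on \<open>Cp \<times> Cm\<close>; on \<open>Cm \<times> Cp\<close> it is determined by
  \<open>\<delta>'(y, x) = \<delta>'(x, y)\<^sup>-\<^sup>1\<close>.\<close>

definition twinning ::
  "('w, 'b) monoid_scheme \<Rightarrow> 'w set \<Rightarrow> 'c set \<Rightarrow> ('c \<Rightarrow> 'c \<Rightarrow> 'w) \<Rightarrow> 'd set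
     \<Rightarrow> ('d \<Rightarrow> 'd \<Rightarrow> 'w) \<Rightarrow> ('c \<Rightarrow> 'd \<Rightarrow> 'w) \<Rightarrow> bool" where
  "twinning W S Cp \<delta>p Cm \<delta>m \<delta>' \<longleftrightarrow>
     codist_axioms W S Cp \<delta>p Cm \<delta>' \<and>
     codist_axioms W S Cm \<delta>m Cp (\<lambda>y x. inv\<^bsub>W\<^esub> \<delta>' x y)"

section \<open>Group actions on buildings and twin building lattices\<close>

text \<open>The complete apartment system: all isometric images of \<open>W\<close>.\<close>

definition apartments ::
  "('w, 'b) monoid_scheme \<Rightarrow> 'c set \<Rightarrow> ('c \<Rightarrow> 'c \<Rightarrow> 'w) \<Rightarrow> 'c set set" where
  "apartments W C \<delta> =
     {f ` carrier W | f. f \<in> carrier W \<rightarrow> C \<and>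
        (\<forall>v\<in>carrier W. \<forall>w\<in>carrier W. \<delta> (f v) (f w) = inv\<^bsub>W\<^esub> v \<otimes>\<^bsub>W\<^esub> w)}"

definition strongly_transitive ::
  "('g, 'e) monoid_scheme \<Rightarrow> ('w, 'b) monoid_scheme \<Rightarrow> 'c set \<Rightarrow> ('c \<Rightarrow> 'c \<Rightarrow> 'w)
     \<Rightarrow> ('g \<Rightarrow> 'c \<Rightarrow> 'c) \<Rightarrow> bool" where
  "strongly_transitive G W C \<delta> \<phi> \<longleftrightarrow>
     (\<forall>A\<in>apartments W C \<delta>. \<forall>A'\<in>apartments W C \<delta>. \<forall>x\<in>A. \<forall>x'\<in>A'.
        \<exists>g\<in>carrier G. \<phi> g ` A = A' \<and> \<phi> g x = x')"

text \<open>Continuity and properness are those of an action on the chamber set, which is discrete.\<close>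

locale building_action =
  Grp: locally_compact_group G X + Bld: locally_finite_building W S C \<delta> +
  Act: group_action G C \<phi>
  for G :: "('g, 'e) monoid_scheme" and X
    and W :: "('w, 'b) monoid_scheme" and S and C :: "'c set" and \<delta> and \<phi> +
  assumes preserves_dist:
      "g \<in> carrier G \<Longrightarrow> x \<in> C \<Longrightarrow> y \<in> C \<Longrightarrow> \<delta> (\<phi> g x) (\<phi> g y) = \<delta> x y"
    and continuous_action:
      "continuous_map (prod_topology X (discrete_topology C)) (discrete_topology C)
         (\<lambda>(g, x). \<phi> g x)"
    and proper_action:
      "proper_map (prod_topology X (discrete_topology C))
         (prod_topology (discrete_topology C) (discrete_topology C)) (\<lambda>(g, x). (\<phi> g x, x))"
    and strongly_transitive_action: "strongly_transitive G W C \<delta> \<phi>"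

locale twin_building_lattice =
  plus: building_action Gp Xp W S Cp \<delta>p \<phi>p + minus: building_action Gm Xm W S Cm \<delta>m \<phi>m
  for Gp :: "('g, 'e) monoid_scheme" and Xp and Gm :: "('h, 'f) monoid_scheme" and Xm
    and W :: "('w, 'b) monoid_scheme" and S
    and Cp :: "'c set" and \<delta>p and Cm :: "'d set" and \<delta>m and \<phi>p and \<phi>m +
  fixes \<delta>' :: "'c \<Rightarrow> 'd \<Rightarrow> 'w" and \<Gamma> :: "('g \<times> 'h) set"
  assumes twinning: "twinning W S Cp \<delta>p Cm \<delta>m \<delta>'"
    and lattice: "lattice_subgroup (Gp \<times>\<times> Gm) (prod_topology Xp Xm) \<Gamma>"
    and dense_plus: "Xp closure_of (fst ` \<Gamma>) = carrier Gp"
    and dense_minus: "Xm closure_of (snd ` \<Gamma>) = carrier Gm"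
    and preserves_twinning:
      "\<gamma> \<in> \<Gamma> \<Longrightarrow> x \<in> Cp \<Longrightarrow> y \<in> Cm \<Longrightarrow> \<delta>' (\<phi>p (fst \<gamma>) x) (\<phi>m (snd \<gamma>) y) = \<delta>' x y"

section \<open>Root group data and the associated twin buildings\<close>

abbreviation conj_set :: "('g, 'e) monoid_scheme \<Rightarrow> 'g \<Rightarrow> 'g set \<Rightarrow> 'g set" where
  "conj_set G g A \<equiv> (\<lambda>x. g \<otimes>\<^bsub>G\<^esub> x \<otimes>\<^bsub>G\<^esub> inv\<^bsub>G\<^esub> g) ` A"

definition commutator_subgroup :: "('g, 'e) monoid_scheme \<Rightarrow> 'g set \<Rightarrow> 'g set \<Rightarrow> 'g set" where
  "commutator_subgroup G A B =
     generate G {x \<otimes>\<^bsub>G\<^esub> y \<otimes>\<^bsub>G\<^esub> inv\<^bsub>G\<^esub> x \<otimes>\<^bsub>G\<^esub> inv\<^bsub>G\<^esub> y | x y. x \<in> A \<and> y \<in> B}"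

definition U_pos ::
  "('g, 'e) monoid_scheme \<Rightarrow> ('w, 'b) monoid_scheme \<Rightarrow> 'w set \<Rightarrow> ('w set \<Rightarrow> 'g set) \<Rightarrow> 'g set" where
  "U_pos G W S U = generate G (\<Union>\<alpha>\<in>pos_roots W S. U \<alpha>)"

definition U_neg ::
  "('g, 'e) monoid_scheme \<Rightarrow> ('w, 'b) monoid_scheme \<Rightarrow> 'w set \<Rightarrow> ('w set \<Rightarrow> 'g set) \<Rightarrow> 'g set" where
  "U_neg G W S U = generate G (\<Union>\<alpha>\<in>neg_roots W S. U \<alpha>)"

text \<open>The possible values of \<open>m(u)\<close> for \<open>u \<in> U\<^sub>\<alpha>\<close>, where \<open>\<alpha>\<close> is the simple root of \<open>s\<close>.\<close>

definition m_elements ::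
  "('g, 'e) monoid_scheme \<Rightarrow> ('w, 'b) monoid_scheme \<Rightarrow> 'w set \<Rightarrow> ('w set \<Rightarrow> 'g set)
     \<Rightarrow> 'w \<Rightarrow> 'g \<Rightarrow> 'g set" where
  "m_elements G W S U s u =
     (let V = U (opp_root W (simple_root W S s)) in
      {m \<in> V <#>\<^bsub>G\<^esub> {u} <#>\<^bsub>G\<^esub> V.
         \<forall>\<beta>\<in>roots W S. conj_set G m (U \<beta>) = U (s <#\<^bsub>W\<^esub> \<beta>)})"

locale root_group_datum = group G + Cox: coxeter_system W S
  for G :: "('g, 'e) monoid_scheme" (structure) and W :: "('w, 'b) monoid_scheme" and S +
  fixes T :: "'g set" and U :: "'w set \<Rightarrow> 'g set"
  assumes T_subgroup: "subgroup T G"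
    and U_subgroup: "\<alpha> \<in> roots W S \<Longrightarrow> subgroup (U \<alpha>) G"
    and U_nontrivial: "\<alpha> \<in> roots W S \<Longrightarrow> U \<alpha> \<noteq> {\<one>}"
    and commutator_relations:
      "\<alpha> \<in> roots W S \<Longrightarrow> \<beta> \<in> roots W S \<Longrightarrow> \<alpha> \<noteq> \<beta> \<Longrightarrow> prenilpotent W \<alpha> \<beta>
        \<Longrightarrow> commutator_subgroup G (U \<alpha>) (U \<beta>)
              \<subseteq> generate G (\<Union>\<gamma>\<in>open_root_interval W S \<alpha> \<beta>. U \<gamma>)"
    and m_exists:
      "s \<in> S \<Longrightarrow> \<exists>m. (\<forall>u\<in>U (simple_root W S s) - {\<one>}. m u \<in> m_elements G W S U s u) \<and>
        (\<forall>u\<in>U (simple_root W S s) - {\<one>}. \<forall>v\<in>U (simple_root W S s) - {\<one>}.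
           inv (m u) \<otimes> m v \<in> T)"
    and U_simple_opp: "s \<in> S \<Longrightarrow> \<not> U (opp_root W (simple_root W S s)) \<subseteq> U_pos G W S U"
    and generated: "carrier G = T <#> generate G (\<Union>\<alpha>\<in>roots W S. U \<alpha>)"
    and T_normalizes: "t \<in> T \<Longrightarrow> \<alpha> \<in> roots W S \<Longrightarrow> conj_set G t (U \<alpha>) = U \<alpha>"

definition B_pos ::
  "('g, 'e) monoid_scheme \<Rightarrow> ('w, 'b) monoid_scheme \<Rightarrow> 'w set \<Rightarrow> 'g set \<Rightarrow> ('w set \<Rightarrow> 'g set)
     \<Rightarrow> 'g set" where
  "B_pos G W S T U = T <#>\<^bsub>G\<^esub> U_pos G W S U"

definition B_neg ::
  "('g, 'e) monoid_scheme \<Rightarrow> ('w, 'b) monoid_scheme \<Rightarrow> 'w set \<Rightarrow> 'g set \<Rightarrow> ('w set \<Rightarrow> 'g set)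
     \<Rightarrow> 'g set" where
  "B_neg G W S T U = T <#>\<^bsub>G\<^esub> U_neg G W S U"

text \<open>The group \<open>N = \<langle>T, m(u)\<rangle>\<close>, and the coset of \<open>N/T \<cong> W\<close> that corresponds to \<open>w\<close>.\<close>

definition N_group ::
  "('g, 'e) monoid_scheme \<Rightarrow> ('w, 'b) monoid_scheme \<Rightarrow> 'w set \<Rightarrow> 'g set \<Rightarrow> ('w set \<Rightarrow> 'g set)
     \<Rightarrow> 'g set" where
  "N_group G W S T U =
     generate G (T \<union> (\<Union>s\<in>S. \<Union>u\<in>U (simple_root W S s) - {\<one>\<^bsub>G\<^esub>}. m_elements G W S U s u))"

definition weyl_lifts ::
  "('g, 'e) monoid_scheme \<Rightarrow> ('w, 'b) monoid_scheme \<Rightarrow> 'w set \<Rightarrow> 'g set \<Rightarrow> ('w set \<Rightarrow> 'g set)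
     \<Rightarrow> 'w \<Rightarrow> 'g set" where
  "weyl_lifts G W S T U w =
     {n \<in> N_group G W S T U. \<forall>\<beta>\<in>roots W S. conj_set G n (U \<beta>) = U (w <#\<^bsub>W\<^esub> \<beta>)}"

text \<open>On cosets \<open>x = gB\<^sub>1\<close> and \<open>y = hB\<^sub>2\<close> with \<open>B\<^sub>1, B\<^sub>2\<close> among the two groups \<open>B\<^sub>\<plusminus>\<close>, the
  condition says \<open>g\<^sup>-\<^sup>1 h \<in> B\<^sub>1 w B\<^sub>2\<close>.  For \<open>B\<^sub>1 = B\<^sub>2\<close> this is the Weyl distance (Bruhat
  decomposition), for opposite signs it is the codistance (Birkhoff decomposition).\<close>

definition rgd_dist ::
  "('g, 'e) monoid_scheme \<Rightarrow> ('w, 'b) monoid_scheme \<Rightarrow> 'w set \<Rightarrow> 'g set \<Rightarrow> ('w set \<Rightarrow> 'g set)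
     \<Rightarrow> 'g set \<Rightarrow> 'g set \<Rightarrow> 'w" where
  "rgd_dist G W S T U x y =
     (THE w. w \<in> carrier W \<and>
        (\<exists>g\<in>x. \<exists>h\<in>y. inv\<^bsub>G\<^esub> g \<otimes>\<^bsub>G\<^esub> h \<in> weyl_lifts G W S T U w))"

end

theory Submission
  imports Defs
begin

text \<open>Fix the opposite base chambers \<open>c\<^sub>+ = B\<^sub>+\<close> and \<open>c\<^sub>- = B\<^sub>-\<close> of the twin building, and for an
  element \<open>g\<close> of the product group let \<open>d\<^sub>\<plusminus>(g)\<close> be the length of the Weyl distance from \<open>c\<^sub>\<plusminus>\<close> to
  \<open>gc\<^sub>\<plusminus>\<close>.  A compact set moves \<open>c\<^sub>\<plusminus>\<close> to finitely many chambers only, so \<open>d\<^sub>\<plusminus>\<close> grows at most linearly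
  in the word length of the product group.  The lattice is therefore undistorted as soon as the word
  length of \<open>\<gamma>\<close> in the lattice is at most linear in \<open>d\<^sub>+(\<gamma>) + d\<^sub>-(\<gamma>)\<close>; the other inequality holds for
  every finitely generated subgroup.

  The generators used for this are the elements that move \<open>c\<^sub>+\<close> and \<open>c\<^sub>-\<close> by at most one step.  There are
  finitely many, since the actions are proper and the lattice is discrete.  Let \<open>z\<^sub>0, \<dots>, z\<^sub>k\<close> be a
  minimal gallery from \<open>c\<^sub>-\<close> to \<open>\<gamma>c\<^sub>-\<close>.  One can choose chambers \<open>x\<^sub>i\<close>, consecutive ones equal or
  adjacent, such that the distance from \<open>c\<^sub>+\<close> to \<open>x\<^sub>i\<close> equals the codistance from \<open>c\<^sub>+\<close> to \<open>z\<^sub>i\<close>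
  (lemma \<open>follow_step\<close>).  This equality alone forces \<open>x\<^sub>i\<close> and \<open>z\<^sub>i\<close> to be opposite
  (\<open>opposite_if_dist_eq_codist\<close>).  As the lattice is transitive on pairs of opposite chambers, the
  pairs \<open>(x\<^sub>i, z\<^sub>i)\<close> are translates of \<open>(c\<^sub>+, c\<^sub>-)\<close> by elements \<open>\<gamma>\<^sub>i\<close> with \<open>\<gamma>\<^sub>i\<^sup>-\<^sup>1\<gamma>\<^sub>i\<^sub>+\<^sub>1\<close> in the
  finite generating set.  After \<open>k = d\<^sub>-(\<gamma>)\<close> steps it remains to treat an element that fixes \<open>c\<^sub>-\<close>; for
  it the roles of the two buildings are exchanged, and the chamber that follows the gallery ends at \<open>c\<^sub>-\<close>,
  because the end of the gallery is opposite \<open>c\<^sub>-\<close>.  In total \<open>2d\<^sub>-(\<gamma>) + d\<^sub>+(\<gamma>) + 1\<close> generators suffice (\<open>small_word_bound\<close>).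

  The remaining work is the transitivity on opposite pairs.  The Weyl distance and the codistance of
  a root group datum are definite descriptions, so a Bruhat decomposition has to be proved before they
  say anything.  The commutator relations show that the positive root groups stabilize each rank one
  parabolic subgroup (\<open>panel_left_Bp\<close>), which gives the decompositions \<open>B\<^sub>+NB\<^sub>+\<close> and \<open>B\<^sub>-NB\<^sub>+\<close> of the
  group, and uniqueness in the first one.  Uniqueness in the Birkhoff decomposition \<open>B\<^sub>-NB\<^sub>+\<close> is much
  harder to get from the root group datum, but the twinning axioms supply what is needed: in each panel
  exactly one chamber has maximal codistance from \<open>c\<^sub>-\<close>, and the root group that fixes \<open>c\<^sub>-\<close> and acts on
  the panel identifies it.  Hence the codistance grows with the length of \<open>w\<close> along \<open>N\<close>
  (\<open>len_codist_N\<close>), and the chambers opposite \<open>c\<^sub>-\<close> form a single orbit of \<open>B\<^sub>-\<close>.  The facts on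
  Coxeter groups behind this, in particular that \<open>\<alpha>\<^sub>s\<close> is the only positive root that \<open>s\<close> makes
  negative, come from counting the crossings of a wall modulo two.\<close>

section \<open>Words and left cosets in groups\<close>

context group
begin

lemma mult_inv_cancel:
  assumes "x \<in> carrier G" and "y \<in> carrier G"
  shows "x \<otimes> (inv x \<otimes> y) = y" and "inv x \<otimes> (x \<otimes> y) = y"
  using assms by (simp_all add: m_assoc [symmetric])

lemma mem_l_coset_iff:
  assumes "g \<in> carrier G" and "A \<subseteq> carrier G"
  shows "x \<in> g <# A \<longleftrightarrow> x \<in> carrier G \<and> inv g \<otimes> x \<in> A"
proof
  assume "x \<in> g <# A"
  then obtain a where "a \<in> A" "x = g \<otimes> a"
    by (auto simp: l_coset_def)
  then show "x \<in> carrier G \<and> inv g \<otimes> x \<in> A"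
    using assms by (auto simp: mult_inv_cancel)
next
  assume "x \<in> carrier G \<and> inv g \<otimes> x \<in> A"
  then show "x \<in> g <# A"
    using assms mult_inv_cancel(1)[of g x] by (force simp: l_coset_def)
qed

lemma list_mult_closed:
  "set u \<subseteq> carrier G \<Longrightarrow> list_mult G u \<in> carrier G"
  by (induction u) auto

lemma list_mult_append:
  "set u \<subseteq> carrier G \<Longrightarrow> set v \<subseteq> carrier G \<Longrightarrow>
    list_mult G (u @ v) = list_mult G u \<otimes> list_mult G v"
  by (induction u) (auto simp: m_assoc list_mult_closed)

text \<open>On the subgroup that is generated, the \<open>LEAST\<close> in the definition of the word length is thus
  attained.\<close>

lemma exists_word:
  assumes "A \<subseteq> carrier G" and "g \<in> generate G A"
  shows "\<exists>xs. set xs \<subseteq> A \<union> m_inv G ` A \<and> list_mult G xs = g"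
  using assms(2)
proof (induction rule: generate.induct)
  case one
  show ?case by (rule exI[of _ "[]"]) auto
next
  case (incl h)
  then show ?case using assms(1) by (intro exI[of _ "[h]"]) auto
next
  case (inv h)
  then show ?case using assms(1) by (intro exI[of _ "[inv h]"]) auto
next
  case (eng h1 h2)
  then obtain xs ys where
    "set xs \<subseteq> A \<union> m_inv G ` A" "list_mult G xs = h1"
    "set ys \<subseteq> A \<union> m_inv G ` A" "list_mult G ys = h2" by auto
  moreover have "A \<union> m_inv G ` A \<subseteq> carrier G" using assms(1) by auto
  ultimately show ?case
    using list_mult_append[of xs ys] by (intro exI[of _ "xs @ ys"]) auto
qed

lemma word_length_le:
  "set xs \<subseteq> A \<union> m_inv G ` A \<Longrightarrow> list_mult G xs = g \<Longrightarrow> word_length G A g \<le> length xs"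
  unfolding word_length_def by (rule Least_le) auto

lemma obtain_shortest_word:
  assumes "A \<subseteq> carrier G" and "g \<in> generate G A"
  obtains xs where "set xs \<subseteq> A \<union> m_inv G ` A" "list_mult G xs = g"
    "length xs = word_length G A g"
proof -
  have "\<exists>n xs. length xs = n \<and> set xs \<subseteq> A \<union> m_inv G ` A \<and> list_mult G xs = g"
    using exists_word[OF assms] by auto
  from LeastI_ex[OF this] show thesis
    unfolding word_length_def[symmetric] using that by auto
qed

end

section \<open>Coxeter groups: length, reflections and roots\<close>

context coxeter_system
begin

abbreviation len :: "'a \<Rightarrow> nat" where "len w \<equiv> word_length W S w"

lemma gen_in [simp, intro]: "s \<in> S \<Longrightarrow> s \<in> carrier W"
  using gens_closed by auto

lemma gen_square [simp]: "s \<in> S \<Longrightarrow> s \<otimes> s = \<one>"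
  using pow_ord_eq_1[of s] gens_involutions[of s] by (simp add: numeral_2_eq_2)

lemma gen_inv [simp]: "s \<in> S \<Longrightarrow> inv s = s"
  by (simp add: inv_equality)

lemma gen_cancel [simp]: "s \<in> S \<Longrightarrow> w \<in> carrier W \<Longrightarrow> s \<otimes> (s \<otimes> w) = w"
  by (simp add: m_assoc [symmetric])

lemma gen_ne_one: "s \<in> S \<Longrightarrow> s \<noteq> \<one>"
  using gens_involutions[of s] by auto

lemma gens_inv_closed [simp]: "S \<union> m_inv W ` S = S"
  by auto

lemma word_in: "set u \<subseteq> S \<Longrightarrow> set u \<subseteq> carrier W"
  by auto

lemma word_prod_in [simp]: "set u \<subseteq> S \<Longrightarrow> list_mult W u \<in> carrier W"
  by (simp add: list_mult_closed word_in)

lemma obtain_reduced: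
  assumes "w \<in> carrier W"
  obtains u where "set u \<subseteq> S" "list_mult W u = w" "length u = len w"
  using obtain_shortest_word[OF gens_closed] assms gens_generate by auto

lemma len_le: "set u \<subseteq> S \<Longrightarrow> len (list_mult W u) \<le> length u"
  by (rule word_length_le) auto

lemma word_rev: "set u \<subseteq> S \<Longrightarrow> list_mult W (rev u) = inv (list_mult W u)"
  by (induction u) (auto simp: list_mult_append word_in inv_mult_group simp del: foldr_append foldr_conv_fold)

lemma len_one [simp]: "len \<one> = 0"
  using len_le[of "[]"] by simp

lemma len_eq_0: "w \<in> carrier W \<Longrightarrow> len w = 0 \<longleftrightarrow> w = \<one>"
  by (auto elim: obtain_reduced)

lemma len_mult_le:
  assumes "v \<in> carrier W" "w \<in> carrier W"
  shows "len (v \<otimes> w) \<le> len v + len w"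
proof -
  obtain a b where "set a \<subseteq> S" "list_mult W a = v" "length a = len v"
    "set b \<subseteq> S" "list_mult W b = w" "length b = len w"
    using assms obtain_reduced by metis
  then show ?thesis
    using len_le[of "a @ b"] by (simp add: list_mult_append word_in del: foldr_append)
qed

lemma len_gen_le: "s \<in> S \<Longrightarrow> len s \<le> 1"
  using len_le[of "[s]"] by simp

lemma len_inv: 
  assumes "w \<in> carrier W"
  shows "len (inv w) = len w"
proof -
  have "len (inv w) \<le> len w" if w: "w \<in> carrier W" for w
  proof -
    obtain u where "set u \<subseteq> S" "list_mult W u = w" "length u = len w"
      using obtain_reduced[OF w] .
    then show ?thesis using len_le[of "rev u"] by (simp add: word_rev del: foldr_conv_foldl)
  qed
  from this[of w] this[of "inv w"] show ?thesis using assms by simp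
qed

text \<open>How often a gallery of type \<open>u\<close> that starts at \<open>1\<close> crosses the wall of the reflection
  \<open>r\<close>.\<close>

fun crossings :: "'a list \<Rightarrow> 'a \<Rightarrow> nat" where
  "crossings [] r = 0"
| "crossings (s # u) r = (if r = s then 1 else 0) + crossings u (s \<otimes> r \<otimes> s)"

lemma crossings_append:
  "set u \<subseteq> S \<Longrightarrow> r \<in> carrier W \<Longrightarrow>
    crossings (u @ v) r = crossings u r + crossings v (inv (list_mult W u) \<otimes> r \<otimes> list_mult W u)"
  by (induction u arbitrary: r) (auto simp: inv_mult_group m_assoc)

lemma block_prod:
  assumes "s \<in> S" "t \<in> S"
  shows "list_mult W (concat (replicate k [s, t])) = (s \<otimes> t) [^] k"
proof (induction k)
  case (Suc k)
  have "(s \<otimes> t) [^] Suc k = (s \<otimes> t) \<otimes> (s \<otimes> t) [^] k"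
    using assms nat_pow_Suc2 by blast
  then show ?case using Suc assms by (simp add: m_assoc)
qed simp

text \<open>Along the word \<open>(st)\<^sup>k\<close> the walls crossed are those of \<open>(st)\<^sup>is\<close> for \<open>i < 2k\<close>.  If
  \<open>(st)\<^sup>k = 1\<close> then each of them occurs for \<open>i\<close> and for \<open>i + k\<close>.\<close>

lemma crossings_block:
  assumes st: "s \<in> S" "t \<in> S" and r: "r \<in> carrier W"
  shows "crossings (concat (replicate k [s, t])) r =
    (\<Sum>i<2 * k. if r = (s \<otimes> t) [^] i \<otimes> s then 1 else 0)"
  using r
proof (induction k arbitrary: r)
  case (Suc k)
  define p where "p = s \<otimes> t"
  have p: "p \<in> carrier W" using st by (simp add: p_def)
  have ip: "inv p = t \<otimes> s"
    unfolding p_def using st by (intro inv_equality) (simp_all add: m_assoc)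
  have eq1: "(s \<otimes> r \<otimes> s = t) = (r = p \<otimes> s)"
  proof
    assume "s \<otimes> r \<otimes> s = t"
    then have "s \<otimes> (s \<otimes> r \<otimes> s) \<otimes> s = s \<otimes> t \<otimes> s" by simp
    then show "r = p \<otimes> s" using st Suc.prems by (simp add: m_assoc p_def)
  qed (use st in \<open>simp add: m_assoc p_def\<close>)
  have eq2: "(t \<otimes> (s \<otimes> r \<otimes> s) \<otimes> t = p [^] i \<otimes> s) = (r = p [^] (Suc (Suc i)) \<otimes> s)" for i
  proof -
    define x where "x = p [^] i"
    have x: "x \<in> carrier W" using p by (simp add: x_def)
    have xp: "x \<otimes> p = p \<otimes> x"
      using p nat_pow_Suc2[OF p, of i] by (simp add: x_def)
    have ps: "p \<otimes> s = s \<otimes> inv p" unfolding ip using st by (simp add: p_def m_assoc)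
    have "p [^] (Suc (Suc i)) \<otimes> s = (x \<otimes> p) \<otimes> p \<otimes> s"
      by (simp add: x_def)
    also have "\<dots> = p \<otimes> x \<otimes> (p \<otimes> s)"
      using p x st unfolding xp by (simp add: m_assoc)
    also have "\<dots> = p \<otimes> (x \<otimes> s) \<otimes> inv p"
      using p x st unfolding ps by (simp add: m_assoc)
    finally have "p [^] (Suc (Suc i)) \<otimes> s = p \<otimes> (x \<otimes> s) \<otimes> inv p" .
    moreover have "(t \<otimes> (s \<otimes> r \<otimes> s) \<otimes> t = x \<otimes> s) = (r = p \<otimes> (x \<otimes> s) \<otimes> inv p)"
    proof
      assume "t \<otimes> (s \<otimes> r \<otimes> s) \<otimes> t = x \<otimes> s"
      then have "p \<otimes> (t \<otimes> (s \<otimes> r \<otimes> s) \<otimes> t) \<otimes> inv p = p \<otimes> (x \<otimes> s) \<otimes> inv p" by simp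
      then show "r = p \<otimes> (x \<otimes> s) \<otimes> inv p"
        using st Suc.prems by (simp add: m_assoc ip p_def)
    next
      assume "r = p \<otimes> (x \<otimes> s) \<otimes> inv p"
      then show "t \<otimes> (s \<otimes> r \<otimes> s) \<otimes> t = x \<otimes> s"
        using st x by (simp add: m_assoc ip p_def)
    qed
    ultimately show ?thesis by (simp add: x_def)
  qed
  have "crossings (concat (replicate (Suc k) [s, t])) r =
      (if r = s then 1 else 0) + ((if r = p \<otimes> s then 1 else 0)
        + (\<Sum>i<2 * k. if t \<otimes> (s \<otimes> r \<otimes> s) \<otimes> t = p [^] i \<otimes> s then 1 else 0))"
    using Suc st by (simp add: p_def eq1[unfolded p_def])
  also have "\<dots> = (\<Sum>i<Suc (Suc (2 * k)). if r = p [^] i \<otimes> s then 1 else 0)"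
    unfolding sum.lessThan_Suc_shift using st p by (simp add: eq2 del: nat_pow_Suc)
  finally show ?case by (simp add: p_def)
qed simp

lemma crossings_relator_even:
  assumes st: "s \<in> S" "t \<in> S" and r: "r \<in> carrier W"
  shows "even (crossings (concat (replicate (ord (s \<otimes> t)) [s, t])) r)"
proof -
  define k where "k = ord (s \<otimes> t)"
  define f :: "nat \<Rightarrow> nat" where "f i = (if r = (s \<otimes> t) [^] i \<otimes> s then 1 else 0)" for i
  have st': "s \<otimes> t \<in> carrier W" using st by simp
  have "f (i + k) = f i" for i
    using st' nat_pow_mult[OF st', of i k, symmetric] pow_ord_eq_1[OF st']
    by (simp add: f_def k_def)
  then have "(\<Sum>i<2 * k. f i) = 2 * (\<Sum>i<k. f i)"
    using sum.nat_group[of f k 2] 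
    by (simp add: mult_2 sum.lessThan_Suc lessThan_atLeast0 numeral_2_eq_2
        sum.atLeastLessThan_concat[of 0 k "k + k", symmetric]
        sum.shift_bounds_nat_ivl[of f 0 k k, simplified])
  then show ?thesis
    unfolding k_def[symmetric] crossings_block[OF st r] f_def by simp
qed

text \<open>A relator has even length and crosses every wall an even number of times, so both parities
  are invariants of the element of \<open>W\<close>.  The congruence relates words over an arbitrary alphabet;
  carrying along that all letters lie in \<open>S\<close> makes sure that the words in between are words in the
  generators.\<close>

lemma coxeter_cong_parity:
  assumes "coxeter_cong W S u v"
  shows "(set u \<subseteq> S \<longleftrightarrow> set v \<subseteq> S) \<and> even (length u + length v) \<and>
    (set u \<subseteq> S \<longrightarrow> (\<forall>r\<in>carrier W. even (crossings u r + crossings v r)))"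
  using assms
proof (induction rule: coxeter_cong.induct)
  case (rel s t u v)
  let ?b = "concat (replicate (ord (s \<otimes> t)) [s, t])"
  have b: "set ?b \<subseteq> S" using rel by auto
  have bp: "list_mult W ?b = \<one>"
    using block_prod[OF rel] rel by simp
  have "even (length ?b)" by (simp add: length_concat sum_list_replicate)
  moreover have "even (crossings (u @ ?b @ v) r + crossings (u @ v) r)"
    if "set u \<subseteq> S" "r \<in> carrier W" for r
  proof -
    let ?r = "inv (list_mult W u) \<otimes> r \<otimes> list_mult W u"
    have r': "?r \<in> carrier W" using that by simp
    have "crossings (u @ ?b @ v) r = crossings u r + (crossings ?b ?r + crossings v ?r)"
      using that r' b bp by (simp add: crossings_append)
    then show ?thesis
      using crossings_relator_even[OF rel r'] that by (simp add: crossings_append)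
  qed
  ultimately show ?case using b by (auto split: if_splits)
next
  case (refl u)
  then show ?case by simp
next
  case (sym u v)
  then show ?case by (simp add: add.commute)
next
  case (trans u v w)
  then show ?case by (auto simp del: even_add) (simp add: even_add | simp only: even_add)+
qed

lemma len_parity:
  assumes u: "set u \<subseteq> S"
  shows "even (length u) \<longleftrightarrow> even (len (list_mult W u))"
proof -
  obtain v where v: "set v \<subseteq> S" "list_mult W v = list_mult W u" "length v = len (list_mult W u)"
    using obtain_reduced[OF word_prod_in[OF u]] .
  then show ?thesis
    using coxeter_cong_parity[OF presentation[OF u v(1)]] by simp
qed

lemma crossings_parity:
  assumes "set u \<subseteq> S" "set v \<subseteq> S" "list_mult W u = list_mult W v" "r \<in> carrier W"
  shows "even (crossings u r) \<longleftrightarrow> even (crossings v r)"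
  using coxeter_cong_parity[OF presentation[OF assms(1-3)]] assms by auto

lemma len_gen_mult_cases:
  assumes s: "s \<in> S" and w: "w \<in> carrier W"
  shows "len (s \<otimes> w) = len w + 1 \<or> len w = len (s \<otimes> w) + 1"
proof -
  obtain u where u: "set u \<subseteq> S" "list_mult W u = w" "length u = len w"
    using obtain_reduced[OF w] .
  have "even (len (s \<otimes> w)) \<longleftrightarrow> odd (len w)"
    using len_parity[of "s # u"] u s by simp
  moreover have "len (s \<otimes> w) \<le> len w + 1" "len w \<le> len (s \<otimes> w) + 1"
    using len_mult_le[of s w] len_mult_le[of s "s \<otimes> w"] len_gen_le[OF s] s w by simp_all
  ultimately show ?thesis by presburger
qed

lemma len_gen_mult_neq: "s \<in> S \<Longrightarrow> w \<in> carrier W \<Longrightarrow> len (s \<otimes> w) \<noteq> len w"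
  using len_gen_mult_cases[of s w] by auto

lemma len_gen [simp]: "s \<in> S \<Longrightarrow> len s = 1"
  using len_gen_mult_cases[of s \<one>] by auto

lemma len_mult_gen: "s \<in> S \<Longrightarrow> w \<in> carrier W \<Longrightarrow> len (w \<otimes> s) = len (s \<otimes> inv w)"
  using len_inv[of "w \<otimes> s"] by (simp add: inv_mult_group)

lemma left_descent:
  assumes "w \<in> carrier W" "w \<noteq> \<one>"
  obtains s where "s \<in> S" "len w = len (s \<otimes> w) + 1"
proof -
  obtain u where u: "set u \<subseteq> S" "list_mult W u = w" "length u = len w"
    using obtain_reduced[OF assms(1)] .
  then obtain s v where sv: "u = s # v" using assms by (cases u) auto
  then have s: "s \<in> S" and "s \<otimes> w = list_mult W v" using u by auto
  then have "len (s \<otimes> w) < len w" using len_le[of v] u sv by simp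
  then show thesis using that[OF s] len_gen_mult_cases[OF s assms(1)] by simp
qed

lemma right_descent:
  assumes "w \<in> carrier W" "w \<noteq> \<one>"
  obtains s where "s \<in> S" "len w = len (w \<otimes> s) + 1"
proof -
  have "inv w \<noteq> \<one>" using assms by (metis inv_inv inv_one)
  then obtain s where "s \<in> S" "len (inv w) = len (s \<otimes> inv w) + 1"
    using left_descent[of "inv w"] assms by auto
  then show thesis using that[of s] assms by (simp add: len_mult_gen len_inv)
qed

text \<open>The new word omits a letter at which the wall of \<open>r\<close> is crossed.\<close>

lemma deletion:
  "set u \<subseteq> S \<Longrightarrow> r \<in> carrier W \<Longrightarrow> crossings u r \<noteq> 0 \<Longrightarrow>
    \<exists>v. set v \<subseteq> S \<and> length v < length u \<and> list_mult W v = r \<otimes> list_mult W u"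
proof (induction u arbitrary: r)
  case (Cons s u)
  show ?case
  proof (cases "r = s")
    case True
    then show ?thesis using Cons.prems by (intro exI[of _ u]) auto
  next
    case False
    then have "crossings u (s \<otimes> r \<otimes> s) \<noteq> 0" using Cons.prems by simp
    then obtain v where v: "set v \<subseteq> S" "length v < length u"
      "list_mult W v = (s \<otimes> r \<otimes> s) \<otimes> list_mult W u"
      using Cons.IH[of "s \<otimes> r \<otimes> s"] Cons.prems by auto
    then show ?thesis
      using Cons.prems by (intro exI[of _ "s # v"]) (auto simp: m_assoc)
  qed
qed simp

lemma simple_root_subset: "simple_root W S s \<subseteq> carrier W"
  by (auto simp: simple_root_def)

text \<open>If the number of crossings is odd then every word for the same element crosses the wall of \<open>t\<close>,
  and deletion in a shortest one shows that multiplication with \<open>t\<close> makes the element shorter.  If the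
  number is even, this applies to \<open>t # u\<close>.\<close>

lemma mem_simple_root_iff_crossings:
  assumes u: "set u \<subseteq> S" and t: "t \<in> S"
  shows "list_mult W u \<in> simple_root W S t \<longleftrightarrow> even (crossings u t)"
proof -
  have *: "len (t \<otimes> list_mult W v) < len (list_mult W v)"
    if v: "set v \<subseteq> S" and odd: "odd (crossings v t)" for v
  proof -
    obtain v' where v': "set v' \<subseteq> S" "list_mult W v' = list_mult W v"
      "length v' = len (list_mult W v)"
      using obtain_reduced[OF word_prod_in[OF v]] .
    then have "crossings v' t \<noteq> 0"
      using crossings_parity[OF v'(1) v v'(2), of t] odd t by (auto intro: Nat.gr0I)
    then obtain v'' where "set v'' \<subseteq> S" "length v'' < length v'"
      "list_mult W v'' = t \<otimes> list_mult W v'"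
      using deletion[OF v'(1), of t] t by auto
    then show ?thesis using len_le[of v''] v' by simp
  qed
  show ?thesis
  proof (cases "even (crossings u t)")
    case True
    then have "odd (crossings (t # u) t)" using t by simp
    from *[OF _ this] show ?thesis
      using True u t by (simp add: simple_root_def)
  next
    case False
    from *[OF u this] show ?thesis using False by (simp add: simple_root_def)
  qed
qed

lemma one_in_simple_root [simp]: "s \<in> S \<Longrightarrow> \<one> \<in> simple_root W S s"
  by (simp add: simple_root_def)

lemma gen_notin_simple_root [simp]: "s \<in> S \<Longrightarrow> s \<notin> simple_root W S s"
  by (simp add: simple_root_def)

lemma root_cases:
  assumes "\<beta> \<in> roots W S"
  obtains w s where "w \<in> carrier W" "s \<in> S" "\<beta> = w <# simple_root W S s"
  using assms by (auto simp: roots_def)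

lemma root_subset: "\<beta> \<in> roots W S \<Longrightarrow> \<beta> \<subseteq> carrier W"
  using simple_root_subset by (fastforce simp: l_coset_def elim!: root_cases)

lemma translate_root: "w \<in> carrier W \<Longrightarrow> \<beta> \<in> roots W S \<Longrightarrow> w <# \<beta> \<in> roots W S"
  unfolding roots_def using lcos_m_assoc[OF simple_root_subset] by blast

lemma translate_translate:
  "v \<in> carrier W \<Longrightarrow> w \<in> carrier W \<Longrightarrow> \<beta> \<in> roots W S \<Longrightarrow> v <# (w <# \<beta>) = (v \<otimes> w) <# \<beta>"
  by (simp add: lcos_m_assoc root_subset)

lemma translate_one [simp]: "\<beta> \<in> roots W S \<Longrightarrow> \<one> <# \<beta> = \<beta>"
  by (simp add: lcos_mult_one root_subset)

lemma simple_root_root [simp, intro]: "s \<in> S \<Longrightarrow> simple_root W S s \<in> roots W S"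
  unfolding roots_def using lcos_mult_one[OF simple_root_subset, of s] by blast

lemma opp_translate:
  assumes "w \<in> carrier W" "A \<subseteq> carrier W"
  shows "opp_root W (w <# A) = w <# opp_root W A"
proof -
  have "opp_root W A \<subseteq> carrier W" by (auto simp: opp_root_def)
  then show ?thesis
    using assms by (auto simp: opp_root_def mem_l_coset_iff)
qed

lemma opp_simple_root: "s \<in> S \<Longrightarrow> opp_root W (simple_root W S s) = s <# simple_root W S s"
  using len_gen_mult_neq[of s]
  by (auto simp: mem_l_coset_iff simple_root_subset opp_root_def)
    (auto simp: simple_root_def not_less order.order_iff_strict)

lemma opp_root_root [simp, intro]: "\<beta> \<in> roots W S \<Longrightarrow> opp_root W \<beta> \<in> roots W S"
  by (auto simp: opp_translate simple_root_subset opp_simple_root translate_root elim!: root_cases)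

lemma opp_opp [simp]: "\<beta> \<in> roots W S \<Longrightarrow> opp_root W (opp_root W \<beta>) = \<beta>"
  using root_subset[of \<beta>] by (auto simp: opp_root_def)

lemma root_nonempty: "\<beta> \<in> roots W S \<Longrightarrow> \<beta> \<noteq> {}"
  by (auto simp: l_coset_def elim!: root_cases dest: one_in_simple_root)

lemma one_in_translate_iff:
  "w \<in> carrier W \<Longrightarrow> s \<in> S \<Longrightarrow> \<one> \<in> w <# simple_root W S s \<longleftrightarrow> len w < len (w \<otimes> s)"
  by (simp add: mem_l_coset_iff simple_root_subset len_mult_gen simple_root_def len_inv)

text \<open>By the parity of crossings, a root is determined by its reflection and by the side on which
  \<open>1\<close> lies; and \<open>1\<close> and \<open>s\<close> are separated by no other wall than that of \<open>s\<close>.\<close>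

lemma root_separating_one_gen:
  assumes \<beta>: "\<beta> \<in> roots W S" and s: "s \<in> S" and "\<one> \<in> \<beta>" "s \<notin> \<beta>"
  shows "\<beta> = simple_root W S s"
proof -
  obtain w t where w: "w \<in> carrier W" and t: "t \<in> S" and \<beta>_eq: "\<beta> = w <# simple_root W S t"
    by (rule root_cases[OF \<beta>]) 
  obtain a where a: "set a \<subseteq> S" "list_mult W a = inv w" 
    by (rule obtain_reduced[OF inv_closed[OF w]])
  define r where "r = w \<otimes> t \<otimes> inv w"
  have mem: "list_mult W u \<in> \<beta> \<longleftrightarrow> even (crossings a t + crossings u r)" if u: "set u \<subseteq> S" for u
  proof -
    have "list_mult W u \<in> \<beta> \<longleftrightarrow> list_mult W (a @ u) \<in> simple_root W S t"
      using u a w by (simp add: \<beta>_eq mem_l_coset_iff simple_root_subset list_mult_append word_in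
          del: foldr_append)
    also have "\<dots> \<longleftrightarrow> even (crossings (a @ u) t)"
      using u a t by (intro mem_simple_root_iff_crossings) auto
    finally show ?thesis using a t w by (simp add: crossings_append r_def)
  qed
  have "even (crossings a t)" using mem[of "[]"] assms by simp
  moreover from this have "r = s" using mem[of "[s]"] assms by (simp split: if_splits)
  ultimately have "list_mult W u \<in> \<beta> \<longleftrightarrow> list_mult W u \<in> simple_root W S s"
    if "set u \<subseteq> S" for u
    using mem[OF that] mem_simple_root_iff_crossings[OF that s] by simp
  then have "x \<in> \<beta> \<longleftrightarrow> x \<in> simple_root W S s" if "x \<in> carrier W" for x
    using obtain_reduced[OF that] by metis
  then show ?thesis using root_subset[OF \<beta>] simple_root_subset by blast
qed

end

section \<open>Buildings and twin buildings\<close>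

context building
begin

lemma adj_sym:
  assumes "x \<in> C" "y \<in> C" "s \<in> S" "\<delta> x y = s"
  shows "\<delta> y x = s"
proof -
  have "\<one> \<in> {s \<otimes> \<delta> y x, \<delta> y x}"
    using WD2[of y x x s] WD1[of x x] assms by simp
  moreover have "\<delta> y x \<noteq> \<one>"
    using WD1[of y x] WD1[of x y] gen_ne_one assms by auto
  moreover have "\<delta> y x = s" if "s \<otimes> \<delta> y x = \<one>"
    using gen_cancel[of s "\<delta> y x"] that assms dist_closed by simp
  ultimately show ?thesis by auto
qed

text \<open>Each step of a reduced gallery from \<open>x\<close> to \<open>y\<close> makes the distance to \<open>z\<close> longer, hence the
  distance is known after each step.  For \<open>z = x\<close> this makes the Weyl distance symmetric up to
  inversion.\<close>

lemma dist_along_reduced: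
  assumes "x \<in> C" "y \<in> C" "z \<in> C"
    and "len (inv (\<delta> x y) \<otimes> \<delta> x z) = len (\<delta> x y) + len (\<delta> x z)"
  shows "\<delta> y z = inv (\<delta> x y) \<otimes> \<delta> x z"
  using assms
proof (induction "len (\<delta> x y)" arbitrary: x)
  case 0
  then have "x = y" using WD1 dist_closed by (metis len_eq_0)
  then show ?case using WD1[of y y] 0 dist_closed by simp
next
  case (Suc k)
  let ?w = "\<delta> x y" and ?u = "\<delta> x z"
  have in': "?w \<in> carrier W" "?u \<in> carrier W" using Suc dist_closed by auto
  have "?w \<noteq> \<one>" using Suc.hyps(2) by auto
  then obtain s where s: "s \<in> S" "len ?w = len (s \<otimes> ?w) + 1"
    using left_descent[OF in'(1)] by blast
  obtain x' where x': "x' \<in> C" "\<delta> x' x = s" "\<delta> x' y = s \<otimes> ?w"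
    using WD3[OF Suc.prems(1,2) s(1)] by blast
  have eq: "inv (s \<otimes> ?w) \<otimes> (s \<otimes> ?u) = inv ?w \<otimes> ?u"
    using s in' by (simp add: inv_mult_group m_assoc)
  have "len ?w + len ?u \<le> len (s \<otimes> ?w) + len (s \<otimes> ?u)"
    using len_mult_le[of "inv (s \<otimes> ?w)" "s \<otimes> ?u"] Suc.prems(4) s in' by (simp add: eq len_inv)
  then have "len (s \<otimes> ?u) = len ?u + 1"
    using len_gen_mult_cases[OF s(1) in'(2)] s(2) by linarith
  then have z: "\<delta> x' z = s \<otimes> ?u"
    using WD2'[OF Suc.prems(1,3) x'(1) s(1) x'(2)] by simp
  have "k = len (\<delta> x' y)" using Suc.hyps(2) s x' by simp
  moreover have "len (inv (\<delta> x' y) \<otimes> \<delta> x' z) = len (\<delta> x' y) + len (\<delta> x' z)"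
    using Suc.prems(4) s(2) \<open>len (s \<otimes> ?u) = len ?u + 1\<close> by (simp add: x' z eq)
  ultimately have "\<delta> y z = inv (\<delta> x' y) \<otimes> \<delta> x' z"
    using Suc.hyps(1)[OF _ x'(1) Suc.prems(2,3)] by blast
  then show ?case by (simp add: x' z eq)
qed

lemma dist_inv:
  assumes "x \<in> C" "y \<in> C"
  shows "\<delta> y x = inv (\<delta> x y)"
proof -
  have "\<delta> x x = \<one>" using WD1 assms by simp
  then show ?thesis
    using dist_along_reduced[of x y x] assms dist_closed[of x y] by (simp add: len_inv)
qed

lemma len_dist_sym: "x \<in> C \<Longrightarrow> y \<in> C \<Longrightarrow> len (\<delta> y x) = len (\<delta> x y)"
  using dist_inv[of x y] dist_closed[of x y] by (simp add: len_inv)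

lemma len_dist_triangle:
  assumes "x \<in> C" "y \<in> C" "z \<in> C"
  shows "len (\<delta> x z) \<le> len (\<delta> x y) + len (\<delta> y z)"
  using assms
proof (induction "len (\<delta> x y)" arbitrary: x)
  case 0
  then have "x = y" using WD1 dist_closed by (metis len_eq_0)
  then show ?case by simp
next
  case (Suc k)
  have in': "\<delta> x y \<in> carrier W" using Suc dist_closed by auto
  have "\<delta> x y \<noteq> \<one>" using Suc.hyps(2) by auto
  then obtain s where s: "s \<in> S" "len (\<delta> x y) = len (s \<otimes> \<delta> x y) + 1"
    using left_descent[OF in'] by blast
  obtain x' where x': "x' \<in> C" "\<delta> x' x = s" "\<delta> x' y = s \<otimes> \<delta> x y"
    using WD3[OF Suc.prems(1,2) s(1)] by blast
  have "\<delta> x z \<in> {s \<otimes> \<delta> x' z, \<delta> x' z}"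
    using WD2[OF x'(1) Suc.prems(3,1) s(1)] adj_sym[OF x'(1) Suc.prems(1) s(1)] x'(2) by blast
  then have "len (\<delta> x z) \<le> len (\<delta> x' z) + 1"
    using len_mult_le[of s "\<delta> x' z"] s(1) dist_closed[OF x'(1) Suc.prems(3)] by auto
  also have "len (\<delta> x' z) \<le> len (\<delta> x' y) + len (\<delta> y z)"
    using Suc.hyps(1)[OF _ x'(1) Suc.prems(2,3)] Suc.hyps(2) s(2) x'(3) by simp
  finally show ?case using s(2) x'(3) by simp
qed

end

lemma codist_axiomsD:
  assumes "codist_axioms W S C \<delta> D \<delta>'"
  shows "x \<in> C \<Longrightarrow> y \<in> D \<Longrightarrow> \<delta>' x y \<in> carrier W"
    and "x \<in> C \<Longrightarrow> y \<in> D \<Longrightarrow> x' \<in> C \<Longrightarrow> s \<in> S \<Longrightarrow> \<delta> x' x = s \<Longrightarrow>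
      word_length W S (s \<otimes>\<^bsub>W\<^esub> \<delta>' x y) < word_length W S (\<delta>' x y) \<Longrightarrow> \<delta>' x' y = s \<otimes>\<^bsub>W\<^esub> \<delta>' x y"
    and "x \<in> C \<Longrightarrow> y \<in> D \<Longrightarrow> s \<in> S \<Longrightarrow> \<exists>x'\<in>C. \<delta> x' x = s \<and> \<delta>' x' y = s \<otimes>\<^bsub>W\<^esub> \<delta>' x y"
proof -
  note c = assms[unfolded codist_axioms_def]
  show "x \<in> C \<Longrightarrow> y \<in> D \<Longrightarrow> \<delta>' x y \<in> carrier W"
    using c[THEN conjunct1] by simp
  show "x \<in> C \<Longrightarrow> y \<in> D \<Longrightarrow> x' \<in> C \<Longrightarrow> s \<in> S \<Longrightarrow> \<delta> x' x = s \<Longrightarrow>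
      word_length W S (s \<otimes>\<^bsub>W\<^esub> \<delta>' x y) < word_length W S (\<delta>' x y) \<Longrightarrow> \<delta>' x' y = s \<otimes>\<^bsub>W\<^esub> \<delta>' x y"
    by (rule c[THEN conjunct2, THEN conjunct1, rule_format, OF _ _ _ _ conjI])
  show "x \<in> C \<Longrightarrow> y \<in> D \<Longrightarrow> s \<in> S \<Longrightarrow> \<exists>x'\<in>C. \<delta> x' x = s \<and> \<delta>' x' y = s \<otimes>\<^bsub>W\<^esub> \<delta>' x y"
    by (rule c[THEN conjunct2, THEN conjunct2, rule_format])
qed

locale twin_building = plus: building W S C \<delta> + minus: building W S D \<delta>m
  for W :: "('w, 'b) monoid_scheme" (structure) and S and C :: "'c set" and \<delta> and D :: "'d set" and \<delta>m +
  fixes \<delta>' :: "'c \<Rightarrow> 'd \<Rightarrow> 'w"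
  assumes twin: "twinning W S C \<delta> D \<delta>m \<delta>'"
begin

abbreviation "len \<equiv> plus.len"

lemma codist_axioms_plus: "codist_axioms W S C \<delta> D \<delta>'"
  and codist_axioms_minus: "codist_axioms W S D \<delta>m C (\<lambda>y x. inv (\<delta>' x y))"
  using twin by (simp_all only: twinning_def)

lemmas codist_closed [simp] = codist_axiomsD(1)[OF codist_axioms_plus]
lemmas codist_descend = codist_axiomsD(2)[OF codist_axioms_plus]
lemmas codist_ex = codist_axiomsD(3)[OF codist_axioms_plus]

lemma twin_building_swap: "twin_building W S D \<delta>m C \<delta> (\<lambda>y x. inv (\<delta>' x y))"
proof -
  have "codist_axioms W S C \<delta> D (\<lambda>x y. inv (inv (\<delta>' x y)))"
    unfolding codist_axioms_def
  proof (intro conjI ballI impI)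
    fix x y x' s assume *: "x \<in> C" "y \<in> D" "x' \<in> C" "s \<in> S"
      "\<delta> x' x = s \<and> plus.len (s \<otimes> inv (inv (\<delta>' x y))) < plus.len (inv (inv (\<delta>' x y)))"
    then show "inv (inv (\<delta>' x' y)) = s \<otimes> inv (inv (\<delta>' x y))"
      using codist_descend[of x y x' s] by simp
  next
    fix x y s assume *: "x \<in> C" "y \<in> D" "s \<in> S"
    then obtain x' where "x' \<in> C" "\<delta> x' x = s" "\<delta>' x' y = s \<otimes> \<delta>' x y"
      using codist_ex by blast
    then show "\<exists>x'\<in>C. \<delta> x' x = s \<and> inv (inv (\<delta>' x' y)) = s \<otimes> inv (inv (\<delta>' x y))"
      using * by (intro bexI[of _ x']) simp_all
  qed simp
  then have "twinning W S D \<delta>m C \<delta> (\<lambda>y x. inv (\<delta>' x y))"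
    using codist_axioms_minus by (simp add: twinning_def)
  then show ?thesis by unfold_locales
qed

text \<open>The axioms say how the codistance changes when it can descend.  If it ascends at \<open>x\<close>, there is
  a chamber \<open>x''\<close> of the panel where it can descend, and \<open>x'\<close> is compared with that chamber.\<close>

lemma codist_left_change:
  assumes x: "x \<in> C" "x' \<in> C" and y: "y \<in> D" and s: "s \<in> S" and adj: "\<delta> x' x = s"
  shows "\<delta>' x' y \<in> {\<delta>' x y, s \<otimes> \<delta>' x y}"
proof -
  let ?v = "\<delta>' x y" and ?v' = "\<delta>' x' y"
  have v: "?v \<in> carrier W" "?v' \<in> carrier W" using x y by auto
  note cases = plus.len_gen_mult_cases[OF s v(1)] plus.len_gen_mult_cases[OF s v(2)]
  consider "len (s \<otimes> ?v) < len ?v" | "len (s \<otimes> ?v') < len ?v'" | "len (s \<otimes> ?v) = len ?v + 1"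
    using cases by linarith
  then show ?thesis
  proof cases
    case 1
    then show ?thesis using codist_descend[OF x(1) y x(2) s adj] by simp
  next
    case 2
    then have "?v = s \<otimes> ?v'"
      using codist_descend[OF x(2) y x(1) s plus.adj_sym[OF x(2,1) s adj]] by simp
    then show ?thesis using s v by simp
  next
    case 3
    obtain x'' where x'': "x'' \<in> C" "\<delta> x'' x = s" "\<delta>' x'' y = s \<otimes> ?v"
      using codist_ex[OF x(1) y s] by blast
    have "\<delta> x x'' = s" using plus.adj_sym[OF x''(1) x(1) s x''(2)] .
    have "\<delta> x' x'' \<in> {s \<otimes> s, s}"
      using plus.WD2[OF x(1) x''(1) x(2) s adj] \<open>\<delta> x x'' = s\<close> by simp
    then consider "x' = x''" | "\<delta> x' x'' = s"
      using plus.WD1[OF x(2) x''(1)] s by auto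
    then show ?thesis
    proof cases
      case 1
      then show ?thesis using x'' by simp
    next
      case 2
      have "\<delta>' x' y = s \<otimes> (s \<otimes> ?v)"
        using codist_descend[OF x''(1) y x(2) s 2] 3 s v x'' by simp
      then show ?thesis using s v by simp
    qed
  qed
qed

lemma codist_right_change:
  assumes x: "x \<in> C" and y: "y \<in> D" "y' \<in> D" and s: "s \<in> S" and adj: "\<delta>m y' y = s"
  shows "\<delta>' x y' \<in> {\<delta>' x y, \<delta>' x y \<otimes> s}"
proof -
  interpret swap: twin_building W S D \<delta>m C \<delta> "\<lambda>y x. inv (\<delta>' x y)"
    by (rule twin_building_swap)
  have "inv (\<delta>' x y') \<in> {inv (\<delta>' x y), s \<otimes> inv (\<delta>' x y)}"
    using swap.codist_left_change[OF y x s adj] by simp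
  then consider "inv (\<delta>' x y') = inv (\<delta>' x y)" | "inv (\<delta>' x y') = s \<otimes> inv (\<delta>' x y)"
    by blast
  moreover have "\<delta>' x y' = inv (inv (\<delta>' x y'))" using x y by simp
  ultimately show ?thesis
    using x y s by cases (simp_all add: plus.inv_mult_group)
qed

text \<open>Walking from \<open>c\<close> to \<open>x\<close> along a reduced gallery, the codistance to \<open>z\<close> is shortened by each
  step and is used up on arrival.\<close>

lemma opposite_if_dist_eq_codist:
  assumes "c \<in> C" "x \<in> C" "z \<in> D" "\<delta> c x = \<delta>' c z"
  shows "\<delta>' x z = \<one>"
  using assms
proof (induction "len (\<delta> c x)" arbitrary: c)
  case 0
  then have "\<delta> c x = \<one>" using plus.dist_closed by (metis plus.len_eq_0)
  then show ?case using plus.WD1[of c x] 0 by simp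
next
  case (Suc k)
  let ?w = "\<delta> c x"
  have w: "?w \<in> carrier W" using Suc plus.dist_closed by simp
  have "?w \<noteq> \<one>" using Suc.hyps(2) by auto
  then obtain s where s: "s \<in> S" "len ?w = len (s \<otimes> ?w) + 1"
    using plus.left_descent[OF w] by blast
  obtain c' where c': "c' \<in> C" "\<delta> c' c = s" "\<delta> c' x = s \<otimes> ?w"
    using plus.WD3[OF Suc.prems(1,2) s(1)] by blast
  have "\<delta>' c' z = s \<otimes> ?w"
    using codist_descend[OF Suc.prems(1,3) c'(1) s(1) c'(2)] s Suc.prems(4) by simp
  then show ?case
    using Suc.hyps(1)[OF _ c'(1) Suc.prems(2,3)] Suc.hyps(2) s c'(3) by simp
qed

text \<open>When \<open>z\<close> moves to an adjacent chamber, \<open>x\<close> can be moved by at most one step so that its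
  distance from \<open>c\<close> follows the codistance of \<open>z\<close> from \<open>c\<close>.\<close>

lemma follow_step:
  assumes c: "c \<in> C" and x: "x \<in> C" and z: "z \<in> D" "z' \<in> D" and s: "s \<in> S"
    and adj: "\<delta>m z' z = s" and eq: "\<delta> c x = \<delta>' c z"
  shows "\<exists>x'\<in>C. \<delta> c x' = \<delta>' c z' \<and> len (\<delta> x x') \<le> 1 \<and> \<delta>' x' z' = \<one>"
proof -
  have "\<exists>x'\<in>C. \<delta> c x' = \<delta>' c z' \<and> len (\<delta> x x') \<le> 1"
  proof (cases "\<delta>' c z' = \<delta>' c z")
    case True
    then show ?thesis using eq x plus.WD1[OF x x] by auto
  next
    case False
    then have *: "\<delta>' c z' = \<delta>' c z \<otimes> s" using codist_right_change[OF c z s adj] by simp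
    obtain x' where x': "x' \<in> C" "\<delta> x' x = s" "\<delta> x' c = s \<otimes> \<delta> x c"
      using plus.WD3[OF x c s] by blast
    have "\<delta> c x' = inv (s \<otimes> \<delta> x c)" using plus.dist_inv[OF x'(1) c] x'(3) by simp
    also have "\<dots> = \<delta> c x \<otimes> s"
      using plus.dist_inv[OF x c] s plus.dist_closed[OF x c] by (simp add: plus.inv_mult_group)
    finally have "\<delta> c x' = \<delta>' c z'" using * eq by simp
    moreover have "\<delta> x x' = s" using plus.adj_sym[OF x'(1) x s x'(2)] .
    ultimately show ?thesis using x'(1) s by auto
  qed
  then show ?thesis using opposite_if_dist_eq_codist[OF c _ z(2)] by blast
qed

end

section \<open>A linear bound for the word length in terms of the displacement of two opposite chambers\<close>

locale opposite_transitive_action = twin_building + Grp: group G for G :: "('g, 'e) monoid_scheme" +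
  fixes a :: "'g \<Rightarrow> 'c \<Rightarrow> 'c" and b :: "'g \<Rightarrow> 'd \<Rightarrow> 'd" and c0 :: 'c and d0 :: 'd
  assumes a_closed: "g \<in> carrier G \<Longrightarrow> x \<in> C \<Longrightarrow> a g x \<in> C"
    and b_closed: "g \<in> carrier G \<Longrightarrow> y \<in> D \<Longrightarrow> b g y \<in> D"
    and a_mult: "g \<in> carrier G \<Longrightarrow> h \<in> carrier G \<Longrightarrow> x \<in> C \<Longrightarrow> a (g \<otimes>\<^bsub>G\<^esub> h) x = a g (a h x)"
    and b_mult: "g \<in> carrier G \<Longrightarrow> h \<in> carrier G \<Longrightarrow> y \<in> D \<Longrightarrow> b (g \<otimes>\<^bsub>G\<^esub> h) y = b g (b h y)"
    and a_one: "x \<in> C \<Longrightarrow> a \<one>\<^bsub>G\<^esub> x = x"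
    and b_one: "y \<in> D \<Longrightarrow> b \<one>\<^bsub>G\<^esub> y = y"
    and a_dist: "g \<in> carrier G \<Longrightarrow> x \<in> C \<Longrightarrow> x' \<in> C \<Longrightarrow> \<delta> (a g x) (a g x') = \<delta> x x'"
    and b_dist: "g \<in> carrier G \<Longrightarrow> y \<in> D \<Longrightarrow> y' \<in> D \<Longrightarrow> \<delta>m (b g y) (b g y') = \<delta>m y y'"
    and ab_codist: "g \<in> carrier G \<Longrightarrow> x \<in> C \<Longrightarrow> y \<in> D \<Longrightarrow> \<delta>' (a g x) (b g y) = \<delta>' x y"
    and c0: "c0 \<in> C" and d0: "d0 \<in> D" and opposite: "\<delta>' c0 d0 = \<one>"
    and transitive: "x \<in> C \<Longrightarrow> y \<in> D \<Longrightarrow> \<delta>' x y = \<one> \<Longrightarrow> \<exists>g\<in>carrier G. a g c0 = x \<and> b g d0 = y"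
begin

text \<open>The elements that move neither base chamber by more than one step.  When the action is proper
  this is a finite set, and by the next results it generates the group.\<close>

definition small :: "'g set" where
  "small = {g \<in> carrier G. len (\<delta> c0 (a g c0)) \<le> 1 \<and> len (\<delta>m d0 (b g d0)) \<le> 1}"

lemma opposite_transitive_action_swap:
  "opposite_transitive_action W S D \<delta>m C \<delta> (\<lambda>y x. inv (\<delta>' x y)) G b a d0 c0"
proof -
  interpret swap: twin_building W S D \<delta>m C \<delta> "\<lambda>y x. inv (\<delta>' x y)"
    by (rule twin_building_swap)
  show ?thesis
  proof unfold_locales
    fix x y assume "x \<in> D" "y \<in> C" "inv (\<delta>' y x) = \<one>"
    then have "\<delta>' y x = \<one>" by (metis codist_closed plus.inv_inv plus.inv_one)
    then show "\<exists>g\<in>carrier G. b g d0 = x \<and> a g c0 = y"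
      using transitive \<open>x \<in> D\<close> \<open>y \<in> C\<close> by blast
  qed (simp_all add: a_closed b_closed a_mult b_mult a_one b_one a_dist b_dist ab_codist c0 d0
      opposite)
qed

lemma small_swap:
  "opposite_transitive_action.small W S \<delta>m \<delta> G b a d0 c0 = small"
  unfolding opposite_transitive_action.small_def[OF opposite_transitive_action_swap] small_def
  by auto

text \<open>Along a gallery from \<open>d0\<close> to \<open>z\<close>, the pairs \<open>(x, z)\<close> of opposite chambers in which \<open>x\<close>
  follows \<open>z\<close> are translates of the pair \<open>(c0, d0)\<close> by group elements whose consecutive quotients are
  small.\<close>

lemma follow_gallery:
  assumes "z \<in> D"
  shows "\<exists>xs. set xs \<subseteq> small \<and> length xs = len (\<delta>m z d0) \<and>
    b (list_mult G xs) d0 = z \<and> \<delta> c0 (a (list_mult G xs) c0) = \<delta>' c0 z"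
  using assms
proof (induction "len (\<delta>m z d0)" arbitrary: z)
  case 0
  then have "z = d0" using minus.WD1 minus.dist_closed d0 by (metis plus.len_eq_0)
  then show ?case
    using 0 plus.WD1[OF c0 c0] c0 d0 a_one b_one opposite by (intro exI[of _ "[]"]) simp
next
  case (Suc k)
  let ?w = "\<delta>m z d0"
  have w: "?w \<in> carrier W" using Suc minus.dist_closed d0 by simp
  have "?w \<noteq> \<one>" using Suc.hyps(2) by auto
  then obtain s where s: "s \<in> S" "len ?w = len (s \<otimes> ?w) + 1"
    using plus.left_descent[OF w] by blast
  obtain z1 where z1: "z1 \<in> D" "\<delta>m z1 z = s" "\<delta>m z1 d0 = s \<otimes> ?w"
    using minus.WD3[OF Suc.prems d0 s(1)] by blast
  have "k = len (\<delta>m z1 d0)" using Suc.hyps(2) s z1 by simp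
  from Suc.hyps(1)[OF this z1(1)] obtain xs where xs: "set xs \<subseteq> small"
    "length xs = len (\<delta>m z1 d0)" "b (list_mult G xs) d0 = z1"
    "\<delta> c0 (a (list_mult G xs) c0) = \<delta>' c0 z1"
    by blast
  define g where "g = list_mult G xs"
  have small_in: "small \<subseteq> carrier G" by (auto simp: small_def)
  have g: "g \<in> carrier G" using Grp.list_mult_closed[of xs] xs small_in by (auto simp: g_def)
  have adj: "\<delta>m z z1 = s" using minus.adj_sym[OF z1(1) Suc.prems s(1) z1(2)] .
  obtain x' where x': "x' \<in> C" "\<delta> c0 x' = \<delta>' c0 z" "len (\<delta> (a g c0) x') \<le> 1" "\<delta>' x' z = \<one>"
    using follow_step[OF c0 a_closed[OF g c0] z1(1) Suc.prems s(1) adj] xs(4) by (auto simp: g_def)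
  obtain h where h: "h \<in> carrier G" "a h c0 = x'" "b h d0 = z"
    using transitive[OF x'(1) Suc.prems x'(4)] by blast
  define e where "e = inv\<^bsub>G\<^esub> g \<otimes>\<^bsub>G\<^esub> h"
  have e: "e \<in> carrier G" and ge: "g \<otimes>\<^bsub>G\<^esub> e = h" using g h by (simp_all add: e_def Grp.mult_inv_cancel)
  have "a g (a e c0) = x'" "b g (b e d0) = z"
    using a_mult[OF g e c0] b_mult[OF g e d0] ge h by simp_all
  then have "\<delta> c0 (a e c0) = \<delta> (a g c0) x'" "\<delta>m d0 (b e d0) = \<delta>m z1 z"
    using a_dist[OF g c0 a_closed[OF e c0]] b_dist[OF g d0 b_closed[OF e d0]] xs(3)
    by (simp_all add: g_def)
  then have "e \<in> small" using e x'(3) z1(2) s(1) by (simp add: small_def)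
  moreover have "list_mult G (xs @ [e]) = h"
    using Grp.list_mult_append[of xs "[e]"] xs(1) small_in e ge by (auto simp: g_def)
  ultimately show ?case
    using xs(1,2) h x'(2) s(2) z1(3) by (intro exI[of _ "xs @ [e]"]) auto
qed

lemma len_displacement_small_word:
  "set xs \<subseteq> small \<Longrightarrow> len (\<delta> c0 (a (list_mult G xs) c0)) \<le> length xs"
proof (induction xs)
  case Nil
  then show ?case using a_one c0 plus.WD1[OF c0 c0] by simp
next
  case (Cons e xs)
  define g where "g = list_mult G xs"
  have in': "e \<in> carrier G" "g \<in> carrier G"
    using Cons.prems Grp.list_mult_closed[of xs] by (auto simp: small_def g_def)
  have "len (\<delta> c0 (a e (a g c0))) \<le> len (\<delta> c0 (a e c0)) + len (\<delta> (a e c0) (a e (a g c0)))"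
    using in' c0 a_closed by (intro plus.len_dist_triangle) auto
  also have "\<dots> \<le> 1 + length xs"
    using Cons in' c0 a_closed a_dist by (intro add_mono) (auto simp: small_def g_def)
  finally show ?case using in' c0 a_mult by (simp add: g_def)
qed

lemma displacement_inv:
  assumes g: "g \<in> carrier G"
  shows "len (\<delta> c0 (a (inv\<^bsub>G\<^esub> g) c0)) = len (\<delta> c0 (a g c0))"
proof -
  have "\<delta> c0 (a (inv\<^bsub>G\<^esub> g) c0) = \<delta> (a g c0) (a g (a (inv\<^bsub>G\<^esub> g) c0))"
    using g c0 a_closed a_dist by simp
  also have "\<dots> = \<delta> (a g c0) c0"
    using g c0 a_mult[of g "inv\<^bsub>G\<^esub> g" c0] a_one by simp
  finally show ?thesis using plus.len_dist_sym g c0 a_closed by simp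
qed

text \<open>The gallery from \<open>d0\<close> to \<open>g d0\<close> reduces to the case that \<open>g\<close> fixes \<open>d0\<close>.  Then \<open>g c0\<close> is
  opposite \<open>d0\<close>, and the gallery from \<open>c0\<close> to \<open>g c0\<close> finishes the proof.\<close>

theorem small_word_bound:
  assumes g: "g \<in> carrier G"
  shows "\<exists>xs. set xs \<subseteq> small \<and> list_mult G xs = g \<and>
    length xs \<le> 2 * len (\<delta>m d0 (b g d0)) + len (\<delta> c0 (a g c0)) + 1"
proof -
  interpret swap: opposite_transitive_action W S D \<delta>m C \<delta> "\<lambda>y x. inv (\<delta>' x y)" G b a d0 c0
    by (rule opposite_transitive_action_swap)
  have small_in: "small \<subseteq> carrier G" by (auto simp: small_def)
  have "\<exists>xs. set xs \<subseteq> small \<and> length xs = len (\<delta>m (b g d0) d0) \<and>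
    b (list_mult G xs) d0 = b g d0 \<and> \<delta> c0 (a (list_mult G xs) c0) = \<delta>' c0 (b g d0)"
    using follow_gallery[OF b_closed[OF g d0]] .
  then obtain xs where xs: "set xs \<subseteq> small" "length xs = len (\<delta>m (b g d0) d0)"
    "b (list_mult G xs) d0 = b g d0" by blast
  define k where "k = list_mult G xs"
  have k: "k \<in> carrier G" using Grp.list_mult_closed[of xs] xs small_in by (auto simp: k_def)
  define h where "h = inv\<^bsub>G\<^esub> k \<otimes>\<^bsub>G\<^esub> g"
  have h: "h \<in> carrier G" and kh: "k \<otimes>\<^bsub>G\<^esub> h = g" using g k by (simp_all add: h_def Grp.mult_inv_cancel)
  have hd0: "b h d0 = d0"
    using b_mult[of "inv\<^bsub>G\<^esub> k" g d0] b_mult[of "inv\<^bsub>G\<^esub> k" k d0] b_one xs(3) g k d0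
    by (simp add: h_def k_def)
  have x: "a h c0 \<in> C" using a_closed h c0 by simp
  obtain ys where ys: "set ys \<subseteq> small" "length ys = len (\<delta> (a h c0) c0)"
    "a (list_mult G ys) c0 = a h c0"
    "\<delta>m d0 (b (list_mult G ys) d0) = inv (\<delta>' (a h c0) d0)"
    using swap.follow_gallery[OF x] unfolding small_swap by blast
  define l where "l = list_mult G ys"
  have l: "l \<in> carrier G" using Grp.list_mult_closed[of ys] ys small_in by (auto simp: l_def)
  have "\<delta>' (a h c0) d0 = \<one>" using ab_codist[OF h c0 d0] hd0 opposite by simp
  then have "b l d0 = d0"
    using ys(4) minus.WD1[OF d0 b_closed[OF l d0]] by (simp add: l_def)
  define e where "e = inv\<^bsub>G\<^esub> l \<otimes>\<^bsub>G\<^esub> h"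
  have e: "e \<in> carrier G" and le: "l \<otimes>\<^bsub>G\<^esub> e = h" using l h by (simp_all add: e_def Grp.mult_inv_cancel)
  have "b e d0 = d0"
    using b_mult[of "inv\<^bsub>G\<^esub> l" h d0] b_mult[of "inv\<^bsub>G\<^esub> l" l d0] b_one \<open>b l d0 = d0\<close> hd0 l h d0
    by (simp add: e_def)
  moreover have "a e c0 = c0"
    using a_mult[of "inv\<^bsub>G\<^esub> l" h c0] a_mult[of "inv\<^bsub>G\<^esub> l" l c0] a_one ys(3) l h c0
    by (simp add: e_def l_def)
  ultimately have "e \<in> small"
    using e c0 d0 plus.WD1[OF c0 c0] minus.WD1[OF d0 d0] by (simp add: small_def)
  have "list_mult G (xs @ ys @ [e]) = k \<otimes>\<^bsub>G\<^esub> (l \<otimes>\<^bsub>G\<^esub> e)"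
    using Grp.list_mult_append[of xs "ys @ [e]"] Grp.list_mult_append[of ys "[e]"]
      xs(1) ys(1) \<open>e \<in> small\<close> small_in e by (auto simp: k_def l_def)
  then have prod: "list_mult G (xs @ ys @ [e]) = g" by (simp add: le kh)
  have len_xs: "length xs = len (\<delta>m d0 (b g d0))"
    using xs(2) minus.len_dist_sym[OF d0 b_closed[OF g d0]] by simp
  have "len (\<delta> c0 (a h c0)) \<le> len (\<delta> c0 (a (inv\<^bsub>G\<^esub> k) c0))
      + len (\<delta> (a (inv\<^bsub>G\<^esub> k) c0) (a (inv\<^bsub>G\<^esub> k) (a g c0)))"
    using plus.len_dist_triangle[of c0 "a (inv\<^bsub>G\<^esub> k) c0" "a h c0"] a_mult[of "inv\<^bsub>G\<^esub> k" g c0]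
      a_closed k g c0 by (simp add: h_def)
  also have "\<dots> \<le> length xs + len (\<delta> c0 (a g c0))"
    using displacement_inv[OF k] len_displacement_small_word[OF xs(1)] a_dist a_closed k g c0
    by (simp add: k_def)
  finally have "length ys \<le> length xs + len (\<delta> c0 (a g c0))"
    using ys(2) plus.len_dist_sym[OF c0 x] by simp
  then show ?thesis
    using prod xs(1) ys(1) \<open>e \<in> small\<close> len_xs by (intro exI[of _ "xs @ ys @ [e]"]) simp
qed

end

section \<open>Root group data: the group N and the parabolic subgroups of rank one\<close>

context group
begin

lemma conj_set_mult:
  assumes "g \<in> carrier G" "h \<in> carrier G" "A \<subseteq> carrier G"
  shows "conj_set G (g \<otimes> h) A = conj_set G g (conj_set G h A)"
  unfolding image_image
proof (rule image_cong[OF HOL.refl])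
  fix x assume "x \<in> A"
  then have "x \<in> carrier G" using assms by blast
  then show "g \<otimes> h \<otimes> x \<otimes> inv (g \<otimes> h) = g \<otimes> (h \<otimes> x \<otimes> inv h) \<otimes> inv g"
    using assms by (simp add: inv_mult_group m_assoc)
qed

lemma conj_set_one:
  assumes "A \<subseteq> carrier G"
  shows "conj_set G \<one> A = A"
proof -
  have "conj_set G \<one> A = (\<lambda>x. x) ` A"
    using assms by (intro image_cong) auto
  then show ?thesis by simp
qed

lemma conj_set_subset: "g \<in> carrier G \<Longrightarrow> A \<subseteq> carrier G \<Longrightarrow> conj_set G g A \<subseteq> carrier G"
  by auto

lemma conj_set_self:
  assumes H: "subgroup H G" and h: "h \<in> H"
  shows "conj_set G h H = H"
proof -
  note [simp] = subgroup.mem_carrier[OF H] subgroup.m_closed[OF H] subgroup.m_inv_closed[OF H]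
  have "x \<in> conj_set G h H" if "x \<in> H" for x
    using that h by (intro image_eqI[of _ _ "inv h \<otimes> x \<otimes> h"]) (simp_all add: m_assoc mult_inv_cancel)
  then show ?thesis using h by auto
qed

lemma conj_generate:
  assumes X: "X \<subseteq> carrier G" and g: "g \<in> carrier G" and H: "subgroup H G"
    and *: "\<And>x. x \<in> X \<Longrightarrow> g \<otimes> x \<otimes> inv g \<in> H" and x: "x \<in> generate G X"
  shows "g \<otimes> x \<otimes> inv g \<in> H"
  using x
proof (induction rule: generate.induct)
  case one
  then show ?case using g subgroup.one_closed[OF H] by simp
next
  case (incl h)
  then show ?case by (rule *)
next
  case (inv h)
  then have "g \<otimes> inv h \<otimes> inv g = inv (g \<otimes> h \<otimes> inv g)"
    using X g by (auto simp: inv_mult_group m_assoc)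
  then show ?case using *[OF inv] subgroup.m_inv_closed[OF H] by simp
next
  case (eng h1 h2)
  then have "h1 \<in> carrier G" "h2 \<in> carrier G" using generate_in_carrier[OF X] by auto
  then have "g \<otimes> (h1 \<otimes> h2) \<otimes> inv g = (g \<otimes> h1 \<otimes> inv g) \<otimes> (g \<otimes> h2 \<otimes> inv g)"
    using g by (simp add: m_assoc mult_inv_cancel)
  then show ?case using eng subgroup.m_closed[OF H] by simp
qed

lemma subgroup_set_mult:
  assumes H: "subgroup H G" and K: "subgroup K G"
    and norm: "\<And>h k. h \<in> H \<Longrightarrow> k \<in> K \<Longrightarrow> h \<otimes> k \<otimes> inv h \<in> K"
  shows "subgroup (H <#> K) G"
proof (rule subgroupI)
  note [simp] = subgroup.mem_carrier[OF H] subgroup.m_closed[OF H] subgroup.m_inv_closed[OF H]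
    subgroup.mem_carrier[OF K] subgroup.m_closed[OF K] subgroup.m_inv_closed[OF K]
  show "H <#> K \<subseteq> carrier G" by (auto simp: set_mult_def)
  show "H <#> K \<noteq> {}"
    using subgroup.one_closed[OF H] subgroup.one_closed[OF K] by (auto simp: set_mult_def)
  fix a assume "a \<in> H <#> K"
  then obtain h k where a: "h \<in> H" "k \<in> K" "a = h \<otimes> k" by (auto simp: set_mult_def)
  have "inv a = inv h \<otimes> (h \<otimes> inv k \<otimes> inv h)"
    using a by (simp add: inv_mult_group m_assoc mult_inv_cancel)
  then show "inv a \<in> H <#> K" using a norm[of h "inv k"] by (auto simp: set_mult_def)
  fix b assume "b \<in> H <#> K"
  then obtain h' k' where b: "h' \<in> H" "k' \<in> K" "b = h' \<otimes> k'" by (auto simp: set_mult_def)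
  have "a \<otimes> b = (h \<otimes> h') \<otimes> ((inv h' \<otimes> k \<otimes> inv (inv h')) \<otimes> k')"
    using a b by (simp add: m_assoc mult_inv_cancel)
  moreover have "(inv h' \<otimes> k \<otimes> inv (inv h')) \<otimes> k' \<in> K"
    using norm[of "inv h'" k] a b subgroup.m_closed[OF K _ b(2)] by simp
  moreover have "h \<otimes> h' \<in> H" using a b by simp
  ultimately show "a \<otimes> b \<in> H <#> K" unfolding set_mult_def by blast
qed

end

context root_group_datum
begin

abbreviation "\<Phi> \<equiv> roots W S"
abbreviation "\<alpha> s \<equiv> simple_root W S s"
abbreviation "opp \<beta> \<equiv> opp_root W \<beta>"
abbreviation "N \<equiv> N_group G W S T U"
abbreviation "Up \<equiv> U_pos G W S U"
abbreviation "Um \<equiv> U_neg G W S U"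
abbreviation "Bp \<equiv> B_pos G W S T U"
abbreviation "Bm \<equiv> B_neg G W S T U"

lemma T_in [simp, intro]: "t \<in> T \<Longrightarrow> t \<in> carrier G"
  using subgroup.mem_carrier[OF T_subgroup] .

lemma U_in [intro]: "\<beta> \<in> \<Phi> \<Longrightarrow> x \<in> U \<beta> \<Longrightarrow> x \<in> carrier G"
  using subgroup.mem_carrier[OF U_subgroup] by blast

lemma U_subset [simp]: "\<beta> \<in> \<Phi> \<Longrightarrow> U \<beta> \<subseteq> carrier G"
  by auto

lemma T_closed [simp]: "t \<in> T \<Longrightarrow> t' \<in> T \<Longrightarrow> t \<otimes> t' \<in> T" "t \<in> T \<Longrightarrow> inv t \<in> T" "\<one> \<in> T"
  using T_subgroup by (simp_all add: subgroup.m_closed subgroup.m_inv_closed subgroup.one_closed)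

lemma U_closed:
  assumes "\<beta> \<in> \<Phi>"
  shows "x \<in> U \<beta> \<Longrightarrow> y \<in> U \<beta> \<Longrightarrow> x \<otimes> y \<in> U \<beta>" "x \<in> U \<beta> \<Longrightarrow> inv x \<in> U \<beta>" "\<one> \<in> U \<beta>"
  using U_subgroup[OF assms]
  by (simp_all add: subgroup.m_closed subgroup.m_inv_closed subgroup.one_closed)

lemma simple_pos: "s \<in> S \<Longrightarrow> \<alpha> s \<in> pos_roots W S"
  by (simp add: pos_roots_def)

lemma opp_simple [simp, intro]: "s \<in> S \<Longrightarrow> opp (\<alpha> s) \<in> \<Phi>"
  by simp

text \<open>The action of \<open>N\<close> on the root groups is recorded by a relation rather than by a map \<open>N \<rightarrow> W\<close>,
  so that it can be used before it is known that \<open>w\<close> is determined by \<open>g\<close>.\<close>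

definition realizes :: "'g \<Rightarrow> 'w \<Rightarrow> bool" where
  "realizes g w \<longleftrightarrow> g \<in> carrier G \<and> w \<in> carrier W \<and>
     (\<forall>\<beta>\<in>\<Phi>. conj_set G g (U \<beta>) = U (w <#\<^bsub>W\<^esub> \<beta>))"

lemma realizes_in: "realizes g w \<Longrightarrow> g \<in> carrier G" "realizes g w \<Longrightarrow> w \<in> carrier W"
  by (simp_all add: realizes_def)

lemma realizes_conj:
  "realizes g w \<Longrightarrow> \<beta> \<in> \<Phi> \<Longrightarrow> x \<in> U \<beta> \<Longrightarrow> g \<otimes> x \<otimes> inv g \<in> U (w <#\<^bsub>W\<^esub> \<beta>)"
  by (auto simp: realizes_def)

lemma realizes_one_iff:
  "realizes g \<one>\<^bsub>W\<^esub> \<longleftrightarrow> g \<in> carrier G \<and> (\<forall>\<beta>\<in>\<Phi>. conj_set G g (U \<beta>) = U \<beta>)"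
  by (simp add: realizes_def)

lemma realizes_mult:
  assumes "realizes g v" "realizes h w"
  shows "realizes (g \<otimes> h) (v \<otimes>\<^bsub>W\<^esub> w)"
  using assms unfolding realizes_def
  by (simp add: conj_set_mult Cox.translate_root Cox.translate_translate)

lemma realizes_inv:
  assumes g: "realizes g w"
  shows "realizes (inv g) (inv\<^bsub>W\<^esub> w)"
proof -
  have "conj_set G (inv g) (U \<beta>) = U (inv\<^bsub>W\<^esub> w <#\<^bsub>W\<^esub> \<beta>)" if \<beta>: "\<beta> \<in> \<Phi>" for \<beta>
  proof -
    let ?\<gamma> = "inv\<^bsub>W\<^esub> w <#\<^bsub>W\<^esub> \<beta>"
    have \<gamma>: "?\<gamma> \<in> \<Phi>" using realizes_in[OF g] \<beta> by (simp add: Cox.translate_root)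
    have "conj_set G g (U ?\<gamma>) = U (w <#\<^bsub>W\<^esub> ?\<gamma>)"
      using g \<gamma> by (simp add: realizes_def)
    also have "\<dots> = U \<beta>"
      using realizes_in[OF g] \<beta> by (simp add: Cox.translate_translate)
    finally have "U \<beta> = conj_set G g (U ?\<gamma>)" by simp
    moreover have "conj_set G (inv g) (conj_set G g (U ?\<gamma>)) = U ?\<gamma>"
      using realizes_in[OF g] \<gamma> conj_set_mult[of "inv g" g "U ?\<gamma>"] conj_set_one[of "U ?\<gamma>"] by simp
    ultimately show ?thesis by (simp only:)
  qed
  then show ?thesis using realizes_in[OF g] by (simp add: realizes_def)
qed

lemma realizes_inv_conj:
  assumes "realizes g w" "\<beta> \<in> \<Phi>" "x \<in> U \<beta>"
  shows "inv g \<otimes> x \<otimes> g \<in> U (inv\<^bsub>W\<^esub> w <#\<^bsub>W\<^esub> \<beta>)"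
  using realizes_conj[OF realizes_inv[OF assms(1)] assms(2,3)] realizes_in[OF assms(1)] by simp

lemma T_realizes: "t \<in> T \<Longrightarrow> realizes t \<one>\<^bsub>W\<^esub>"
  using T_normalizes by (simp add: realizes_one_iff)

lemma m_elements_cases:
  assumes "s \<in> S" "m \<in> m_elements G W S U s u"
  obtains v v' where "v \<in> U (opp (\<alpha> s))" "v' \<in> U (opp (\<alpha> s))" "m = v \<otimes> u \<otimes> v'"
  using assms by (auto simp: m_elements_def Let_def set_mult_def)

lemma m_elements_intro:
  "v \<in> U (opp (\<alpha> s)) \<Longrightarrow> v' \<in> U (opp (\<alpha> s)) \<Longrightarrow> realizes (v \<otimes> u \<otimes> v') s \<Longrightarrow>
    v \<otimes> u \<otimes> v' \<in> m_elements G W S U s u"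
  by (auto simp: m_elements_def Let_def set_mult_def realizes_def)

lemma m_realizes:
  assumes s: "s \<in> S" and u: "u \<in> U (\<alpha> s)" and m: "m \<in> m_elements G W S U s u"
  shows "realizes m s"
proof -
  have "u \<in> carrier G" using u s by auto
  then have "m \<in> carrier G"
    using m_elements_cases[OF s m] U_in[OF opp_simple[OF s]] by (metis m_closed)
  then show ?thesis using m s by (simp add: realizes_def m_elements_def Let_def)
qed

lemma swap_simple:
  assumes s: "s \<in> S"
  shows "s <#\<^bsub>W\<^esub> \<alpha> s = opp (\<alpha> s)" "s <#\<^bsub>W\<^esub> opp (\<alpha> s) = \<alpha> s"
  using s by (simp_all add: Cox.opp_simple_root Cox.translate_translate)

lemma U_simple_subset: "s \<in> S \<Longrightarrow> U (\<alpha> s) \<subseteq> Up"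
  using simple_pos by (auto simp: U_pos_def intro: generate.incl)

lemma U_opp_neq: "s \<in> S \<Longrightarrow> U (opp (\<alpha> s)) \<noteq> U (\<alpha> s)"
  using U_simple_opp U_simple_subset by auto

text \<open>Nontrivial elements of \<open>U\<^sub>\<alpha>\<close> do not normalize \<open>U\<^sub>-\<^sub>\<alpha>\<close>, since \<open>m(u)\<close> exchanges the two
  groups.  This rigidity makes \<open>m(u)\<close> unique, and uniqueness makes \<open>T\<close> normal in \<open>N\<close>.\<close>

lemma not_normalizes_opp:
  assumes s: "s \<in> S" and u: "u \<in> U (\<alpha> s)" and norm: "conj_set G u (U (opp (\<alpha> s))) = U (opp (\<alpha> s))"
  shows "u = \<one>"
proof (rule ccontr)
  assume "u \<noteq> \<one>"
  then obtain m where m: "m \<in> m_elements G W S U s u" using m_exists[OF s] u by blast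
  obtain v v' where v: "v \<in> U (opp (\<alpha> s))" "v' \<in> U (opp (\<alpha> s))" and mv: "m = v \<otimes> u \<otimes> v'"
    using m_elements_cases[OF s m] .
  let ?V = "U (opp (\<alpha> s))"
  have in': "v \<in> carrier G" "v' \<in> carrier G" "u \<in> carrier G" "?V \<subseteq> carrier G"
    using v u s by auto
  have "conj_set G m ?V = conj_set G v (conj_set G u (conj_set G v' ?V))"
    using in' by (simp add: mv conj_set_mult conj_set_subset)
  also have "\<dots> = ?V"
    using conj_set_self[OF U_subgroup[OF opp_simple[OF s]]] v norm by simp
  finally have "U (s <#\<^bsub>W\<^esub> opp (\<alpha> s)) = ?V"
    using m_realizes[OF s u m] s by (simp add: realizes_def)
  then show False using U_opp_neq[OF s] swap_simple[OF s] by simp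
qed

lemma opp_not_normalizes:
  assumes s: "s \<in> S" and v: "v \<in> U (opp (\<alpha> s))" and norm: "conj_set G v (U (\<alpha> s)) = U (\<alpha> s)"
  shows "v = \<one>"
proof -
  obtain u where u: "u \<in> U (\<alpha> s)" "u \<noteq> \<one>"
    using U_nontrivial[of "\<alpha> s"] U_closed(3)[of "\<alpha> s"] s by auto
  then obtain m where m: "m \<in> m_elements G W S U s u" using m_exists[OF s] by blast
  note rm = m_realizes[OF s u(1) m]
  have in': "m \<in> carrier G" "v \<in> carrier G" using realizes_in[OF rm] v s by auto
  have V: "U (opp (\<alpha> s)) = conj_set G m (U (\<alpha> s))"
    using rm s by (simp add: realizes_def swap_simple)
  have V': "conj_set G m (U (opp (\<alpha> s))) = U (\<alpha> s)"
    using rm s by (simp add: realizes_def swap_simple)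
  let ?x = "inv m \<otimes> v \<otimes> m"
  have x: "?x \<in> U (\<alpha> s)"
    using realizes_inv_conj[OF rm opp_simple[OF s] v] s by (simp add: swap_simple)
  have "conj_set G ?x (U (opp (\<alpha> s))) = conj_set G (inv m) (conj_set G v (U (\<alpha> s)))"
    using in' s by (simp add: conj_set_mult conj_set_subset V')
  also have "\<dots> = U (opp (\<alpha> s))"
    using realizes_inv[OF rm] s unfolding norm by (simp add: realizes_def swap_simple)
  finally have "?x = \<one>" by (rule not_normalizes_opp[OF s x])
  then have "m \<otimes> ?x \<otimes> inv m = \<one>" using in' by simp
  then show ?thesis using in' by (simp add: m_assoc mult_inv_cancel)
qed

lemma m_unique:
  assumes s: "s \<in> S" and u: "u \<in> U (\<alpha> s)"
    and m: "m \<in> m_elements G W S U s u" and m': "m' \<in> m_elements G W S U s u"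
  shows "m = m'"
proof -
  let ?V = "U (opp (\<alpha> s))"
  obtain v1 v2 where v: "v1 \<in> ?V" "v2 \<in> ?V" and mv: "m = v1 \<otimes> u \<otimes> v2"
    using m_elements_cases[OF s m] .
  obtain w1 w2 where w: "w1 \<in> ?V" "w2 \<in> ?V" and mw: "m' = w1 \<otimes> u \<otimes> w2"
    using m_elements_cases[OF s m'] .
  note rm = m_realizes[OF s u m] and rm' = m_realizes[OF s u m']
  have in': "v1 \<in> carrier G" "v2 \<in> carrier G" "w1 \<in> carrier G" "w2 \<in> carrier G" "u \<in> carrier G"
    "m \<in> carrier G" "m' \<in> carrier G"
    using v w u s realizes_in[OF rm] realizes_in[OF rm'] by auto
  define a where "a = w1 \<otimes> inv v1"
  define b where "b = inv v2 \<otimes> w2"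
  define c where "c = m \<otimes> b \<otimes> inv m"
  define g where "g = m' \<otimes> inv m"
  note VC = U_closed[OF opp_simple[OF s]]
  have a: "a \<in> ?V" and b: "b \<in> ?V" using v w VC by (simp_all add: a_def b_def)
  have abc: "a \<in> carrier G" "b \<in> carrier G" "c \<in> carrier G" "g \<in> carrier G"
    using in' by (simp_all add: a_def b_def c_def g_def)
  have c: "c \<in> U (\<alpha> s)"
    using realizes_conj[OF rm opp_simple[OF s] b] s by (simp add: c_def swap_simple)
  have "m' = a \<otimes> m \<otimes> b"
    unfolding mv mw a_def b_def using in' by (simp add: m_assoc mult_inv_cancel)
  then have gac: "g = a \<otimes> c"
    using in' abc by (simp add: g_def c_def m_assoc)
  have rg: "realizes g \<one>\<^bsub>W\<^esub>"
    using realizes_mult[OF rm' realizes_inv[OF rm]] s by (simp add: g_def)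
  have "c = inv a \<otimes> g" using gac abc by (simp add: mult_inv_cancel)
  then have "conj_set G c ?V = conj_set G (inv a) (conj_set G g ?V)"
    using abc s by (simp add: conj_set_mult)
  also have "\<dots> = ?V"
    using rg s conj_set_self[OF U_subgroup[OF opp_simple[OF s]] VC(2)[OF a]]
    by (simp add: realizes_one_iff)
  finally have "c = \<one>" by (rule not_normalizes_opp[OF s c])
  then have "g = a" using gac abc by simp
  moreover have "a = \<one>"
    using rg s by (intro opp_not_normalizes[OF s a]) (simp add: \<open>g = a\<close> realizes_one_iff)
  ultimately have "m' \<otimes> inv m = \<one>" by (simp add: g_def)
  then show ?thesis using in' by (metis inv_equality inv_inv inv_closed)
qed

definition is_m :: "'w \<Rightarrow> 'g \<Rightarrow> bool" where
  "is_m s m \<longleftrightarrow> s \<in> S \<and> (\<exists>u\<in>U (\<alpha> s) - {\<one>}. m \<in> m_elements G W S U s u)"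

lemma is_m_realizes: "is_m s m \<Longrightarrow> realizes m s"
  using m_realizes by (auto simp: is_m_def)

lemma is_m_in: "is_m s m \<Longrightarrow> m \<in> carrier G"
  using is_m_realizes realizes_in by blast

lemma is_m_cases:
  assumes "s \<in> S" "u \<in> U (\<alpha> s)" "u \<noteq> \<one>"
  obtains m v v' where "is_m s m" "v \<in> U (opp (\<alpha> s))" "v' \<in> U (opp (\<alpha> s))" "u = v \<otimes> m \<otimes> v'"
proof -
  obtain m where m: "m \<in> m_elements G W S U s u" using m_exists assms by blast
  obtain v v' where v: "v \<in> U (opp (\<alpha> s))" "v' \<in> U (opp (\<alpha> s))" "m = v \<otimes> u \<otimes> v'"
    using m_elements_cases[OF assms(1) m] .
  have "v \<in> carrier G" "v' \<in> carrier G" "u \<in> carrier G" using v assms by auto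
  then have "u = inv v \<otimes> m \<otimes> inv v'" by (simp add: v m_assoc mult_inv_cancel)
  moreover have "is_m s m" using assms m by (auto simp: is_m_def)
  ultimately show thesis
    using U_closed(2)[OF opp_simple[OF assms(1)]] v(1,2) by (intro that[of m "inv v" "inv v'"]) 
qed

lemma ex_is_m: 
  assumes s: "s \<in> S"
  shows "\<exists>m. is_m s m"
proof -
  obtain u where "u \<in> U (\<alpha> s)" "u \<noteq> \<one>"
    using U_nontrivial[of "\<alpha> s"] U_closed(3)[of "\<alpha> s"] s by auto
  then show ?thesis by (rule is_m_cases[OF s]) blast
qed

text \<open>The elements \<open>m(u)\<close> of the root group datum come from some choice function; by uniqueness
  every element that qualifies as \<open>m(u)\<close> is a value of it.\<close>

lemma m_quotient: 
  assumes "is_m s m" "is_m s m'"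
  shows "inv m \<otimes> m' \<in> T"
proof -
  have s: "s \<in> S" using assms by (simp add: is_m_def)
  obtain f where f: "\<forall>u\<in>U (\<alpha> s) - {\<one>}. f u \<in> m_elements G W S U s u"
    "\<forall>u\<in>U (\<alpha> s) - {\<one>}. \<forall>v\<in>U (\<alpha> s) - {\<one>}. inv (f u) \<otimes> f v \<in> T"
    using m_exists[OF s] by blast
  have "\<exists>u\<in>U (\<alpha> s) - {\<one>}. x = f u" if x: "is_m s x" for x
  proof -
    obtain u where u: "u \<in> U (\<alpha> s) - {\<one>}" "x \<in> m_elements G W S U s u"
      using x by (auto simp: is_m_def)
    then show ?thesis using m_unique[OF s, of u x "f u"] f(1) by blast
  qed
  from this[OF assms(1)] this[OF assms(2)] show ?thesis using f(2) by auto
qed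

lemma is_m_inv:
  assumes "is_m s m"
  shows "is_m s (inv m)"
proof -
  have s: "s \<in> S" using assms by (simp add: is_m_def)
  obtain u where u: "u \<in> U (\<alpha> s)" "u \<noteq> \<one>" and m: "m \<in> m_elements G W S U s u"
    using assms by (auto simp: is_m_def)
  obtain v v' where v: "v \<in> U (opp (\<alpha> s))" "v' \<in> U (opp (\<alpha> s))" "m = v \<otimes> u \<otimes> v'"
    using m_elements_cases[OF s m] .
  have in': "v \<in> carrier G" "v' \<in> carrier G" "u \<in> carrier G" using v u s by auto
  have eq: "inv m = inv v' \<otimes> inv u \<otimes> inv v" using in' by (simp add: v inv_mult_group m_assoc)
  have "realizes (inv m) s"
    using realizes_inv[OF m_realizes[OF s u(1) m]] s by simp
  then have "inv m \<in> m_elements G W S U s (inv u)"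
    unfolding eq using v U_closed(2)[OF opp_simple[OF s]] by (intro m_elements_intro) auto
  moreover have "inv u \<in> U (\<alpha> s) - {\<one>}"
    using u s U_closed(2)[of "\<alpha> s"] in' by auto
  ultimately show ?thesis using s by (auto simp: is_m_def)
qed

lemma m_product: "is_m s m \<Longrightarrow> is_m s m' \<Longrightarrow> m \<otimes> m' \<in> T"
  using m_quotient[OF is_m_inv, of s m m'] is_m_in by simp

lemma is_m_conj_T:
  assumes m: "is_m s m" and t: "t \<in> T"
  shows "is_m s (t \<otimes> m \<otimes> inv t)"
proof -
  have s: "s \<in> S" using m by (simp add: is_m_def)
  obtain u where u: "u \<in> U (\<alpha> s)" "u \<noteq> \<one>" and mu: "m \<in> m_elements G W S U s u"
    using m by (auto simp: is_m_def)
  obtain v v' where v: "v \<in> U (opp (\<alpha> s))" "v' \<in> U (opp (\<alpha> s))" "m = v \<otimes> u \<otimes> v'"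
    using m_elements_cases[OF s mu] .
  have in': "v \<in> carrier G" "v' \<in> carrier G" "u \<in> carrier G" "t \<in> carrier G" using v u s t by auto
  have tU: "t \<otimes> x \<otimes> inv t \<in> U \<beta>" if "\<beta> \<in> \<Phi>" "x \<in> U \<beta>" for x \<beta>
    using realizes_conj[OF T_realizes[OF t] that] that by simp
  have eq: "t \<otimes> m \<otimes> inv t = (t \<otimes> v \<otimes> inv t) \<otimes> (t \<otimes> u \<otimes> inv t) \<otimes> (t \<otimes> v' \<otimes> inv t)"
    using in' by (simp add: v m_assoc mult_inv_cancel)
  have "realizes (t \<otimes> m \<otimes> inv t) s"
    using realizes_mult[OF realizes_mult[OF T_realizes[OF t] is_m_realizes[OF m]]
        realizes_inv[OF T_realizes[OF t]]] s by simp
  then have "t \<otimes> m \<otimes> inv t \<in> m_elements G W S U s (t \<otimes> u \<otimes> inv t)"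
    unfolding eq using tU v s by (intro m_elements_intro) auto
  moreover have "t \<otimes> u \<otimes> inv t \<noteq> \<one>"
  proof
    assume "t \<otimes> u \<otimes> inv t = \<one>"
    then have "inv t \<otimes> (t \<otimes> u \<otimes> inv t) \<otimes> t = \<one>" using in' by simp
    then show False using in' u by (simp add: m_assoc mult_inv_cancel)
  qed
  ultimately show ?thesis using s u tU[of "\<alpha> s" u] by (auto simp: is_m_def)
qed

lemma m_conj_T:
  assumes m: "is_m s m" and t: "t \<in> T"
  shows "inv m \<otimes> t \<otimes> m \<in> T"
proof -
  have "inv m \<otimes> (t \<otimes> m \<otimes> inv t) \<otimes> t \<in> T"
    using m_quotient[OF m is_m_conj_T[OF m t]] t by simp
  then show ?thesis using is_m_in[OF m] t by (simp add: m_assoc)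
qed

lemma N_eq: "N = generate G (T \<union> {m. \<exists>s. is_m s m})"
  unfolding N_group_def is_m_def by (rule arg_cong[of _ _ "generate G"]) auto

lemma N_gens_in: "T \<union> {m. \<exists>s. is_m s m} \<subseteq> carrier G"
  using is_m_in by auto

lemma N_subgroup: "subgroup N G"
  unfolding N_eq by (rule generate_is_subgroup[OF N_gens_in])

lemma N_closed: 
  "n \<in> N \<Longrightarrow> n \<in> carrier G" "n \<in> N \<Longrightarrow> n' \<in> N \<Longrightarrow> n \<otimes> n' \<in> N" "n \<in> N \<Longrightarrow> inv n \<in> N" "\<one> \<in> N"
  using N_subgroup
  by (simp_all add: subgroup.mem_carrier subgroup.m_closed subgroup.m_inv_closed subgroup.one_closed)

lemma m_N: "is_m s m \<Longrightarrow> m \<in> N"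
  unfolding N_eq by (auto intro: generate.incl)

lemma N_realizes:
  assumes "n \<in> N"
  shows "\<exists>w. realizes n w"
  using assms unfolding N_eq
proof (induction rule: generate.induct)
  case one
  then show ?case using T_realizes[of \<one>] by auto
next
  case (incl h)
  then show ?case using T_realizes is_m_realizes by blast
next
  case (inv h)
  then show ?case using T_realizes is_m_realizes realizes_inv by blast
next
  case (eng h1 h2)
  then show ?case using realizes_mult by blast
qed

lemma N_conj_T:
  assumes "n \<in> N" and "t \<in> T"
  shows "n \<otimes> t \<otimes> inv n \<in> T"
  using assms unfolding N_eq
proof (induction arbitrary: t rule: generate.induct)
  case one
  then show ?case by simp
next
  case (incl h)
  then consider "h \<in> T" | s where "is_m s h" by auto
  then show ?case
  proof cases
    case 2
    then show ?thesis using m_conj_T[OF is_m_inv[OF 2] incl(2)] is_m_in[OF 2] by simp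
  qed (use incl in simp)
next
  case (inv h)
  then consider "h \<in> T" | s where "is_m s h" by auto
  then show ?case
  proof cases
    case 2
    then show ?thesis using m_conj_T[OF 2 inv(2)] is_m_in[OF 2] by simp
  qed (use inv in simp)
next
  case (eng h1 h2)
  have in': "h1 \<in> carrier G" "h2 \<in> carrier G"
    using eng generate_in_carrier[OF N_gens_in] by auto
  have "h1 \<otimes> (h2 \<otimes> t \<otimes> inv h2) \<otimes> inv h1 \<in> T" using eng by blast
  then show ?case using in' eng.prems by (simp add: inv_mult_group m_assoc)
qed

lemma ex_N_realizes:
  assumes "w \<in> carrier W"
  shows "\<exists>n\<in>N. realizes n w"
proof -
  obtain u where u: "set u \<subseteq> S" "list_mult W u = w" 
    by (rule Cox.obtain_reduced[OF assms])
  have "\<exists>n\<in>N. realizes n (list_mult W u)" if "set u \<subseteq> S" for u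
    using that
  proof (induction u)
    case Nil
    then show ?case using T_realizes[of \<one>] N_closed(4) by auto
  next
    case (Cons s u)
    then obtain n m where "n \<in> N" "realizes n (list_mult W u)" "is_m s m"
      using ex_is_m by fastforce
    then show ?case
      using realizes_mult[OF is_m_realizes] N_closed(2)[OF m_N] by fastforce
  qed
  from this[OF u(1)] show ?thesis using u(2) by simp
qed

lemma pos_gens_in: "(\<Union>\<beta>\<in>pos_roots W S. U \<beta>) \<subseteq> carrier G"
  by (auto simp: pos_roots_def)

lemma neg_gens_in: "(\<Union>\<beta>\<in>neg_roots W S. U \<beta>) \<subseteq> carrier G"
  by (auto simp: neg_roots_def)

lemma Up_subgroup: "subgroup Up G" and Um_subgroup: "subgroup Um G"
  unfolding U_pos_def U_neg_def
  using pos_gens_in neg_gens_in by (simp_all add: generate_is_subgroup)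

lemma Up_incl: "\<beta> \<in> pos_roots W S \<Longrightarrow> x \<in> U \<beta> \<Longrightarrow> x \<in> Up"
  and Um_incl: "\<beta> \<in> neg_roots W S \<Longrightarrow> x \<in> U \<beta> \<Longrightarrow> x \<in> Um"
  unfolding U_pos_def U_neg_def by (auto intro: generate.incl)

lemma realizes_one_conj:
  assumes g: "realizes g \<one>\<^bsub>W\<^esub>"
  shows "x \<in> Up \<Longrightarrow> g \<otimes> x \<otimes> inv g \<in> Up" and "x \<in> Um \<Longrightarrow> g \<otimes> x \<otimes> inv g \<in> Um"
proof -
  have *: "g \<otimes> x \<otimes> inv g \<in> U \<beta>" if "\<beta> \<in> \<Phi>" "x \<in> U \<beta>" for x \<beta>
    using realizes_conj[OF g that] that by simp
  show "g \<otimes> x \<otimes> inv g \<in> Up" if "x \<in> Up"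
  proof (rule conj_generate[OF pos_gens_in realizes_in(1)[OF g] Up_subgroup])
    show "x \<in> generate G (\<Union>\<beta>\<in>pos_roots W S. U \<beta>)" using that by (simp add: U_pos_def)
    fix y assume "y \<in> (\<Union>\<beta>\<in>pos_roots W S. U \<beta>)"
    then obtain \<beta> where \<beta>: "\<beta> \<in> pos_roots W S" "y \<in> U \<beta>" by blast
    then have "\<beta> \<in> \<Phi>" by (simp add: pos_roots_def)
    then show "g \<otimes> y \<otimes> inv g \<in> Up" using Up_incl[OF \<beta>(1)] * \<beta>(2) by blast
  qed
  show "g \<otimes> x \<otimes> inv g \<in> Um" if "x \<in> Um"
  proof (rule conj_generate[OF neg_gens_in realizes_in(1)[OF g] Um_subgroup])
    show "x \<in> generate G (\<Union>\<beta>\<in>neg_roots W S. U \<beta>)" using that by (simp add: U_neg_def)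
    fix y assume "y \<in> (\<Union>\<beta>\<in>neg_roots W S. U \<beta>)"
    then obtain \<beta> where \<beta>: "\<beta> \<in> neg_roots W S" "y \<in> U \<beta>" by blast
    then have "\<beta> \<in> \<Phi>" by (simp add: neg_roots_def)
    then show "g \<otimes> y \<otimes> inv g \<in> Um" using Um_incl[OF \<beta>(1)] * \<beta>(2) by blast
  qed
qed

lemma Bp_subgroup: "subgroup Bp G"
  unfolding B_pos_def
  by (rule subgroup_set_mult[OF T_subgroup Up_subgroup realizes_one_conj(1)[OF T_realizes]])

lemma Bm_subgroup: "subgroup Bm G"
  unfolding B_neg_def
  by (rule subgroup_set_mult[OF T_subgroup Um_subgroup realizes_one_conj(2)[OF T_realizes]])

lemma Bp_closed:
  "b \<in> Bp \<Longrightarrow> b \<in> carrier G" "b \<in> Bp \<Longrightarrow> b' \<in> Bp \<Longrightarrow> b \<otimes> b' \<in> Bp"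
  "b \<in> Bp \<Longrightarrow> inv b \<in> Bp" "\<one> \<in> Bp"
  using Bp_subgroup
  by (simp_all add: subgroup.mem_carrier subgroup.m_closed subgroup.m_inv_closed subgroup.one_closed)

lemma Bm_closed:
  "b \<in> Bm \<Longrightarrow> b \<in> carrier G" "b \<in> Bm \<Longrightarrow> b' \<in> Bm \<Longrightarrow> b \<otimes> b' \<in> Bm"
  "b \<in> Bm \<Longrightarrow> inv b \<in> Bm" "\<one> \<in> Bm"
  using Bm_subgroup
  by (simp_all add: subgroup.mem_carrier subgroup.m_closed subgroup.m_inv_closed subgroup.one_closed)

lemma T_Bp: 
  assumes "t \<in> T"
  shows "t \<in> Bp"
proof -
  have "t \<otimes> \<one> \<in> Bp"
    using assms subgroup.one_closed[OF Up_subgroup] unfolding B_pos_def set_mult_def by blast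
  then show ?thesis using assms by simp
qed

lemma Up_in: "x \<in> Up \<Longrightarrow> x \<in> carrier G"
  using subgroup.mem_carrier[OF Up_subgroup] .

lemma Um_in: "x \<in> Um \<Longrightarrow> x \<in> carrier G"
  using subgroup.mem_carrier[OF Um_subgroup] .

lemma Up_Bp:
  assumes "x \<in> Up"
  shows "x \<in> Bp"
proof -
  have "\<one> \<otimes> x \<in> Bp" using assms T_closed(3) unfolding B_pos_def set_mult_def by blast
  then show ?thesis using Up_in[OF assms] by simp
qed

lemma Um_Bm:
  assumes "x \<in> Um"
  shows "x \<in> Bm"
proof -
  have "\<one> \<otimes> x \<in> Bm" using assms T_closed(3) unfolding B_neg_def set_mult_def by blast
  then show ?thesis using Um_in[OF assms] by simp
qed

lemma U_pos_Bp: "\<beta> \<in> pos_roots W S \<Longrightarrow> x \<in> U \<beta> \<Longrightarrow> x \<in> Bp"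
  using Up_incl Up_Bp by blast

lemma U_simple_Bp: "s \<in> S \<Longrightarrow> x \<in> U (\<alpha> s) \<Longrightarrow> x \<in> Bp"
  using simple_pos U_pos_Bp by blast

lemma Bp_normalizes_Up:
  assumes "b \<in> Bp" "x \<in> Up"
  shows "b \<otimes> x \<otimes> inv b \<in> Up"
proof -
  obtain t y where b: "t \<in> T" "y \<in> Up" "b = t \<otimes> y"
    using assms by (auto simp: B_pos_def set_mult_def)
  have "y \<otimes> x \<otimes> inv y \<in> Up"
    using b assms Up_subgroup by (simp add: subgroup.m_closed subgroup.m_inv_closed)
  then have "t \<otimes> (y \<otimes> x \<otimes> inv y) \<otimes> inv t \<in> Up"
    using realizes_one_conj(1)[OF T_realizes] b by blast
  then show ?thesis using b assms by (simp add: Up_in inv_mult_group m_assoc)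
qed

lemma N_one_normalizes_Bp:
  assumes n: "n \<in> N" "realizes n \<one>\<^bsub>W\<^esub>" and b: "b \<in> Bp"
  shows "n \<otimes> b \<otimes> inv n \<in> Bp"
proof -
  obtain t y where b: "t \<in> T" "y \<in> Up" "b = t \<otimes> y"
    using b by (auto simp: B_pos_def set_mult_def)
  have "n \<otimes> b \<otimes> inv n = (n \<otimes> t \<otimes> inv n) \<otimes> (n \<otimes> y \<otimes> inv n)"
    using b n by (simp add: Up_in N_closed m_assoc mult_inv_cancel)
  then show ?thesis
    using N_conj_T[OF n(1) b(1)] realizes_one_conj(1)[OF n(2) b(2)]
    by (auto simp: B_pos_def set_mult_def)
qed

lemma pos_or_opp_pos: "\<beta> \<in> \<Phi> \<Longrightarrow> \<beta> \<in> pos_roots W S \<or> opp \<beta> \<in> pos_roots W S"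
  by (auto simp: pos_roots_def opp_root_def dest: Cox.opp_root_root[unfolded opp_root_def])

lemma neg_or_opp_neg: "\<beta> \<in> \<Phi> \<Longrightarrow> \<beta> \<in> neg_roots W S \<or> opp \<beta> \<in> neg_roots W S"
  by (auto simp: pos_roots_def neg_roots_def opp_root_def
      dest: Cox.opp_root_root[unfolded opp_root_def])

text \<open>If \<open>U\<^sub>-\<^sub>\<alpha>\<close> were in \<open>B\<^sub>+\<close> then so would be \<open>m(u)\<close>, which would then normalize \<open>U\<^sub>+\<close> and
  conjugate \<open>U\<^sub>\<alpha>\<close> to \<open>U\<^sub>-\<^sub>\<alpha>\<close>.\<close>

lemma U_opp_not_in_Bp:
  assumes s: "s \<in> S"
  shows "\<not> U (opp (\<alpha> s)) \<subseteq> Bp"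
proof
  assume sub: "U (opp (\<alpha> s)) \<subseteq> Bp"
  obtain m where m: "is_m s m" using ex_is_m[OF s] by blast
  then obtain u where u: "u \<in> U (\<alpha> s)" and mu: "m \<in> m_elements G W S U s u"
    by (auto simp: is_m_def)
  obtain v v' where v: "v \<in> U (opp (\<alpha> s))" "v' \<in> U (opp (\<alpha> s))" "m = v \<otimes> u \<otimes> v'"
    by (rule m_elements_cases[OF s mu])
  have "m \<in> Bp"
    unfolding v(3) using v(1,2) sub U_simple_Bp[OF s u] by (intro Bp_closed(2)) auto
  then have "conj_set G m (U (\<alpha> s)) \<subseteq> Up"
    using Bp_normalizes_Up U_simple_subset[OF s] by auto
  then have "U (opp (\<alpha> s)) \<subseteq> Up"
    using is_m_realizes[OF m] s by (simp add: realizes_def swap_simple)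
  then show False using U_simple_opp[OF s] by simp
qed

end

section \<open>The action of the root groups on a panel\<close>

context root_group_datum
begin

text \<open>This set is the union of the chambers of the \<open>s\<close>-panel of \<open>B\<^sub>+\<close>, and \<open>B\<^sub>+ \<union> B\<^sub>+sB\<^sub>+\<close> in the
  language of BN-pairs.\<close>

definition panel :: "'w \<Rightarrow> 'g set" where
  "panel s = Bp \<union> {u \<otimes> m \<otimes> b | u m b. u \<in> U (\<alpha> s) \<and> is_m s m \<and> b \<in> Bp}"

lemma panel_intro:
  "b \<in> Bp \<Longrightarrow> b \<in> panel s" 
  "u \<in> U (\<alpha> s) \<Longrightarrow> is_m s m \<Longrightarrow> b \<in> Bp \<Longrightarrow> u \<otimes> m \<otimes> b \<in> panel s"
  unfolding panel_def by blast+

lemma panel_cases: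
  assumes "g \<in> panel s"
  obtains "g \<in> Bp" | u m b where "u \<in> U (\<alpha> s)" "is_m s m" "b \<in> Bp" "g = u \<otimes> m \<otimes> b"
  using assms unfolding panel_def by blast

lemma m_swaps:
  assumes m: "is_m s m"
  shows "x \<in> U (opp (\<alpha> s)) \<Longrightarrow> m \<otimes> x \<otimes> inv m \<in> U (\<alpha> s)"
    and "x \<in> U (opp (\<alpha> s)) \<Longrightarrow> inv m \<otimes> x \<otimes> m \<in> U (\<alpha> s)"
proof -
  have s: "s \<in> S" using m by (simp add: is_m_def)
  note r = is_m_realizes[OF m]
  note sw = swap_simple[OF s]
  show "x \<in> U (opp (\<alpha> s)) \<Longrightarrow> m \<otimes> x \<otimes> inv m \<in> U (\<alpha> s)"
    using realizes_conj[OF r, of "opp (\<alpha> s)"] s by (simp add: sw)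
  show "x \<in> U (opp (\<alpha> s)) \<Longrightarrow> inv m \<otimes> x \<otimes> m \<in> U (\<alpha> s)"
    using realizes_inv_conj[OF r, of "opp (\<alpha> s)"] s by (simp add: sw)
qed

lemma panel_in: 
  assumes "s \<in> S" "g \<in> panel s"
  shows "g \<in> carrier G"
  using assms(2)
proof (cases rule: panel_cases)
  case (2 u m b)
  then show ?thesis using is_m_in Bp_closed(1) U_in[of "\<alpha> s"] assms by auto
qed (rule Bp_closed)

text \<open>The same set seen from the opposite chamber of the panel: the panel consists of \<open>sB\<^sub>+\<close> and
  of the \<open>U\<^sub>-\<^sub>\<alpha>\<close>-translates of \<open>B\<^sub>+\<close>.  Depending on the sign of a root, one or the other
  description is adapted to the group that acts.\<close>

lemma panel_opp_cases:
  assumes s: "s \<in> S" and m: "is_m s m" and g: "g \<in> panel s"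
  obtains b where "b \<in> Bp" "g = m \<otimes> b"
  | v b where "v \<in> U (opp (\<alpha> s))" "b \<in> Bp" "g = v \<otimes> b"
  using g
proof (cases rule: panel_cases)
  case 1
  then show thesis
    using that(2)[of \<one> g] U_closed(3)[OF opp_simple[OF s]] Bp_closed(1) by simp
next
  case (2 u m' b)
  have in': "u \<in> carrier G" "m \<in> carrier G" "m' \<in> carrier G" "b \<in> carrier G"
    using 2 m is_m_in Bp_closed(1) U_in[of "\<alpha> s"] s by auto
  show thesis
  proof (cases "u = \<one>")
    case True
    have "g = m \<otimes> ((inv m \<otimes> m') \<otimes> b)"
      using in' by (simp add: 2 True m_assoc mult_inv_cancel)
    moreover have "(inv m \<otimes> m') \<otimes> b \<in> Bp"
      by (intro Bp_closed(2) T_Bp[OF m_quotient[OF m]] 2)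
    ultimately show thesis using that(1) by blast
  next
    case False
    obtain m'' v v' where v: "is_m s m''" "v \<in> U (opp (\<alpha> s))" "v' \<in> U (opp (\<alpha> s))"
      "u = v \<otimes> m'' \<otimes> v'"
      using is_m_cases[OF s 2(1) False] .
    have in'': "v \<in> carrier G" "v' \<in> carrier G" "m'' \<in> carrier G"
      using v is_m_in s by auto
    have "g = v \<otimes> ((m'' \<otimes> m') \<otimes> (inv m' \<otimes> v' \<otimes> m') \<otimes> b)"
      using in' in'' by (simp add: 2 v m_assoc mult_inv_cancel)
    moreover have "(m'' \<otimes> m') \<otimes> (inv m' \<otimes> v' \<otimes> m') \<otimes> b \<in> Bp"
      by (intro Bp_closed(2) T_Bp[OF m_product[OF v(1)]] 2
          U_simple_Bp[OF s m_swaps(2)[OF 2(2) v(3)]])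
    ultimately show thesis using that(2) v(2) by blast
  qed
qed

lemma panel_opp_intro:
  assumes s: "s \<in> S"
  shows "is_m s m \<Longrightarrow> b \<in> Bp \<Longrightarrow> m \<otimes> b \<in> panel s"
    and "v \<in> U (opp (\<alpha> s)) \<Longrightarrow> b \<in> Bp \<Longrightarrow> v \<otimes> b \<in> panel s"
proof -
  show "m \<otimes> b \<in> panel s" if "is_m s m" "b \<in> Bp"
    using panel_intro(2)[of \<one> s m b] that U_closed(3)[of "\<alpha> s"] s is_m_in by simp
  assume v: "v \<in> U (opp (\<alpha> s))" and b: "b \<in> Bp"
  obtain m where m: "is_m s m" using ex_is_m[OF s] by blast
  have in': "v \<in> carrier G" "b \<in> carrier G" "m \<in> carrier G"
    using v b s m Bp_closed(1) is_m_in by auto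
  define a where "a = inv m \<otimes> v \<otimes> m"
  have a: "a \<in> U (\<alpha> s)" "a \<in> carrier G" and va: "v = m \<otimes> a \<otimes> inv m"
    using m_swaps(2)[OF m v] in' by (simp_all add: a_def m_assoc mult_inv_cancel)
  show "v \<otimes> b \<in> panel s"
  proof (cases "a = \<one>")
    case True
    then have "v = \<one>" using va in' by simp
    then show ?thesis using b in' panel_intro(1) by simp
  next
    case False
    obtain m' w w' where w: "is_m s m'" "w \<in> U (opp (\<alpha> s))" "w' \<in> U (opp (\<alpha> s))"
      "a = w \<otimes> m' \<otimes> w'"
      using is_m_cases[OF s a(1) False] .
    have in'': "w \<in> carrier G" "w' \<in> carrier G" "m' \<in> carrier G"
      using w is_m_in s by auto
    have "v \<otimes> b = (m \<otimes> w \<otimes> inv m) \<otimes> m \<otimes> ((m' \<otimes> inv m) \<otimes> (m \<otimes> w' \<otimes> inv m) \<otimes> b)"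
      using in' in'' by (simp add: va w m_assoc mult_inv_cancel)
    also have "\<dots> \<in> panel s"
      by (intro panel_intro(2) Bp_closed(2) T_Bp[OF m_product[OF w(1) is_m_inv[OF m]]] m b
          U_simple_Bp[OF s m_swaps(1)[OF m w(3)]] m_swaps(1)[OF m w(2)])
    finally show ?thesis .
  qed
qed

lemma panel_left_simple:
  assumes s: "s \<in> S" and x: "x \<in> U (\<alpha> s)" and g: "g \<in> panel s"
  shows "x \<otimes> g \<in> panel s"
  using g
proof (cases rule: panel_cases)
  case 1
  then show ?thesis by (intro panel_intro(1) Bp_closed(2) U_simple_Bp[OF s x])
next
  case (2 u m b)
  have "x \<otimes> g = (x \<otimes> u) \<otimes> m \<otimes> b"
    using 2 x s is_m_in Bp_closed(1) U_in[of "\<alpha> s"] by (simp add: m_assoc)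
  then show ?thesis using 2 x s U_closed(1)[of "\<alpha> s"] panel_intro(2) by simp
qed

lemma panel_left_T:
  assumes s: "s \<in> S" and t: "t \<in> T" and g: "g \<in> panel s"
  shows "t \<otimes> g \<in> panel s"
  using g
proof (cases rule: panel_cases)
  case 1
  then show ?thesis by (intro panel_intro(1) Bp_closed(2) T_Bp[OF t])
next
  case (2 u m b)
  have "t \<otimes> g = (t \<otimes> u \<otimes> inv t) \<otimes> m \<otimes> ((inv m \<otimes> t \<otimes> m) \<otimes> b)"
    using 2 t s is_m_in Bp_closed(1) U_in[of "\<alpha> s"] by (simp add: m_assoc mult_inv_cancel)
  also have "\<dots> \<in> panel s"
  proof (rule panel_intro(2)[OF _ 2(2)])
    show "t \<otimes> u \<otimes> inv t \<in> U (\<alpha> s)"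
      using realizes_conj[OF T_realizes[OF t], of "\<alpha> s" u] s 2 by simp
    show "inv m \<otimes> t \<otimes> m \<otimes> b \<in> Bp"
      by (intro Bp_closed(2) T_Bp[OF m_conj_T[OF 2(2) t]] 2)
  qed
  finally show ?thesis .
qed

text \<open>Conjugating \<open>U\<^sub>\<beta>\<close> by \<open>U\<^sub>\<gamma>\<close> stays in the group generated by the positive root groups other
  than \<open>U\<^sub>\<alpha>\<close>, as soon as the commutator relations of the pair involve only such roots; and \<open>s\<close>
  permutes these root groups.\<close>

abbreviation "other_pos s \<equiv> pos_roots W S - {\<alpha> s}"

lemma other_pos_in: "(\<Union>\<beta>\<in>other_pos s. U \<beta>) \<subseteq> carrier G"
  using pos_gens_in by blast

lemma conj_in_other_pos:
  assumes \<gamma>: "\<gamma> \<in> \<Phi>" and \<beta>: "\<beta> \<in> other_pos s" and ne: "\<gamma> \<noteq> \<beta>" and pre: "prenilpotent W \<gamma> \<beta>"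
    and int: "open_root_interval W S \<gamma> \<beta> \<subseteq> other_pos s"
    and u: "u \<in> U \<gamma>" and x: "x \<in> U \<beta>"
  shows "inv u \<otimes> x \<otimes> u \<in> generate G (\<Union>\<beta>\<in>other_pos s. U \<beta>)"
proof -
  let ?X = "generate G (\<Union>\<beta>\<in>other_pos s. U \<beta>)"
  have \<beta>': "\<beta> \<in> \<Phi>" using \<beta> by (simp add: pos_roots_def)
  have in': "u \<in> carrier G" "x \<in> carrier G" using \<gamma> \<beta>' u x by auto
  have iu: "inv u \<in> U \<gamma>" using U_closed(2)[OF \<gamma> u] .
  have "inv u \<otimes> x \<otimes> inv (inv u) \<otimes> inv x \<in> commutator_subgroup G (U \<gamma>) (U \<beta>)"
    unfolding commutator_subgroup_def using iu x by (intro generate.incl) blast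
  also have "\<dots> \<subseteq> generate G (\<Union>\<gamma>\<in>open_root_interval W S \<gamma> \<beta>. U \<gamma>)"
    by (rule commutator_relations[OF \<gamma> \<beta>' ne pre])
  also have "\<dots> \<subseteq> ?X" using int by (intro mono_generate) blast
  finally have "inv u \<otimes> x \<otimes> u \<otimes> inv x \<in> ?X" using in' by simp
  moreover have "x \<in> ?X" using x \<beta> by (intro generate.incl) blast
  ultimately have "(inv u \<otimes> x \<otimes> u \<otimes> inv x) \<otimes> x \<in> ?X" by (rule generate.eng)
  then show ?thesis using in' by (simp add: m_assoc)
qed

lemma swap_other_pos:
  assumes s: "s \<in> S" and \<beta>: "\<beta> \<in> other_pos s"
  shows "s <#\<^bsub>W\<^esub> \<beta> \<in> pos_roots W S"
proof -
  have \<beta>': "\<beta> \<in> \<Phi>" "\<one>\<^bsub>W\<^esub> \<in> \<beta>" "\<beta> \<noteq> \<alpha> s" using \<beta> by (auto simp: pos_roots_def)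
  then have "s \<in> \<beta>" using Cox.root_separating_one_gen s by blast
  then show ?thesis
    using s \<beta>' by (simp add: pos_roots_def Cox.translate_root Cox.mem_l_coset_iff Cox.root_subset)
qed

lemma m_conj_other_pos:
  assumes m: "is_m s m" and x: "x \<in> generate G (\<Union>\<beta>\<in>other_pos s. U \<beta>)"
  shows "inv m \<otimes> x \<otimes> m \<in> Up"
proof -
  have s: "s \<in> S" using m by (simp add: is_m_def)
  have "inv m \<otimes> x \<otimes> inv (inv m) \<in> Up"
  proof (rule conj_generate[OF other_pos_in _ Up_subgroup _ x])
    show "inv m \<in> carrier G" using is_m_in[OF m] by simp
    fix y assume "y \<in> (\<Union>\<beta>\<in>other_pos s. U \<beta>)"
    then obtain \<beta> where \<beta>: "\<beta> \<in> other_pos s" "y \<in> U \<beta>" by blast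
    then have "\<beta> \<in> \<Phi>" by (simp add: pos_roots_def)
    from realizes_conj[OF is_m_realizes[OF is_m_inv[OF m]] this \<beta>(2)]
    show "inv m \<otimes> y \<otimes> inv (inv m) \<in> Up"
      by (rule Up_incl[OF swap_other_pos[OF s \<beta>(1)]])
  qed
  then show ?thesis using is_m_in[OF m] by simp
qed

lemma other_pos_Up: 
  assumes "x \<in> generate G (\<Union>\<beta>\<in>other_pos s. U \<beta>)"
  shows "x \<in> Up"
proof -
  have "generate G (\<Union>\<beta>\<in>other_pos s. U \<beta>) \<subseteq> Up"
    unfolding U_pos_def by (intro mono_generate) blast
  then show ?thesis using assms by blast
qed

text \<open>A positive root \<open>\<beta> \<noteq> \<alpha>\<close> either forms a prenilpotent pair with \<open>\<alpha>\<close>, or it contains \<open>-\<alpha>\<close>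
  and then forms one with \<open>-\<alpha>\<close>.  In both cases \<open>U\<^sub>\<beta>\<close> fixes every chamber of the panel: the two
  cases use the two descriptions of the panel.\<close>

lemma panel_left_other_pos:
  assumes s: "s \<in> S" and \<beta>: "\<beta> \<in> other_pos s" and x: "x \<in> U \<beta>" and g: "g \<in> panel s"
  shows "x \<otimes> g \<in> panel s"
proof (cases "prenilpotent W (\<alpha> s) \<beta>")
  case True
  have xB: "x \<in> Bp" using \<beta> x U_pos_Bp by blast
  have "open_root_interval W S (\<alpha> s) \<beta> \<subseteq> other_pos s"
    using s \<beta> by (auto simp: open_root_interval_def pos_roots_def)
  then have conj: "inv u \<otimes> x \<otimes> u \<in> generate G (\<Union>\<beta>\<in>other_pos s. U \<beta>)" if "u \<in> U (\<alpha> s)" for u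
    using conj_in_other_pos[OF _ \<beta> _ True _ that x] s \<beta> by blast
  show ?thesis using g
  proof (cases rule: panel_cases)
    case 1
    then show ?thesis by (intro panel_intro(1) Bp_closed(2) xB)
  next
    case (2 u m b)
    have "x \<otimes> g = u \<otimes> m \<otimes> ((inv m \<otimes> (inv u \<otimes> x \<otimes> u) \<otimes> m) \<otimes> b)"
      using 2 xB s is_m_in Bp_closed(1) U_in[of "\<alpha> s"] by (simp add: m_assoc mult_inv_cancel)
    also have "\<dots> \<in> panel s"
      by (intro panel_intro(2) Bp_closed(2) 2 Up_Bp[OF m_conj_other_pos[OF 2(2) conj[OF 2(1)]]])
    finally show ?thesis .
  qed
next
  case False
  have \<beta>': "\<beta> \<in> \<Phi>" "\<one>\<^bsub>W\<^esub> \<in> \<beta>" "\<beta> \<noteq> \<alpha> s" using \<beta> by (auto simp: pos_roots_def)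
  have xB: "x \<in> Bp" using \<beta> x U_pos_Bp by blast
  obtain m where m: "is_m s m" using ex_is_m[OF s] by blast
  have sub: "opp (\<alpha> s) \<subseteq> \<beta>"
  proof -
    have "\<alpha> s \<inter> \<beta> \<noteq> {}" using \<beta>' s Cox.one_in_simple_root[OF s] by blast
    then show ?thesis using False by (auto simp: prenilpotent_def opp_root_def)
  qed
  have s_opp: "s \<in> opp (\<alpha> s)" "\<one>\<^bsub>W\<^esub> \<notin> opp (\<alpha> s)" using s by (auto simp: opp_root_def)
  have ne: "opp (\<alpha> s) \<noteq> \<beta>" using \<beta>' s_opp by blast
  have "opp \<beta> \<subseteq> \<alpha> s" using sub by (auto simp: opp_root_def)
  then have inter: "opp (opp (\<alpha> s)) \<inter> opp \<beta> = opp \<beta>" using s by auto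
  have pre: "prenilpotent W (opp (\<alpha> s)) \<beta>"
    unfolding prenilpotent_def inter using sub s_opp Cox.root_nonempty[of "opp \<beta>"] \<beta>' by blast
  have int: "open_root_interval W S (opp (\<alpha> s)) \<beta> \<subseteq> other_pos s"
  proof
    fix \<gamma> assume "\<gamma> \<in> open_root_interval W S (opp (\<alpha> s)) \<beta>"
    then have \<gamma>: "\<gamma> \<in> \<Phi>" "opp (\<alpha> s) \<subseteq> \<gamma>" "\<gamma> \<noteq> opp (\<alpha> s)"
      using sub by (auto simp: open_root_interval_def)
    have "s \<in> \<gamma>" using \<gamma> s_opp by blast
    moreover have "\<one>\<^bsub>W\<^esub> \<in> \<gamma>"
    proof (rule ccontr)
      assume "\<one>\<^bsub>W\<^esub> \<notin> \<gamma>"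
      then have "\<one>\<^bsub>W\<^esub> \<in> opp \<gamma>" "s \<notin> opp \<gamma>"
        using \<open>s \<in> \<gamma>\<close> by (auto simp: opp_root_def)
      then have "opp \<gamma> = \<alpha> s"
        by (rule Cox.root_separating_one_gen[OF Cox.opp_root_root[OF \<gamma>(1)] s])
      then have "opp (opp \<gamma>) = opp (\<alpha> s)" by simp
      then show False using \<gamma> by simp
    qed
    ultimately show "\<gamma> \<in> other_pos s" using \<gamma> s by (auto simp: pos_roots_def)
  qed
  show ?thesis
  proof (rule panel_opp_cases[OF s m g])
    fix b assume b: "b \<in> Bp" "g = m \<otimes> b"
    have "x \<otimes> g = m \<otimes> ((inv m \<otimes> x \<otimes> m) \<otimes> b)"
      using b xB m is_m_in Bp_closed(1) by (simp add: m_assoc mult_inv_cancel)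
    also have "\<dots> \<in> panel s"
    proof (intro panel_opp_intro(1)[OF s m] Bp_closed(2)[OF _ b(1)] Up_Bp m_conj_other_pos[OF m])
      show "x \<in> generate G (\<Union>\<beta>\<in>other_pos s. U \<beta>)" using \<beta> x by (intro generate.incl) blast
    qed
    finally show ?thesis .
  next
    fix v b assume v: "v \<in> U (opp (\<alpha> s))" and b: "b \<in> Bp" "g = v \<otimes> b"
    have "x \<otimes> g = v \<otimes> ((inv v \<otimes> x \<otimes> v) \<otimes> b)"
      using b xB v s Bp_closed(1) U_in[OF opp_simple[OF s]] by (simp add: m_assoc mult_inv_cancel)
    also have "\<dots> \<in> panel s"
      by (intro panel_opp_intro(2)[OF s v] Bp_closed(2)[OF _ b(1)] Up_Bp[OF
          other_pos_Up[OF conj_in_other_pos[OF opp_simple[OF s] \<beta> ne pre int v x]]])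
    finally show ?thesis .
  qed
qed

lemma panel_left_Bp:
  assumes s: "s \<in> S" and x: "x \<in> Bp" and g: "g \<in> panel s"
  shows "x \<otimes> g \<in> panel s"
proof -
  have U\<beta>: "y \<otimes> g \<in> panel s" if "\<beta> \<in> pos_roots W S" "y \<in> U \<beta>" "g \<in> panel s" for y g \<beta>
    using panel_left_simple[OF s _ that(3)] panel_left_other_pos[OF s _ _ that(3)] that by blast
  have Up: "y \<otimes> g \<in> panel s" if "y \<in> Up" "g \<in> panel s" for y g
    using that unfolding U_pos_def
  proof (induction arbitrary: g rule: generate.induct)
    case one
    then show ?case using panel_in[OF s] by simp
  next
    case (incl h)
    then show ?case using U\<beta> by blast
  next
    case (inv h)
    then obtain \<beta> where \<beta>: "\<beta> \<in> pos_roots W S" "h \<in> U \<beta>" by blast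
    then have "inv h \<in> U \<beta>" using U_closed(2)[of \<beta> h] by (simp add: pos_roots_def)
    then show ?case using U\<beta> \<beta> inv by blast
  next
    case (eng h1 h2)
    then have "h1 \<otimes> (h2 \<otimes> g) \<in> panel s" by blast
    moreover have "h1 \<in> carrier G" "h2 \<in> carrier G" "g \<in> carrier G"
      using eng generate_in_carrier[OF pos_gens_in] panel_in[OF s] by auto
    ultimately show ?case by (simp add: m_assoc)
  qed
  obtain t y where ty: "t \<in> T" "y \<in> Up" "x = t \<otimes> y"
    using x by (auto simp: B_pos_def set_mult_def)
  then have "x \<otimes> g = t \<otimes> (y \<otimes> g)" using panel_in[OF s g] Up_in by (simp add: m_assoc)
  then show ?thesis using panel_left_T[OF s ty(1) Up[OF ty(2) g]] by simp
qed

end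

section \<open>Bruhat and Birkhoff decompositions\<close>

context group
begin

lemma l_coset_eq_iff:
  assumes H: "subgroup H G" and g: "g \<in> carrier G" and h: "h \<in> carrier G"
  shows "g <# H = h <# H \<longleftrightarrow> inv g \<otimes> h \<in> H"
proof
  have HG: "H \<subseteq> carrier G" using subgroup.subset[OF H] .
  assume "g <# H = h <# H"
  moreover have "h \<in> h <# H" using lcos_self[OF h H] .
  ultimately show "inv g \<otimes> h \<in> H" using mem_l_coset_iff[OF g HG, of h] by simp
next
  have HG: "H \<subseteq> carrier G" using subgroup.subset[OF H] .
  assume gh: "inv g \<otimes> h \<in> H"
  then have hg: "inv h \<otimes> g \<in> H"
    using subgroup.m_inv_closed[OF H gh] g h by (simp add: inv_mult_group)
  have "inv g \<otimes> x \<in> H \<longleftrightarrow> inv h \<otimes> x \<in> H" if x: "x \<in> carrier G" for x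
  proof -
    have "inv g \<otimes> x = (inv g \<otimes> h) \<otimes> (inv h \<otimes> x)" "inv h \<otimes> x = (inv h \<otimes> g) \<otimes> (inv g \<otimes> x)"
      using g h x by (simp_all add: m_assoc mult_inv_cancel)
    then show ?thesis using subgroup.m_closed[OF H] gh hg by metis
  qed
  then show "g <# H = h <# H"
    using mem_l_coset_iff[OF g HG] mem_l_coset_iff[OF h HG] by blast
qed

end

context root_group_datum
begin

abbreviation "ch g \<equiv> g <# Bp"
abbreviation "chm g \<equiv> g <# Bm"
abbreviation "wdist \<equiv> rgd_dist G W S T U"

lemma Bp_subset: "Bp \<subseteq> carrier G" and Bm_subset: "Bm \<subseteq> carrier G"
  using Bp_closed(1) Bm_closed(1) by auto

text \<open>The same computation gives the Bruhat decomposition (\<open>D = B\<^sub>+\<close>) and the Birkhoff decomposition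
  (\<open>D = B\<^sub>-\<close>): for each root \<open>\<beta>\<close>, one of \<open>U\<^sub>\<beta>\<close> and \<open>U\<^sub>-\<^sub>\<beta>\<close> lies in \<open>D\<close>, and the description of the
  panel is chosen accordingly.\<close>

lemma double_coset_panel:
  assumes D: "\<And>\<beta>. \<beta> \<in> \<Phi> \<Longrightarrow> U \<beta> \<subseteq> D \<or> U (opp \<beta>) \<subseteq> D" and one: "\<one> \<in> D"
    and n: "realizes n w" and s: "s \<in> S" and p: "p \<in> panel s"
  shows "\<exists>d\<in>D. \<exists>b\<in>Bp. n \<otimes> p = d \<otimes> n \<otimes> b \<or> (\<exists>m. is_m s m \<and> n \<otimes> p = d \<otimes> (n \<otimes> m) \<otimes> b)"
proof -
  have nG: "n \<in> carrier G" and w: "w \<in> carrier W" using realizes_in[OF n] by auto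
  let ?\<beta> = "w <#\<^bsub>W\<^esub> \<alpha> s"
  have "?\<beta> \<in> \<Phi>" using w s by (simp add: Cox.translate_root)
  then consider "U ?\<beta> \<subseteq> D" | "U (opp ?\<beta>) \<subseteq> D" using D by blast
  then show ?thesis
  proof cases
    case 1
    show ?thesis using p
    proof (cases rule: panel_cases)
      case 1
      then have "n \<otimes> p = \<one> \<otimes> n \<otimes> p" using nG by simp
      then show ?thesis using 1 one by blast
    next
      case (2 u m b)
      have "n \<otimes> p = (n \<otimes> u \<otimes> inv n) \<otimes> (n \<otimes> m) \<otimes> b"
        using 2 s nG is_m_in Bp_closed(1) U_in[of "\<alpha> s"] by (simp add: m_assoc mult_inv_cancel)
      moreover have "n \<otimes> u \<otimes> inv n \<in> D"
        using realizes_conj[OF n _ 2(1)] s 1 by auto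
      ultimately show ?thesis using 2 by blast
    qed
  next
    case 2
    obtain m where m: "is_m s m" using ex_is_m[OF s] by blast
    show ?thesis
    proof (rule panel_opp_cases[OF s m p])
      fix b assume b: "b \<in> Bp" "p = m \<otimes> b"
      have "n \<otimes> p = \<one> \<otimes> (n \<otimes> m) \<otimes> b"
        using b nG is_m_in[OF m] Bp_closed(1) by (simp add: m_assoc)
      then show ?thesis using b m one by blast
    next
      fix v b assume v: "v \<in> U (opp (\<alpha> s))" and b: "b \<in> Bp" "p = v \<otimes> b"
      have "n \<otimes> p = (n \<otimes> v \<otimes> inv n) \<otimes> n \<otimes> b"
        using b v s nG Bp_closed(1) U_in[OF opp_simple[OF s]] by (simp add: m_assoc mult_inv_cancel)
      moreover have "n \<otimes> v \<otimes> inv n \<in> U (w <#\<^bsub>W\<^esub> opp (\<alpha> s))"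
        using realizes_conj[OF n opp_simple[OF s] v] .
      then have "n \<otimes> v \<otimes> inv n \<in> D"
        using 2 w by (auto simp: Cox.opp_translate Cox.simple_root_subset)
      ultimately show ?thesis using b by blast
    qed
  qed
qed

text \<open>The set \<open>DNB\<^sub>+\<close> is stable under right multiplication by the rank one parabolic subgroups, and
  these generate the group, because every root group is conjugate under \<open>N\<close> to one of a simple
  root.\<close>

lemma double_coset_decomposition:
  assumes D: "subgroup D G" "\<And>\<beta>. \<beta> \<in> \<Phi> \<Longrightarrow> U \<beta> \<subseteq> D \<or> U (opp \<beta>) \<subseteq> D"
    and g: "g \<in> carrier G"
  shows "\<exists>d\<in>D. \<exists>n\<in>N. \<exists>b\<in>Bp. g = d \<otimes> n \<otimes> b"
proof -
  note DC = subgroup.mem_carrier[OF D(1)] subgroup.m_closed[OF D(1)] subgroup.one_closed[OF D(1)]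
  define Y where "Y = {d \<otimes> n \<otimes> b | d n b. d \<in> D \<and> n \<in> N \<and> b \<in> Bp}"
  define stab where "stab = {g \<in> carrier G. \<forall>y\<in>Y. y \<otimes> g \<in> Y}"
  have YI: "d \<otimes> n \<otimes> b \<in> Y" if "d \<in> D" "n \<in> N" "b \<in> Bp" for d n b
    unfolding Y_def using that by blast
  have YG: "y \<in> carrier G" if "y \<in> Y" for y
    using that DC(1) N_closed(1) Bp_closed(1) by (auto simp: Y_def)
  have mult: "g \<otimes> h \<in> stab" if "g \<in> stab" "h \<in> stab" for g h
    using that YG by (auto simp: stab_def m_assoc[symmetric])
  have panel: "p \<in> stab" if s: "s \<in> S" and p: "p \<in> panel s" for s p
  proof -
    have "y \<otimes> p \<in> Y" if y: "y \<in> Y" for y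
    proof -
      obtain d n b where y: "d \<in> D" "n \<in> N" "b \<in> Bp" "y = d \<otimes> n \<otimes> b"
        using y by (auto simp: Y_def)
      obtain w where w: "realizes n w" using N_realizes[OF y(2)] by blast
      have bp: "b \<otimes> p \<in> panel s" by (rule panel_left_Bp[OF s y(3) p])
      obtain d' b' where db: "d' \<in> D" "b' \<in> Bp" and
        "n \<otimes> (b \<otimes> p) = d' \<otimes> n \<otimes> b' \<or> (\<exists>m. is_m s m \<and> n \<otimes> (b \<otimes> p) = d' \<otimes> (n \<otimes> m) \<otimes> b')"
        using double_coset_panel[OF D(2) DC(3) w s bp] by blast
      then obtain n' where n': "n' \<in> N" "n \<otimes> (b \<otimes> p) = d' \<otimes> n' \<otimes> b'"
        using y(2) N_closed(2)[OF y(2) m_N] by blast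
      have "y \<otimes> p = d \<otimes> (n \<otimes> (b \<otimes> p))"
        using y DC(1) N_closed(1) Bp_closed(1) panel_in[OF s p] by (simp add: m_assoc)
      also have "\<dots> = (d \<otimes> d') \<otimes> n' \<otimes> b'"
        using y(1) db DC(1) N_closed(1)[OF n'(1)] Bp_closed(1) by (simp add: n'(2) m_assoc)
      finally show ?thesis using YI[OF DC(2)[OF y(1) db(1)] n'(1) db(2)] by simp
    qed
    then show ?thesis using panel_in[OF s p] by (simp add: stab_def)
  qed
  have T_stab: "t \<in> stab" if t: "t \<in> T" for t
  proof -
    have "d \<otimes> n \<otimes> b \<otimes> t = d \<otimes> n \<otimes> (b \<otimes> t)" if "d \<in> D" "n \<in> N" "b \<in> Bp" for d n b
      using that DC(1) N_closed(1) Bp_closed(1) t by (simp add: m_assoc)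
    then have "y \<otimes> t \<in> Y" if "y \<in> Y" for y
      using that YI Bp_closed(2)[OF _ T_Bp[OF t]] by (auto simp: Y_def)
    then show ?thesis using t by (simp add: stab_def)
  qed
  have m_stab: "m \<in> stab" if "is_m s m" for s m
    using panel[OF _ panel_opp_intro(1)[OF _ that Bp_closed(4)]] that is_m_in[OF that]
    by (simp add: is_m_def)
  have N_stab: "n \<in> stab" if "n \<in> N" for n
    using that unfolding N_eq
  proof (induction rule: generate.induct)
    case one
    then show ?case using T_stab T_closed(3) by blast
  next
    case (incl h)
    then show ?case using T_stab m_stab by blast
  next
    case (inv h)
    then show ?case using T_stab T_closed(2) m_stab is_m_inv by blast
  next
    case (eng h1 h2)
    then show ?case using mult by blast
  qed
  have U_stab: "x \<in> stab" if \<beta>: "\<beta> \<in> \<Phi>" and x: "x \<in> U \<beta>" for \<beta> x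
  proof -
    obtain w s where w: "w \<in> carrier W" "s \<in> S" "\<beta> = w <#\<^bsub>W\<^esub> \<alpha> s"
      by (rule Cox.root_cases[OF \<beta>])
    obtain n where n: "n \<in> N" "realizes n w" using ex_N_realizes[OF w(1)] by blast
    define y where "y = inv n \<otimes> x \<otimes> n"
    have nG: "n \<in> carrier G" and xG: "x \<in> carrier G" using n N_closed(1) x \<beta> by auto
    have "y \<in> U (\<alpha> s)"
      using realizes_inv_conj[OF n(2) \<beta> x] w by (simp add: y_def Cox.translate_translate)
    then have "y \<in> stab" using panel[OF w(2) panel_intro(1)[OF U_simple_Bp[OF w(2)]]] by blast
    moreover have "x = n \<otimes> y \<otimes> inv n"
      using nG xG by (simp add: y_def m_assoc mult_inv_cancel)
    ultimately show ?thesis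
      using mult N_stab[OF n(1)] N_stab[OF N_closed(3)[OF n(1)]] by simp
  qed
  have gen_stab: "x \<in> stab" if "x \<in> generate G (\<Union>\<beta>\<in>\<Phi>. U \<beta>)" for x
    using that
  proof (induction rule: generate.induct)
    case one
    then show ?case using T_stab T_closed(3) by blast
  next
    case (incl h)
    then show ?case using U_stab by blast
  next
    case (inv h)
    then show ?case using U_stab U_closed(2) by blast
  next
    case (eng h1 h2)
    then show ?case using mult by blast
  qed
  obtain t x where tx: "t \<in> T" "x \<in> generate G (\<Union>\<beta>\<in>\<Phi>. U \<beta>)" "g = t \<otimes> x"
    using g generated by (auto simp: set_mult_def)
  then have "g \<in> stab" using mult T_stab gen_stab by blast
  moreover have "\<one> \<in> Y" using YI[OF DC(3) N_closed(4) Bp_closed(4)] by simp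
  ultimately have "\<one> \<otimes> g \<in> Y" unfolding stab_def by blast
  then have "g \<in> Y" using g by simp
  then show ?thesis unfolding Y_def by blast
qed

lemma Bp_roots: "\<beta> \<in> \<Phi> \<Longrightarrow> U \<beta> \<subseteq> Bp \<or> U (opp \<beta>) \<subseteq> Bp"
  using pos_or_opp_pos U_pos_Bp by blast

lemma Bm_roots: "\<beta> \<in> \<Phi> \<Longrightarrow> U \<beta> \<subseteq> Bm \<or> U (opp \<beta>) \<subseteq> Bm"
  using neg_or_opp_neg Um_incl Um_Bm by blast

text \<open>Otherwise an element of \<open>B\<^sub>+\<close>, which normalizes \<open>U\<^sub>+\<close>, would conjugate a positive root group
  to that of a negative simple root, and the latter is not contained in \<open>U\<^sub>+\<close>.\<close>

lemma Bp_realizes_one: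
  assumes b: "b \<in> Bp" and w: "realizes b w"
  shows "w = \<one>\<^bsub>W\<^esub>"
proof (rule ccontr)
  assume "w \<noteq> \<one>\<^bsub>W\<^esub>"
  have wW: "w \<in> carrier W" using realizes_in[OF w] by simp
  obtain r where r: "r \<in> S" "Cox.len w = Cox.len (r \<otimes>\<^bsub>W\<^esub> w) + 1"
    using Cox.left_descent[OF wW \<open>w \<noteq> \<one>\<^bsub>W\<^esub>\<close>] by blast
  let ?\<beta> = "inv\<^bsub>W\<^esub> w <#\<^bsub>W\<^esub> opp (\<alpha> r)"
  have \<beta>: "?\<beta> \<in> \<Phi>" using r wW by (simp add: Cox.translate_root)
  have "\<one>\<^bsub>W\<^esub> \<notin> inv\<^bsub>W\<^esub> w <#\<^bsub>W\<^esub> \<alpha> r"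
    using Cox.one_in_translate_iff[of "inv\<^bsub>W\<^esub> w" r] r wW by (simp add: Cox.len_mult_gen Cox.len_inv)
  moreover have "?\<beta> = opp (inv\<^bsub>W\<^esub> w <#\<^bsub>W\<^esub> \<alpha> r)"
    using wW by (simp add: Cox.opp_translate Cox.simple_root_subset)
  ultimately have "?\<beta> \<in> pos_roots W S"
    using \<beta> by (simp add: pos_roots_def opp_root_def)
  then have "U ?\<beta> \<subseteq> Up" using Up_incl by blast
  then have "conj_set G b (U ?\<beta>) \<subseteq> Up" using Bp_normalizes_Up[OF b] by blast
  moreover have "conj_set G b (U ?\<beta>) = U (opp (\<alpha> r))"
    using w \<beta> r wW by (simp add: realizes_def Cox.translate_translate)
  ultimately show False using U_simple_opp[OF r(1)] by simp
qed

text \<open>Uniqueness in the Bruhat decomposition, by induction on the length of the shorter element: a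
  first letter \<open>s\<close> of \<open>w\<close> can be moved to the other side since \<open>sBw'B \<subseteq> Bw'B \<union> Bsw'B\<close>.\<close>

lemma Bruhat_unique_le:
  assumes "n \<in> N" "realizes n w" "n' \<in> N" "realizes n' w'" "b \<in> Bp" "b' \<in> Bp"
    "n' = b \<otimes> n \<otimes> b'" "Cox.len w \<le> Cox.len w'"
  shows "w = w'"
  using assms
proof (induction "Cox.len w" arbitrary: n w n' w' b b')
  case 0
  note n = 0(2) and n' = 0(4) and bb = 0(6,7)
  have w1: "w = \<one>\<^bsub>W\<^esub>" using 0 realizes_in Cox.len_eq_0 by metis
  then have n1: "realizes n \<one>\<^bsub>W\<^esub>" using 0 by simp
  have G: "n \<in> carrier G" "n' \<in> carrier G" "b \<in> carrier G" "b' \<in> carrier G"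
    using n n' bb N_closed(1) Bp_closed(1) by auto
  have "n' \<otimes> inv n = b \<otimes> (n \<otimes> b' \<otimes> inv n)" using G by (simp add: 0(8) m_assoc)
  also have "\<dots> \<in> Bp" by (intro Bp_closed(2) bb N_one_normalizes_Bp n n1)
  finally have "n' \<otimes> inv n \<in> Bp" .
  moreover have "realizes (n' \<otimes> inv n) w'"
    using realizes_mult[OF 0(5) realizes_inv[OF n1]] realizes_in(2)[OF 0(5)] by simp
  ultimately show ?case using Bp_realizes_one w1 by blast
next
  case (Suc k)
  note n = Suc.prems(1,2) and n' = Suc.prems(3,4) and bb = Suc.prems(5,6)
  have w: "w \<in> carrier W" "w' \<in> carrier W" using n n' realizes_in by auto
  have G: "n \<in> carrier G" "n' \<in> carrier G" "b \<in> carrier G" "b' \<in> carrier G"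
    using n n' bb N_closed(1) Bp_closed(1) by auto
  have "w \<noteq> \<one>\<^bsub>W\<^esub>" using Suc.hyps(2) by auto
  then obtain s where s: "s \<in> S" "Cox.len w = Cox.len (s \<otimes>\<^bsub>W\<^esub> w) + 1"
    using Cox.left_descent[OF w(1)] by blast
  obtain m where m: "is_m s m" using ex_is_m[OF s(1)] by blast
  have mG: "m \<in> carrier G" using is_m_in[OF m] .
  define n0 where "n0 = inv m \<otimes> n"
  have n0: "n0 \<in> N" "realizes n0 (s \<otimes>\<^bsub>W\<^esub> w)"
    using N_closed(2)[OF N_closed(3)[OF m_N[OF m]] n(1)]
      realizes_mult[OF realizes_inv[OF is_m_realizes[OF m]] n(2)] s(1) by (simp_all add: n0_def)
  have n0G: "n0 \<in> carrier G" using n0 N_closed(1) by blast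
  have "m \<in> panel s" using panel_opp_intro(1)[OF s(1) m Bp_closed(4)] mG by simp
  then have bm: "b \<otimes> m \<in> panel s" using panel_left_Bp[OF s(1) bb(1)] by blast
  obtain d c where dc: "d \<in> Bp" "c \<in> Bp" and alt: "inv n' \<otimes> (b \<otimes> m) = d \<otimes> inv n' \<otimes> c \<or>
      (\<exists>m'. is_m s m' \<and> inv n' \<otimes> (b \<otimes> m) = d \<otimes> (inv n' \<otimes> m') \<otimes> c)"
    using double_coset_panel[OF Bp_roots Bp_closed(4) realizes_inv[OF n'(2)] s(1) bm] by blast
  have dcG: "d \<in> carrier G" "c \<in> carrier G" using dc Bp_closed(1) by auto
  have IH: "s \<otimes>\<^bsub>W\<^esub> w = w1" if n1: "n1 \<in> N" "realizes n1 w1" and le: "Cox.len w \<le> Cox.len w1 + 1"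
    and eq: "inv n' \<otimes> (b \<otimes> m) = d \<otimes> inv n1 \<otimes> c" for n1 w1
  proof -
    have n1G: "n1 \<in> carrier G" using n1 N_closed(1) by blast
    have "n' = b \<otimes> m \<otimes> n0 \<otimes> b'" 
      using G mG by (simp add: n0_def Suc.prems(7) m_assoc mult_inv_cancel)
    then have "n0 = inv (inv n' \<otimes> (b \<otimes> m)) \<otimes> inv b'"
      using G mG n0G by (simp add: inv_mult_group m_assoc mult_inv_cancel)
    also have "\<dots> = inv c \<otimes> n1 \<otimes> (inv d \<otimes> inv b')"
      unfolding eq using G dcG n1G by (simp add: inv_mult_group m_assoc)
    finally have "n1 = c \<otimes> n0 \<otimes> (b' \<otimes> d)"
      using G dcG n1G by (simp add: m_assoc mult_inv_cancel)
    then show ?thesis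
      using Suc.hyps(1)[OF _ n0 n1 dc(2) Bp_closed(2)[OF bb(2) dc(1)]] Suc.hyps(2) s(2) le by simp
  qed
  from alt show ?case
  proof
    assume "inv n' \<otimes> (b \<otimes> m) = d \<otimes> inv n' \<otimes> c"
    then have "s \<otimes>\<^bsub>W\<^esub> w = w'" using IH[OF n'] Suc.prems(8) by simp
    then show ?thesis using s Suc.prems(8) by simp
  next
    assume "\<exists>m'. is_m s m' \<and> inv n' \<otimes> (b \<otimes> m) = d \<otimes> (inv n' \<otimes> m') \<otimes> c"
    then obtain m' where m': "is_m s m'" "inv n' \<otimes> (b \<otimes> m) = d \<otimes> (inv n' \<otimes> m') \<otimes> c" by blast
    have m'G: "m' \<in> carrier G" using is_m_in[OF m'(1)] .
    have "inv m' \<otimes> n' \<in> N" "realizes (inv m' \<otimes> n') (s \<otimes>\<^bsub>W\<^esub> w')"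
      using N_closed(2)[OF N_closed(3)[OF m_N[OF m'(1)]] n'(1)]
        realizes_mult[OF realizes_inv[OF is_m_realizes[OF m'(1)]] n'(2)] s(1) by simp_all
    moreover have "inv (inv m' \<otimes> n') = inv n' \<otimes> m'" using G m'G by (simp add: inv_mult_group)
    moreover have "Cox.len w \<le> Cox.len (s \<otimes>\<^bsub>W\<^esub> w') + 1"
      using Cox.len_gen_mult_cases[OF s(1) w(2)] Suc.prems(8) by linarith
    ultimately have "s \<otimes>\<^bsub>W\<^esub> w = s \<otimes>\<^bsub>W\<^esub> w'" using IH m'(2) by simp
    then show ?thesis using s(1) w by (metis Cox.gen_cancel)
  qed
qed

lemma Bruhat_unique:
  assumes n: "n \<in> N" "realizes n w" and n': "n' \<in> N" "realizes n' w'" and b: "b \<in> Bp" "b' \<in> Bp"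
    and eq: "n' = b \<otimes> n \<otimes> b'"
  shows "w = w'"
proof (cases "Cox.len w \<le> Cox.len w'")
  case True
  then show ?thesis using Bruhat_unique_le assms by blast
next
  case False
  have "n = inv b \<otimes> n' \<otimes> inv b'"
    using n b N_closed(1) Bp_closed(1) by (simp add: eq m_assoc mult_inv_cancel)
  then show ?thesis
    using Bruhat_unique_le[OF n' n Bp_closed(3)[OF b(1)] Bp_closed(3)[OF b(2)]] False by simp
qed

section \<open>Transitivity on pairs of opposite chambers\<close>

lemma weyl_lifts_iff:
  "w \<in> carrier W \<Longrightarrow> n \<in> weyl_lifts G W S T U w \<longleftrightarrow> n \<in> N \<and> realizes n w"
  using N_closed(1) by (auto simp: weyl_lifts_def realizes_def)

text \<open>Only uniqueness in the Bruhat decomposition determines the value of the definite description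
  in the Weyl distance.\<close>

lemma dist_eq:
  assumes g: "g \<in> carrier G" and h: "h \<in> carrier G" and b: "b \<in> Bp" "b' \<in> Bp"
    and n: "n \<in> N" "realizes n w" and eq: "inv g \<otimes> h = b \<otimes> n \<otimes> b'"
  shows "wdist (ch g) (ch h) = w"
  unfolding rgd_dist_def
proof (rule the_equality)
  have w: "w \<in> carrier W" using realizes_in[OF n(2)] by simp
  have G: "b \<in> carrier G" "b' \<in> carrier G" "n \<in> carrier G" using b n Bp_closed(1) N_closed(1) by auto
  have "inv (g \<otimes> b) \<otimes> (h \<otimes> inv b') = inv b \<otimes> (inv g \<otimes> h) \<otimes> inv b'"
    using g h G by (simp add: inv_mult_group m_assoc)
  also have "\<dots> = n" unfolding eq using G by (simp add: m_assoc mult_inv_cancel)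
  finally have "inv (g \<otimes> b) \<otimes> (h \<otimes> inv b') \<in> weyl_lifts G W S T U w"
    using n w by (simp add: weyl_lifts_iff)
  moreover have "g \<otimes> b \<in> ch g" "h \<otimes> inv b' \<in> ch h"
    using b Bp_closed(3) by (auto simp: l_coset_def)
  ultimately show "w \<in> carrier W \<and> (\<exists>x\<in>ch g. \<exists>y\<in>ch h. inv x \<otimes> y \<in> weyl_lifts G W S T U w)"
    using w by blast
  fix w' assume *: "w' \<in> carrier W \<and> (\<exists>x\<in>ch g. \<exists>y\<in>ch h. inv x \<otimes> y \<in> weyl_lifts G W S T U w')"
  then obtain b1 b2 where b12: "b1 \<in> Bp" "b2 \<in> Bp"
    "inv (g \<otimes> b1) \<otimes> (h \<otimes> b2) \<in> weyl_lifts G W S T U w'"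
    by (auto simp: l_coset_def)
  define n' where "n' = inv (g \<otimes> b1) \<otimes> (h \<otimes> b2)"
  have G': "b1 \<in> carrier G" "b2 \<in> carrier G" using b12 Bp_closed(1) by auto
  have n': "n' \<in> N" "realizes n' w'" using b12(3) * by (simp_all add: n'_def weyl_lifts_iff)
  have "n' = inv b1 \<otimes> (inv g \<otimes> h) \<otimes> b2"
    using g h G' by (simp add: n'_def inv_mult_group m_assoc)
  also have "\<dots> = (inv b1 \<otimes> b) \<otimes> n \<otimes> (b' \<otimes> b2)"
    unfolding eq using G G' by (simp add: m_assoc)
  finally have "w = w'"
    by (rule Bruhat_unique[OF n n' Bp_closed(2)[OF Bp_closed(3)[OF b12(1)] b(1)]
          Bp_closed(2)[OF b(2) b12(2)]])
  then show "w' = w" by simp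
qed

lemma dist_translate:
  assumes k: "k \<in> carrier G" and x: "x \<subseteq> carrier G" and y: "y \<subseteq> carrier G"
  shows "wdist (k <# x) (k <# y) = wdist x y"
proof -
  have "inv (k \<otimes> g) \<otimes> (k \<otimes> h) = inv g \<otimes> h" if "g \<in> x" "h \<in> y" for g h
    using k x y that by (auto simp: inv_mult_group m_assoc mult_inv_cancel subset_iff)
  then have "(\<exists>g\<in>k <# x. \<exists>h\<in>k <# y. inv g \<otimes> h \<in> L) \<longleftrightarrow> (\<exists>g\<in>x. \<exists>h\<in>y. inv g \<otimes> h \<in> L)" for L
    unfolding l_coset_def by simp
  then show ?thesis unfolding rgd_dist_def by simp
qed

lemma ch_subset: "g \<in> carrier G \<Longrightarrow> ch g \<subseteq> carrier G"
  and chm_subset: "g \<in> carrier G \<Longrightarrow> chm g \<subseteq> carrier G"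
  using l_coset_subset_G[OF Bp_subset] l_coset_subset_G[OF Bm_subset] by auto

lemma ch_eq_iff: "g \<in> carrier G \<Longrightarrow> h \<in> carrier G \<Longrightarrow> ch g = ch h \<longleftrightarrow> inv g \<otimes> h \<in> Bp"
  by (rule l_coset_eq_iff[OF Bp_subgroup])

lemma chm_eq_iff: "g \<in> carrier G \<Longrightarrow> h \<in> carrier G \<Longrightarrow> chm g = chm h \<longleftrightarrow> inv g \<otimes> h \<in> Bm"
  by (rule l_coset_eq_iff[OF Bm_subgroup])

lemma ch_mult: "g \<in> carrier G \<Longrightarrow> h \<in> carrier G \<Longrightarrow> g <# ch h = ch (g \<otimes> h)"
  and chm_mult: "g \<in> carrier G \<Longrightarrow> h \<in> carrier G \<Longrightarrow> g <# chm h = chm (g \<otimes> h)"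
  by (simp_all add: lcos_m_assoc Bp_subset Bm_subset)

lemma ch_mult_Bp: "g \<in> carrier G \<Longrightarrow> b \<in> Bp \<Longrightarrow> ch (g \<otimes> b) = ch g"
  using ch_eq_iff[of g "g \<otimes> b"] Bp_closed(1) by (simp add: mult_inv_cancel)

lemma chm_Bm: "b \<in> Bm \<Longrightarrow> chm b = chm \<one>"
  using chm_eq_iff[of \<one> b] Bm_closed(1) by simp

lemma dist_translate_chm:
  assumes g: "g \<in> carrier G" and b: "b \<in> Bm"
  shows "wdist (ch (b \<otimes> g)) (chm \<one>) = wdist (ch g) (chm \<one>)"
proof -
  have bG: "b \<in> carrier G" using b Bm_closed(1) by blast
  have "wdist (b <# ch g) (b <# chm \<one>) = wdist (ch g) (chm \<one>)"
    using bG g by (intro dist_translate ch_subset chm_subset) simp_all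
  then show ?thesis using bG g chm_Bm[OF b] by (simp add: ch_mult chm_mult)
qed

end

locale twin_root_group_datum = root_group_datum +
  assumes twin: "twin_building W S (lcosets Bp) wdist (lcosets Bm) wdist wdist"
begin

lemma building: "building W S (lcosets Bp) wdist"
  using twin by (simp add: twin_building_def)

lemmas codist = twin_building.codist_axioms_plus[OF twin]

lemma ch_in [simp, intro]: "g \<in> carrier G \<Longrightarrow> ch g \<in> lcosets Bp"
  and chm_in [simp, intro]: "g \<in> carrier G \<Longrightarrow> chm g \<in> lcosets Bm"
  by (auto simp: LCOSETS_def)

lemma lcosets_cases:
  assumes "x \<in> lcosets Bp"
  obtains g where "g \<in> carrier G" "x = ch g"
  using assms by (auto simp: LCOSETS_def)

text \<open>This is the faithfulness of the action of \<open>N\<close> modulo \<open>B\<^sub>+ \<inter> N\<close> on the root groups.  It is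
  read off from the building, where only equal chambers have distance \<open>1\<close>.\<close>

lemma N_realizes_one_in_Bp:
  assumes n: "n \<in> N" "realizes n \<one>\<^bsub>W\<^esub>"
  shows "n \<in> Bp"
proof -
  have nG: "n \<in> carrier G" using n N_closed(1) by blast
  have "wdist (ch \<one>) (ch n) = \<one>\<^bsub>W\<^esub>"
    using dist_eq[OF one_closed nG Bp_closed(4) Bp_closed(4) n] nG by simp
  then have "ch \<one> = ch n" using building.WD1[OF building] nG by simp
  then show ?thesis using ch_eq_iff[of \<one> n] nG by simp
qed

lemma adjacent_in_panel:
  assumes g: "g \<in> carrier G" and h: "h \<in> carrier G" and s: "s \<in> S" and adj: "wdist (ch g) (ch h) = s"
  shows "inv g \<otimes> h \<in> panel s"
proof -
  have "inv g \<otimes> h \<in> carrier G" using g h by simp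
  then obtain b n b' where b: "b \<in> Bp" "b' \<in> Bp" and n: "n \<in> N" and eq: "inv g \<otimes> h = b \<otimes> n \<otimes> b'"
    using double_coset_decomposition[OF Bp_subgroup Bp_roots] by blast
  obtain w where w: "realizes n w" using N_realizes[OF n] by blast
  have "w = s" using dist_eq[OF g h b n w eq] adj by simp
  obtain m where m: "is_m s m" using ex_is_m[OF s] by blast
  have G: "b \<in> carrier G" "b' \<in> carrier G" "n \<in> carrier G" "m \<in> carrier G"
    using b n Bp_closed(1) N_closed(1) is_m_in[OF m] by auto
  have "realizes (inv m \<otimes> n) \<one>\<^bsub>W\<^esub>"
    using realizes_mult[OF realizes_inv[OF is_m_realizes[OF m]] w] s \<open>w = s\<close> by simp
  then have mn: "inv m \<otimes> n \<in> Bp"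
    using N_realizes_one_in_Bp N_closed(2)[OF N_closed(3)[OF m_N[OF m]] n] by blast
  then have "b \<otimes> (m \<otimes> ((inv m \<otimes> n) \<otimes> b')) \<in> panel s"
    by (intro panel_left_Bp[OF s b(1)] panel_opp_intro(1)[OF s m] Bp_closed(2)[OF mn b(2)])
  then show ?thesis using G by (simp add: eq m_assoc mult_inv_cancel)
qed

lemma panel_adjacent:
  assumes g: "g \<in> carrier G" and s: "s \<in> S" and h: "h \<in> panel s" "h \<notin> Bp"
  shows "wdist (ch g) (ch (g \<otimes> h)) = s"
  using h(1)
proof (cases rule: panel_cases)
  case (2 u m b)
  have hG: "h \<in> carrier G" using panel_in[OF s h(1)] .
  have "inv g \<otimes> (g \<otimes> h) = u \<otimes> m \<otimes> b" using g hG 2 by (simp add: mult_inv_cancel)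
  then show ?thesis
    using dist_eq[OF g _ U_simple_Bp[OF s 2(1)] 2(3) m_N[OF 2(2)] is_m_realizes[OF 2(2)]] g hG
    by simp
qed (use h in blast)

text \<open>Write \<open>c\<^sub>\<plusminus>\<close> for the chambers \<open>B\<^sub>\<plusminus>\<close>.  If \<open>w\<alpha>\<^sub>s > 0\<close> then the conjugate of \<open>U\<^sub>-\<^sub>\<alpha>\<close> under \<open>n\<close>
  fixes \<open>c\<^sub>-\<close> and permutes transitively the chambers of the panel other than \<open>nmc\<^sub>+\<close>, of which there
  are at least two.  All of these have the same codistance from \<open>c\<^sub>-\<close>.  In every panel exactly one
  chamber has a longer codistance than the others, so it is \<open>nmc\<^sub>+\<close>.\<close>

lemma codist_ascends:
  assumes n: "n \<in> N" "realizes n w" and m: "is_m s m"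
    and asc: "Cox.len w < Cox.len (w \<otimes>\<^bsub>W\<^esub> s)"
  shows "Cox.len (wdist (ch (n \<otimes> m)) (chm \<one>)) = Cox.len (wdist (ch n) (chm \<one>)) + 1"
proof -
  have s: "s \<in> S" using m by (simp add: is_m_def)
  have nG: "n \<in> carrier G" and wW: "w \<in> carrier W" using realizes_in[OF n(2)] by auto
  have mG: "m \<in> carrier G" using is_m_in[OF m] .
  note cx = codist_axiomsD[OF codist]
  let ?F = "wdist (ch n) (chm \<one>)"
  have F: "?F \<in> carrier W" using cx(1) nG by simp
  have neg: "opp (w <#\<^bsub>W\<^esub> \<alpha> s) \<in> neg_roots W S"
    using asc wW s Cox.one_in_translate_iff[OF wW s]
    by (simp add: neg_roots_def pos_roots_def Cox.translate_root opp_root_def[of W "w <#\<^bsub>W\<^esub> \<alpha> s"]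
        Cox.opp_root_root[unfolded opp_root_def])
  have same: "wdist (ch (n \<otimes> v)) (chm \<one>) = ?F" if v: "v \<in> U (opp (\<alpha> s))" for v
  proof -
    have vG: "v \<in> carrier G" using v s by auto
    have "n \<otimes> v \<otimes> inv n \<in> U (w <#\<^bsub>W\<^esub> opp (\<alpha> s))"
      using realizes_conj[OF n(2) opp_simple[OF s] v] .
    then have "n \<otimes> v \<otimes> inv n \<in> Bm"
      using Um_Bm[OF Um_incl[OF neg]] wW by (simp add: Cox.opp_translate Cox.simple_root_subset)
    from dist_translate_chm[OF nG this] show ?thesis using nG vG by (simp add: m_assoc)
  qed
  obtain x' where x': "x' \<in> lcosets Bp" "wdist x' (ch n) = s"
    "wdist x' (chm \<one>) = s \<otimes>\<^bsub>W\<^esub> ?F"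
    using cx(3)[OF ch_in[OF nG] chm_in[OF one_closed] s] by blast
  obtain h where h: "h \<in> carrier G" "x' = ch h" by (rule lcosets_cases[OF x'(1)])
  have "wdist (ch n) (ch h) = s"
    using building.adj_sym[OF building x'(1) ch_in[OF nG] s x'(2)] unfolding h(2) .
  then have p: "inv n \<otimes> h \<in> panel s" using adjacent_in_panel nG h(1) s by blast
  have h_eq: "h = n \<otimes> (inv n \<otimes> h)" using nG h by (simp add: mult_inv_cancel)
  have sF: "s \<otimes>\<^bsub>W\<^esub> ?F \<noteq> ?F" using Cox.len_gen_mult_neq[OF s F] by metis
  have nm: "wdist (ch (n \<otimes> m)) (chm \<one>) = s \<otimes>\<^bsub>W\<^esub> ?F"
  proof (rule panel_opp_cases[OF s m p])
    fix b assume b: "b \<in> Bp" "inv n \<otimes> h = m \<otimes> b"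
    then have "h = (n \<otimes> m) \<otimes> b" using h_eq nG mG Bp_closed(1) by (simp add: m_assoc)
    then have "x' = ch (n \<otimes> m)" using h(2) ch_mult_Bp[of "n \<otimes> m" b] nG mG b(1) by simp
    then show ?thesis using x'(3) by simp
  next
    fix v b assume v: "v \<in> U (opp (\<alpha> s))" and b: "b \<in> Bp" "inv n \<otimes> h = v \<otimes> b"
    have vG: "v \<in> carrier G" using v s by auto
    have "h = (n \<otimes> v) \<otimes> b" using h_eq b nG vG Bp_closed(1) by (simp add: m_assoc)
    then have "x' = ch (n \<otimes> v)" using h(2) ch_mult_Bp[of "n \<otimes> v" b] nG vG b(1) by simp
    then show ?thesis using x'(3) same[OF v] sF by simp
  qed
  have "\<not> Cox.len (s \<otimes>\<^bsub>W\<^esub> ?F) < Cox.len ?F"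
  proof
    assume less: "Cox.len (s \<otimes>\<^bsub>W\<^esub> ?F) < Cox.len ?F"
    obtain v where v: "v \<in> U (opp (\<alpha> s))" "v \<notin> Bp" using U_opp_not_in_Bp[OF s] by blast
    have vG: "v \<in> carrier G" using v s by auto
    have "v \<in> panel s" using panel_opp_intro(2)[OF s v(1) Bp_closed(4)] vG by simp
    then have "wdist (ch n) (ch (n \<otimes> v)) = s" using panel_adjacent[OF nG s _ v(2)] by blast
    then have "wdist (ch (n \<otimes> v)) (ch n) = s"
      by (rule building.adj_sym[OF building ch_in[OF nG] ch_in[OF m_closed[OF nG vG]] s])
    from cx(2)[OF ch_in[OF nG] chm_in[OF one_closed] _ s this less] nG vG
    show False using same[OF v(1)] sF by simp
  qed
  then show ?thesis using nm Cox.len_gen_mult_cases[OF s F] by auto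
qed

text \<open>The codistance of \<open>nc\<^sub>+\<close> from \<open>c\<^sub>-\<close> is longer than that of \<open>c\<^sub>+\<close> by the length of \<open>w\<close>, so
  it can be \<open>1\<close> only at \<open>c\<^sub>+\<close>.  Its value at \<open>c\<^sub>+\<close> is found from the existence of some chamber opposite \<open>c\<^sub>-\<close>.\<close>

lemma len_codist_N:
  assumes "n \<in> N" "realizes n w"
  shows "Cox.len (wdist (ch n) (chm \<one>)) = Cox.len (wdist (ch \<one>) (chm \<one>)) + Cox.len w"
  using assms
proof (induction "Cox.len w" arbitrary: n w)
  case 0
  then have "w = \<one>\<^bsub>W\<^esub>" using realizes_in Cox.len_eq_0 by metis
  then have "n \<in> Bp" using 0 N_realizes_one_in_Bp by blast
  then have "ch n = ch \<one>" using ch_mult_Bp[of \<one> n] Bp_closed(1) by simp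
  then show ?case using 0 by simp
next
  case (Suc k)
  have w: "w \<in> carrier W" and nG: "n \<in> carrier G" using Suc.prems realizes_in by auto
  have "w \<noteq> \<one>\<^bsub>W\<^esub>" using Suc.hyps(2) by auto
  then obtain s where s: "s \<in> S" "Cox.len w = Cox.len (w \<otimes>\<^bsub>W\<^esub> s) + 1"
    using Cox.right_descent[OF w] by blast
  obtain m where m: "is_m s m" using ex_is_m[OF s(1)] by blast
  have mG: "m \<in> carrier G" using is_m_in[OF m] .
  define n0 where "n0 = n \<otimes> inv m"
  have n0: "n0 \<in> N" "realizes n0 (w \<otimes>\<^bsub>W\<^esub> s)"
    using N_closed(2)[OF Suc.prems(1) N_closed(3)[OF m_N[OF m]]]
      realizes_mult[OF Suc.prems(2) realizes_inv[OF is_m_realizes[OF m]]] s(1)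
    by (simp_all add: n0_def)
  have "n0 \<otimes> m = n" using nG mG by (simp add: n0_def m_assoc)
  moreover have "Cox.len (w \<otimes>\<^bsub>W\<^esub> s \<otimes>\<^bsub>W\<^esub> s) = Cox.len w" using w s(1) by (simp add: Cox.m_assoc)
  ultimately show ?case
    using codist_ascends[OF n0 m] Suc.hyps(1)[OF _ n0] Suc.hyps(2) s(2) by simp
qed

lemma exists_opposite: "\<exists>x\<in>lcosets Bp. wdist x (chm \<one>) = \<one>\<^bsub>W\<^esub>"
proof -
  note cx = codist_axiomsD[OF codist]
  have "\<exists>x\<in>lcosets Bp. wdist x (chm \<one>) = \<one>\<^bsub>W\<^esub>" if "x \<in> lcosets Bp" for x
    using that
  proof (induction "Cox.len (wdist x (chm \<one>))" arbitrary: x)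
    case 0
    have "wdist x (chm \<one>) \<in> carrier W" using cx(1) 0 by simp
    then have "wdist x (chm \<one>) = \<one>\<^bsub>W\<^esub>" using 0 Cox.len_eq_0 by metis
    then show ?case using 0 by blast
  next
    case (Suc k)
    have F: "wdist x (chm \<one>) \<in> carrier W" using cx(1) Suc by simp
    have "wdist x (chm \<one>) \<noteq> \<one>\<^bsub>W\<^esub>" using Suc.hyps(2) by auto
    then obtain s where s: "s \<in> S"
      "Cox.len (wdist x (chm \<one>)) = Cox.len (s \<otimes>\<^bsub>W\<^esub> wdist x (chm \<one>)) + 1"
      using Cox.left_descent[OF F] by blast
    obtain x' where x': "x' \<in> lcosets Bp" "wdist x' (chm \<one>) = s \<otimes>\<^bsub>W\<^esub> wdist x (chm \<one>)"
      using cx(3)[OF Suc.prems chm_in[OF one_closed] s(1)] by blast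
    show ?case using Suc.hyps(1)[OF _ x'(1)] Suc.hyps(2) s(2) x'(2) by simp
  qed
  then show ?thesis using ch_in[OF one_closed] by blast
qed

lemma codist_one:
  assumes g: "g \<in> carrier G" and opp: "wdist (ch g) (chm \<one>) = \<one>\<^bsub>W\<^esub>"
  shows "\<exists>d\<in>Bm. ch g = ch d" and "wdist (ch \<one>) (chm \<one>) = \<one>\<^bsub>W\<^esub>"
proof -
  obtain d n b where d: "d \<in> Bm" "n \<in> N" "b \<in> Bp" "g = d \<otimes> n \<otimes> b"
    using double_coset_decomposition[OF Bm_subgroup Bm_roots g] by blast
  obtain w where w: "realizes n w" using N_realizes[OF d(2)] by blast
  have G: "d \<in> carrier G" "n \<in> carrier G" "b \<in> carrier G"
    using d Bm_closed(1) N_closed(1) Bp_closed(1) by auto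
  have ch: "ch g = ch (d \<otimes> n)" using d G by (simp add: ch_mult_Bp)
  then have "wdist (ch n) (chm \<one>) = \<one>\<^bsub>W\<^esub>" using opp dist_translate_chm[OF G(2) d(1)] by simp
  then have *: "Cox.len (wdist (ch \<one>) (chm \<one>)) + Cox.len w = 0"
    using len_codist_N[OF d(2) w] by simp
  then have "w = \<one>\<^bsub>W\<^esub>" using Cox.len_eq_0 realizes_in(2)[OF w] by simp
  then have "n \<in> Bp" using N_realizes_one_in_Bp d(2) w by simp
  then show "\<exists>d\<in>Bm. ch g = ch d" using ch d(1) G ch_mult_Bp by auto
  show "wdist (ch \<one>) (chm \<one>) = \<one>\<^bsub>W\<^esub>"
    using * Cox.len_eq_0 codist_axiomsD(1)[OF codist] by simp
qed

lemma base_opposite: "wdist (ch \<one>) (chm \<one>) = \<one>\<^bsub>W\<^esub>"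
proof -
  obtain x where x: "x \<in> lcosets Bp" "wdist x (chm \<one>) = \<one>\<^bsub>W\<^esub>" using exists_opposite by blast
  obtain g where "g \<in> carrier G" "x = ch g" by (rule lcosets_cases[OF x(1)])
  then show ?thesis using codist_one(2) x(2) by blast
qed

lemma opposite_transitive:
  assumes x: "x \<in> lcosets Bp" and y: "y \<in> lcosets Bm" and opp: "wdist x y = \<one>\<^bsub>W\<^esub>"
  shows "\<exists>k\<in>carrier G. k <# Bp = x \<and> k <# Bm = y"
proof -
  obtain g where g: "g \<in> carrier G" "x = ch g" by (rule lcosets_cases[OF x])
  obtain h where h: "h \<in> carrier G" "y = chm h" using y by (auto simp: LCOSETS_def)
  have "wdist (inv h <# ch g) (inv h <# chm h) = \<one>\<^bsub>W\<^esub>"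
    using dist_translate[of "inv h" "ch g" "chm h"] g h opp ch_subset chm_subset by simp
  then have "wdist (ch (inv h \<otimes> g)) (chm \<one>) = \<one>\<^bsub>W\<^esub>"
    using g h by (simp add: ch_mult chm_mult)
  then obtain d where d: "d \<in> Bm" "ch (inv h \<otimes> g) = ch d"
    using codist_one(1)[of "inv h \<otimes> g"] g h by auto
  have dG: "d \<in> carrier G" using d Bm_closed(1) by blast
  have "h <# ch (inv h \<otimes> g) = h <# ch d" using d by simp
  then have "ch (h \<otimes> d) = x" using g h dG by (simp add: ch_mult mult_inv_cancel)
  moreover have "chm (h \<otimes> d) = y"
    using chm_eq_iff[of h "h \<otimes> d"] h dG d by (simp add: mult_inv_cancel)
  ultimately show ?thesis using h dG by (intro bexI[of _ "h \<otimes> d"]) simp_all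
qed

lemma translation_opposite_transitive:
  "opposite_transitive_action W S (lcosets Bp) wdist (lcosets Bm) wdist wdist G
    (\<lambda>g x. g <# x) (\<lambda>g y. g <# y) (ch \<one>) (chm \<one>)"
proof -
  interpret twin_building W S "lcosets Bp" wdist "lcosets Bm" wdist wdist by (rule twin)
  have sub: "x \<subseteq> carrier G" if "x \<in> lcosets Bp" for x
    using that ch_subset by (auto simp: LCOSETS_def)
  have subm: "y \<subseteq> carrier G" if "y \<in> lcosets Bm" for y
    using that chm_subset by (auto simp: LCOSETS_def)
  show ?thesis
  proof unfold_locales
    show "g <# x \<in> lcosets Bp" if "g \<in> carrier G" "x \<in> lcosets Bp" for g x
      using that by (auto simp: LCOSETS_def ch_mult)
    show "g <# x \<in> lcosets Bm" if "g \<in> carrier G" "x \<in> lcosets Bm" for g x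
      using that by (auto simp: LCOSETS_def chm_mult)
    show "\<exists>g\<in>carrier G. g <# ch \<one> = x \<and> g <# chm \<one> = y"
      if "x \<in> lcosets Bp" "y \<in> lcosets Bm" "wdist x y = \<one>\<^bsub>W\<^esub>" for x y
      using opposite_transitive[OF that] by (simp add: ch_mult chm_mult)
  qed (simp_all add: lcos_m_assoc lcos_mult_one dist_translate sub subm base_opposite)
qed

end

section \<open>Word lengths and quasi-isometries\<close>

context group
begin

lemma word_length_list_mult_le:
  assumes A: "A \<subseteq> carrier G" "generate G A = carrier G"
    and M: "\<And>e. e \<in> E \<Longrightarrow> word_length G A e \<le> M" and E: "E \<subseteq> carrier G"
  shows "set xs \<subseteq> E \<Longrightarrow> word_length G A (list_mult G xs) \<le> M * length xs"
proof (induction xs)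
  case Nil
  then show ?case using word_length_le[of "[]" A \<one>] by simp
next
  case (Cons e xs)
  have in': "e \<in> carrier G" "list_mult G xs \<in> carrier G"
    using Cons.prems E list_mult_closed[of xs] by auto
  obtain us where us: "set us \<subseteq> A \<union> m_inv G ` A" "list_mult G us = e" 
    "length us = word_length G A e"
    using obtain_shortest_word[OF A(1), of e] in' A(2) by auto
  obtain vs where vs: "set vs \<subseteq> A \<union> m_inv G ` A" "list_mult G vs = list_mult G xs" 
    "length vs = word_length G A (list_mult G xs)"
    using obtain_shortest_word[OF A(1), of "list_mult G xs"] in' A(2) by auto
  have sub: "A \<union> m_inv G ` A \<subseteq> carrier G" using A(1) by auto
  have "list_mult G (us @ vs) = e \<otimes> list_mult G xs"
    using list_mult_append[OF order_trans[OF us(1) sub] order_trans[OF vs(1) sub]] us(2) vs(2)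
    by simp
  then have "word_length G A (e \<otimes> list_mult G xs) \<le> length (us @ vs)"
    using us vs by (intro word_length_le) auto
  also have "\<dots> \<le> M + M * length xs"
    using us(3) vs(3) M[of e] Cons by auto
  finally show ?case by simp
qed

end

lemma quasi_isometric_embedding_of_linear_bounds:
  fixes L1 L2 C2 :: nat
  assumes "X \<subseteq> Y"
    and "\<And>x y. x \<in> X \<Longrightarrow> y \<in> X \<Longrightarrow> lY x y \<le> L1 * lX x y"
    and "\<And>x y. x \<in> X \<Longrightarrow> y \<in> X \<Longrightarrow> lX x y \<le> L2 * lY x y + C2"
  shows "quasi_isometric_embedding X (\<lambda>x y. real (lX x y)) Y (\<lambda>x y. real (lY x y)) (\<lambda>x. x)"
proof -
  \<comment> \<open>one constant \<open>L \<ge> 1\<close> that dominates both slopes\<close>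
  define L where "L = real (1 + L1 + L2)"
  have L: "L \<ge> 1" "L > 0" by (simp_all add: L_def)
  have "real (lX x y) / L - real C2 \<le> real (lY x y) \<and> real (lY x y) \<le> L * real (lX x y) + real C2"
    if xy: "x \<in> X" "y \<in> X" for x y
  proof
    have "real (lX x y) \<le> real L2 * real (lY x y) + real C2"
      using assms(3)[OF xy] by (metis of_nat_add of_nat_le_iff of_nat_mult)
    also have "\<dots> \<le> L * real (lY x y) + L * real C2"
      using L by (intro add_mono mult_right_mono) (auto simp: L_def mult_le_cancel_right1)
    finally show "real (lX x y) / L - real C2 \<le> real (lY x y)"
      using L by (simp add: field_simps)
    have "real (lY x y) \<le> real L1 * real (lX x y)"
      using assms(2)[OF xy] by (metis of_nat_le_iff of_nat_mult)
    also have "\<dots> \<le> L * real (lX x y)" by (intro mult_right_mono) (auto simp: L_def)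
    finally show "real (lY x y) \<le> L * real (lX x y) + real C2" by simp
  qed
  then show ?thesis
    unfolding quasi_isometric_embedding_def using assms(1) L
    by (intro conjI exI[of _ L] exI[of _ "real C2"]) auto
qed

section \<open>Discrete subgroups and proper actions\<close>

lemma topological_group_DirProd:
  assumes "topological_group G X" "topological_group H Y"
  shows "topological_group (G \<times>\<times> H) (prod_topology X Y)"
proof -
  interpret G: topological_group G X by fact
  interpret H: topological_group H Y by fact
  interpret GH: group "G \<times>\<times> H" by (rule DirProd_group) unfold_locales
  show ?thesis
  proof unfold_locales
    show "topspace (prod_topology X Y) = carrier (G \<times>\<times> H)"
      by (simp add: G.topspace_eq H.topspace_eq DirProd_def)
    let ?P = "prod_topology X Y"
    have fst: "continuous_map (prod_topology ?P ?P) X (\<lambda>z. fst (fst z))"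
      "continuous_map (prod_topology ?P ?P) X (\<lambda>z. fst (snd z))"
      and snd: "continuous_map (prod_topology ?P ?P) Y (\<lambda>z. snd (fst z))"
      "continuous_map (prod_topology ?P ?P) Y (\<lambda>z. snd (snd z))"
      by (auto intro: continuous_map_fst_of continuous_map_snd_of continuous_map_fst
          continuous_map_snd continuous_map_compose[unfolded o_def])
    have "continuous_map (prod_topology ?P ?P) ?P (\<lambda>z. (fst (fst z) \<otimes>\<^bsub>G\<^esub> fst (snd z),
        snd (fst z) \<otimes>\<^bsub>H\<^esub> snd (snd z)))"
      using continuous_map_compose[OF continuous_map_pairedI[OF fst] G.continuous_mult]
        continuous_map_compose[OF continuous_map_pairedI[OF snd] H.continuous_mult]
      by (intro continuous_map_pairedI) (simp_all add: o_def)
    then show "continuous_map (prod_topology ?P ?P) ?P (\<lambda>(x, y). x \<otimes>\<^bsub>G \<times>\<times> H\<^esub> y)"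
      by (simp add: case_prod_unfold DirProd_def)
    have "continuous_map ?P ?P (\<lambda>z. (inv\<^bsub>G\<^esub> fst z, inv\<^bsub>H\<^esub> snd z))"
      using continuous_map_compose[OF continuous_map_fst G.continuous_inv]
        continuous_map_compose[OF continuous_map_snd H.continuous_inv]
      by (intro continuous_map_pairedI) (simp_all add: o_def)
    then show "continuous_map ?P ?P (\<lambda>x. inv\<^bsub>G \<times>\<times> H\<^esub> x)"
      by (rule continuous_map_eq)
        (auto simp: G.topspace_eq H.topspace_eq inv_DirProd[OF G.is_group H.is_group])
  qed
qed

text \<open>Every point has a neighbourhood in which quotients are so close to \<open>1\<close> that it contains at most
  one element of the discrete subgroup; finitely many such neighbourhoods cover \<open>K\<close>.\<close>

lemma (in topological_group) discrete_subgroup_Int_compact_finite: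
  assumes H: "subgroup H G" and disc: "subtopology X H = discrete_topology H"
    and K: "compactin X K"
  shows "finite (H \<inter> K)"
proof -
  have "openin (subtopology X H) {\<one>}"
    using subgroup.one_closed[OF H] by (simp add: disc)
  then obtain V where V: "openin X V" "{\<one>} = V \<inter> H"
    by (auto simp: openin_subtopology)
  let ?q = "\<lambda>z. inv (fst z) \<otimes> snd z"
  have "continuous_map (prod_topology X X) (prod_topology X X) (\<lambda>z. (inv (fst z), snd z))"
    using continuous_map_compose[OF continuous_map_fst continuous_inv]
    by (intro continuous_map_pairedI) (simp_all add: o_def continuous_map_snd)
  then have q: "continuous_map (prod_topology X X) X ?q"
    using continuous_map_compose[OF _ continuous_mult] by (fastforce simp: o_def)
  define Z where "Z = {z \<in> topspace (prod_topology X X). ?q z \<in> V}"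
  have pre: "openin (prod_topology X X) Z"
    unfolding Z_def using q V(1) by (rule openin_continuous_map_preimage)
  have "\<exists>B. openin X B \<and> p \<in> B \<and> (\<forall>x\<in>B \<inter> H. \<forall>y\<in>B \<inter> H. x = y)" if p: "p \<in> topspace X" for p
  proof -
    have "(p, p) \<in> Z"
      using p V(2) by (auto simp: topspace_eq Z_def)
    then obtain U1 U2 where U: "openin X U1" "openin X U2" "p \<in> U1" "p \<in> U2" "U1 \<times> U2 \<subseteq> Z"
      using pre[unfolded openin_prod_topology_alt, rule_format, of p p] by auto
    have "x = y" if xy: "x \<in> U1 \<inter> U2 \<inter> H" "y \<in> U1 \<inter> U2 \<inter> H" for x y
    proof -
      have "inv x \<otimes> y \<in> V" using U(5) xy by (auto simp: Z_def)
      moreover have "inv x \<otimes> y \<in> H"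
        using xy H by (simp add: subgroup.m_closed subgroup.m_inv_closed)
      ultimately have "inv x \<otimes> y = \<one>" using V(2) by blast
      then show ?thesis
        using xy subgroup.mem_carrier[OF H] mult_inv_cancel(1)[of x y] by simp
    qed
    then show ?thesis using U by (intro exI[of _ "U1 \<inter> U2"]) auto
  qed
  then obtain N where N: "\<And>p. p \<in> topspace X \<Longrightarrow> openin X (N p)" 
    "\<And>p. p \<in> topspace X \<Longrightarrow> p \<in> N p"
    "\<And>p x y. p \<in> topspace X \<Longrightarrow> x \<in> N p \<inter> H \<Longrightarrow> y \<in> N p \<inter> H \<Longrightarrow> x = y"
    by metis
  have fin: "finite (N p \<inter> H)" if "p \<in> topspace X" for p
  proof (cases "N p \<inter> H = {}")
    case False
    then obtain x where "x \<in> N p \<inter> H" by blast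
    then have "N p \<inter> H \<subseteq> {x}" using N(3)[OF that] by blast
    then show ?thesis using finite_subset by blast
  qed simp
  have KX: "K \<subseteq> topspace X" using K by (simp add: compactin_subset_topspace)
  have "\<forall>U\<in>N ` K. openin X U" "K \<subseteq> \<Union> (N ` K)" using N(1,2) KX by auto
  then have "\<exists>F. finite F \<and> F \<subseteq> N ` K \<and> K \<subseteq> \<Union> F"
    using K unfolding compactin_def by simp
  then obtain F where F: "finite F" "F \<subseteq> N ` K" "K \<subseteq> \<Union> F" by blast
  obtain P where P: "finite P" "P \<subseteq> K" "F = N ` P" 
    using finite_subset_image[OF F(1,2)] by blast
  have "H \<inter> K \<subseteq> (\<Union>p\<in>P. N p \<inter> H)" using F P by blast
  moreover have "finite (\<Union>p\<in>P. N p \<inter> H)" using fin P(1,2) KX by blast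
  ultimately show ?thesis by (rule finite_subset)
qed

context building_action
begin

abbreviation "displacement c g \<equiv> word_length W S (\<delta> c (\<phi> g c))"

lemma \<phi>_mult: "g \<in> carrier G \<Longrightarrow> h \<in> carrier G \<Longrightarrow> x \<in> C \<Longrightarrow> \<phi> (g \<otimes>\<^bsub>G\<^esub> h) x = \<phi> g (\<phi> h x)"
  using Act.composition_rule by blast

lemma \<phi>_in: "g \<in> carrier G \<Longrightarrow> x \<in> C \<Longrightarrow> \<phi> g x \<in> C"
  using Act.element_image by blast

lemma \<phi>_one: "x \<in> C \<Longrightarrow> \<phi> \<one>\<^bsub>G\<^esub> x = x"
  using Act.id_eq_one by (metis restrict_apply')

lemma displacement_mult_le:
  assumes "g \<in> carrier G" "h \<in> carrier G" "c \<in> C"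
  shows "displacement c (g \<otimes>\<^bsub>G\<^esub> h) \<le> displacement c g + displacement c h"
  using Bld.len_dist_triangle[of c "\<phi> g c" "\<phi> g (\<phi> h c)"] assms
  by (simp add: \<phi>_mult \<phi>_in preserves_dist)

lemma displacement_inverse:
  assumes "g \<in> carrier G" "c \<in> C"
  shows "displacement c (inv\<^bsub>G\<^esub> g) = displacement c g"
proof -
  have "\<delta> c (\<phi> (inv\<^bsub>G\<^esub> g) c) = \<delta> (\<phi> g c) (\<phi> g (\<phi> (inv\<^bsub>G\<^esub> g) c))"
    using assms by (simp add: preserves_dist \<phi>_in)
  also have "\<phi> g (\<phi> (inv\<^bsub>G\<^esub> g) c) = c"
    using assms \<phi>_mult[of g "inv\<^bsub>G\<^esub> g" c] by (simp add: \<phi>_one)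
  finally show ?thesis using Bld.len_dist_sym[of c "\<phi> g c"] assms \<phi>_in by simp
qed

lemma displacement_one: "c \<in> C \<Longrightarrow> displacement c \<one>\<^bsub>G\<^esub> = 0"
  using Bld.WD1[of c c] by (simp add: \<phi>_one)

text \<open>The orbit map to the discrete set of chambers is continuous, so a compact set has finite
  image.\<close>

lemma displacement_bounded_on_compact:
  assumes K: "compactin X K" and c: "c \<in> C"
  shows "\<exists>M. \<forall>g\<in>K. displacement c g \<le> M"
proof -
  have "continuous_map X (prod_topology X (discrete_topology C)) (\<lambda>g. (g, c))"
    using c by (intro continuous_map_pairedI) (simp_all add: continuous_map_id[unfolded id_def])
  then have "continuous_map X (discrete_topology C) (\<lambda>g. \<phi> g c)"
    using continuous_map_compose[OF _ continuous_action] by (fastforce simp: o_def)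
  then have "compactin (discrete_topology C) ((\<lambda>g. \<phi> g c) ` K)"
    using image_compactin K by blast
  then have "finite ((\<lambda>g. \<phi> g c) ` K)" by (simp add: compactin_discrete_topology)
  then have "finite ((\<lambda>x. word_length W S (\<delta> c x)) ` (\<lambda>g. \<phi> g c) ` K)" by simp
  then have "finite (displacement c ` K)" by (simp add: image_image)
  then show ?thesis using Max_ge by blast
qed

lemma ball_one_finite:
  assumes S: "finite S" and c: "c \<in> C"
  shows "finite {x \<in> C. word_length W S (\<delta> c x) \<le> 1}"
proof -
  have "{x \<in> C. word_length W S (\<delta> c x) \<le> 1} \<subseteq> insert c (\<Union>s\<in>S. {x \<in> C. \<delta> c x \<in> {\<one>\<^bsub>W\<^esub>, s}})"
  proof
    fix x assume x: "x \<in> {x \<in> C. word_length W S (\<delta> c x) \<le> 1}"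
    then have "\<delta> c x \<in> carrier W" using c Bld.dist_closed by simp
    then obtain u where u: "set u \<subseteq> S" "list_mult W u = \<delta> c x" "length u = word_length W S (\<delta> c x)"
      by (rule Bld.obtain_reduced)
    then have "length u \<le> 1" using x by simp
    then have "u = [] \<or> (\<exists>s. u = [s])" by (auto simp: le_Suc_eq length_Suc_conv)
    then show "x \<in> insert c (\<Union>s\<in>S. {x \<in> C. \<delta> c x \<in> {\<one>\<^bsub>W\<^esub>, s}})"
      using u x c Bld.WD1[of c x] by auto
  qed
  moreover have "finite \<dots>" using S Bld.panels_finite c by simp
  ultimately show ?thesis using finite_subset by blast
qed

text \<open>Conversely, by properness, only a compact set of group elements moves \<open>c\<close> into a given finite
  set.\<close>

lemma bounded_displacement_compact:
  assumes F: "finite F" "F \<subseteq> C" and c: "c \<in> C"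
  shows "compactin X {g \<in> carrier G. \<phi> g c \<in> F}"
proof -
  let ?D = "discrete_topology C"
  have "compactin (prod_topology ?D ?D) (F \<times> {c})"
    using F c by (simp add: compactin_Times compactin_discrete_topology)
  then have "compactin (prod_topology X ?D)
      {z \<in> topspace (prod_topology X ?D). (\<lambda>(g, x). (\<phi> g x, x)) z \<in> F \<times> {c}}"
    by (rule compactin_proper_map_preimage[OF proper_action])
  then have "compactin X (fst ` {z \<in> topspace (prod_topology X ?D). (\<lambda>(g, x). (\<phi> g x, x)) z \<in> F \<times> {c}})"
    by (rule image_compactin[OF _ continuous_map_fst])
  also have "fst ` {z \<in> topspace (prod_topology X ?D). (\<lambda>(g, x). (\<phi> g x, x)) z \<in> F \<times> {c}} =
      {g \<in> carrier G. \<phi> g c \<in> F}"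
    using c by (force simp: Grp.topspace_eq)
  finally show ?thesis .
qed

end

section \<open>Twin building lattices are undistorted\<close>

theorem theorem1p1:
  fixes Gp :: "'g monoid" and Xp :: "'g topology"
    and Gm :: "'h monoid" and Xm :: "'h topology"
    and \<Gamma> :: "('g \<times> 'h) set" and K :: "('g \<times> 'h) monoid"
    and W :: "'w monoid" and S :: "'w set"
    and T :: "('g \<times> 'h) set" and U :: "'w set \<Rightarrow> ('g \<times> 'h) set"
    and Cp Cm :: "('g \<times> 'h) set set"
    and \<delta> :: "('g \<times> 'h) set \<Rightarrow> ('g \<times> 'h) set \<Rightarrow> 'w"
    and \<phi>p :: "'g \<Rightarrow> ('g \<times> 'h) set \<Rightarrow> ('g \<times> 'h) set"
    and \<phi>m :: "'h \<Rightarrow> ('g \<times> 'h) set \<Rightarrow> ('g \<times> 'h) set"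
    and \<Sigma> \<Sigma>' :: "('g \<times> 'h) set"
  assumes "K = (Gp \<times>\<times> Gm)\<lparr>carrier := \<Gamma>\<rparr>"
    and "finite S"
    and "root_group_datum K W S T U"
    and "\<And>\<alpha>. \<alpha> \<in> roots W S \<Longrightarrow> finite (U \<alpha>)"
    and "Cp = lcosets\<^bsub>K\<^esub> (B_pos K W S T U)"
    and "Cm = lcosets\<^bsub>K\<^esub> (B_neg K W S T U)"
    and "\<delta> = rgd_dist K W S T U"
    and "twin_building_lattice Gp Xp Gm Xm W S Cp \<delta> Cm \<delta> \<phi>p \<phi>m \<delta> \<Gamma>"
    and "\<And>\<gamma> x. \<gamma> \<in> \<Gamma> \<Longrightarrow> x \<in> Cp \<Longrightarrow> \<phi>p (fst \<gamma>) x = \<gamma> <#\<^bsub>K\<^esub> x"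
    and "\<And>\<gamma> y. \<gamma> \<in> \<Gamma> \<Longrightarrow> y \<in> Cm \<Longrightarrow> \<phi>m (snd \<gamma>) y = \<gamma> <#\<^bsub>K\<^esub> y"
    and "finite \<Sigma>" and "\<Sigma> \<subseteq> \<Gamma>" and "generate K \<Sigma> = \<Gamma>"
    and "compactin (prod_topology Xp Xm) \<Sigma>'"
    and "generate (Gp \<times>\<times> Gm) \<Sigma>' = carrier (Gp \<times>\<times> Gm)"
  shows "quasi_isometric_embedding \<Gamma> (word_dist K \<Sigma>)
           (carrier (Gp \<times>\<times> Gm)) (word_dist (Gp \<times>\<times> Gm) \<Sigma>') (\<lambda>x. x)"
proof -
  let ?G = "Gp \<times>\<times> Gm" and ?X = "prod_topology Xp Xm"
  interpret L: twin_building_lattice Gp Xp Gm Xm W S Cp \<delta> Cm \<delta> \<phi>p \<phi>m \<delta> \<Gamma> by fact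
  interpret R: root_group_datum K W S T U by fact
  interpret G: topological_group ?G ?X
    by (rule topological_group_DirProd[OF L.plus.Grp.topological_group_axioms
          L.minus.Grp.topological_group_axioms])
  have \<Gamma>_sub: "subgroup \<Gamma> ?G" and \<Gamma>_disc: "subtopology ?X \<Gamma> = discrete_topology \<Gamma>"
    using L.lattice by (auto simp: lattice_subgroup_def)
  have \<Gamma>_in: "\<Gamma> \<subseteq> carrier ?G" using subgroup.subset[OF \<Gamma>_sub] .
  have K_carrier: "carrier K = \<Gamma>" and K_mult: "mult K = mult ?G" and K_one: "\<one>\<^bsub>K\<^esub> = \<one>\<^bsub>?G\<^esub>"
    by (simp_all add: assms(1))
  have K_inv: "inv\<^bsub>K\<^esub> x = inv\<^bsub>?G\<^esub> x" if "x \<in> \<Gamma>" for x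
    using G.m_inv_consistent[OF \<Gamma>_sub that] by (simp add: assms(1))
  have twin: "twin_building W S Cp \<delta> Cm \<delta> \<delta>"
    using L.plus.Bld.building_axioms L.minus.Bld.building_axioms L.twinning
    by (simp add: twin_building_def twin_building_axioms_def)
  interpret D: twin_root_group_datum K W S T U
    using twin unfolding assms(5-7)
    by (rule twin_root_group_datum.intro[OF R.root_group_datum_axioms
          twin_root_group_datum_axioms.intro])
  let ?cp = "\<one>\<^bsub>K\<^esub> <#\<^bsub>K\<^esub> B_pos K W S T U" and ?cm = "\<one>\<^bsub>K\<^esub> <#\<^bsub>K\<^esub> B_neg K W S T U"
  interpret A: opposite_transitive_action W S Cp \<delta> Cm \<delta> \<delta> K
    "\<lambda>g x. g <#\<^bsub>K\<^esub> x" "\<lambda>g y. g <#\<^bsub>K\<^esub> y" ?cp ?cm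
    unfolding assms(5-7) by (rule D.translation_opposite_transitive)
  let ?l = "word_length W S"
  define dp where "dp g = L.plus.displacement ?cp (fst g)" for g :: "'g \<times> 'h"
  define dm where "dm g = L.minus.displacement ?cm (snd g)" for g :: "'g \<times> 'h"
  have dp_eq: "?l (\<delta> ?cp (\<gamma> <#\<^bsub>K\<^esub> ?cp)) = dp \<gamma>" and dm_eq: "?l (\<delta> ?cm (\<gamma> <#\<^bsub>K\<^esub> ?cm)) = dm \<gamma>"
    if "\<gamma> \<in> \<Gamma>" for \<gamma>
    using assms(9)[OF that A.c0] assms(10)[OF that A.d0] by (simp_all add: dp_def dm_def)
  have \<Sigma>'_in: "\<Sigma>' \<subseteq> carrier ?G"
    using compactin_subset_topspace[OF assms(14)] G.topspace_eq by simp

  obtain Mp where Mp: "\<And>g. g \<in> fst ` \<Sigma>' \<Longrightarrow> L.plus.displacement ?cp g \<le> Mp"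
    using L.plus.displacement_bounded_on_compact[OF image_compactin[OF assms(14) continuous_map_fst] A.c0]
    by blast
  obtain Mm where Mm: "\<And>g. g \<in> snd ` \<Sigma>' \<Longrightarrow> L.minus.displacement ?cm g \<le> Mm"
    using L.minus.displacement_bounded_on_compact[OF image_compactin[OF assms(14) continuous_map_snd] A.d0]
    by blast
  \<comment> \<open>Each letter of a word in \<open>\<Sigma>'\<close> moves the two base chambers by at most \<open>M\<close>.\<close>
  define M where "M = max Mp Mm"
  have displacement_word: "dp (list_mult ?G xs) \<le> M * length xs \<and> dm (list_mult ?G xs) \<le> M * length xs"
    if "set xs \<subseteq> \<Sigma>' \<union> m_inv ?G ` \<Sigma>'" for xs
    using that
  proof (induction xs)
    case Nil
    then show ?case
      using L.plus.displacement_one[OF A.c0] L.minus.displacement_one[OF A.d0]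
      by (simp add: dp_def dm_def DirProd_def)
  next
    case (Cons x xs)
    define y where "y = list_mult ?G xs"
    have sub: "\<Sigma>' \<union> m_inv ?G ` \<Sigma>' \<subseteq> carrier ?G"
      using \<Sigma>'_in G.inv_closed by blast
    have xs_in: "set xs \<subseteq> carrier ?G" using Cons.prems sub by (meson order_trans set_subset_Cons)
    have in': "x \<in> carrier ?G" "y \<in> carrier ?G"
      using Cons.prems sub G.list_mult_closed[OF xs_in] unfolding y_def
      by (meson list.set_intros(1) subsetD)+
    have bound: "dp z \<le> M \<and> dm z \<le> M" if "z \<in> \<Sigma>'" for z
      using Mp[of "fst z"] Mm[of "snd z"] that by (auto simp: dp_def dm_def M_def)
    have "dp x \<le> M \<and> dm x \<le> M"
    proof (cases "x \<in> \<Sigma>'")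
      case False
      then obtain z where z: "z \<in> \<Sigma>'" "x = inv\<^bsub>?G\<^esub> z" using Cons.prems by auto
      have zin: "fst z \<in> carrier Gp" "snd z \<in> carrier Gm"
        using z \<Sigma>'_in by (auto simp: DirProd_def)
      then have "x = (inv\<^bsub>Gp\<^esub> fst z, inv\<^bsub>Gm\<^esub> snd z)"
        using inv_DirProd[OF L.plus.Grp.is_group L.minus.Grp.is_group zin] z(2) by simp
      then show ?thesis
        using bound[OF z(1)] L.plus.displacement_inverse[OF zin(1) A.c0]
          L.minus.displacement_inverse[OF zin(2) A.d0]
        by (simp add: dp_def dm_def)
    qed (rule bound)
    moreover have "fst x \<in> carrier Gp" "snd x \<in> carrier Gm" "fst y \<in> carrier Gp" "snd y \<in> carrier Gm"
      using in' by (auto simp: DirProd_def)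
    then have "dp (x \<otimes>\<^bsub>?G\<^esub> y) \<le> dp x + dp y" "dm (x \<otimes>\<^bsub>?G\<^esub> y) \<le> dm x + dm y"
      using L.plus.displacement_mult_le[OF _ _ A.c0] L.minus.displacement_mult_le[OF _ _ A.d0]
      by (simp_all add: dp_def dm_def DirProd_def case_prod_unfold)
    ultimately show ?case using Cons by (simp add: y_def)
  qed
  have displacement: "dp g \<le> M * word_length ?G \<Sigma>' g" "dm g \<le> M * word_length ?G \<Sigma>' g"
    if "g \<in> carrier ?G" for g
  proof -
    have "g \<in> generate ?G \<Sigma>'" unfolding assms(15) by (rule that)
    then obtain xs where xs: "set xs \<subseteq> \<Sigma>' \<union> m_inv ?G ` \<Sigma>'" "list_mult ?G xs = g"
      "length xs = word_length ?G \<Sigma>' g"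
      by (rule G.obtain_shortest_word[OF \<Sigma>'_in])
    show "dp g \<le> M * word_length ?G \<Sigma>' g" "dm g \<le> M * word_length ?G \<Sigma>' g"
      using displacement_word[OF xs(1)] unfolding xs(2,3) by simp_all
  qed

  \<comment> \<open>properness puts the small elements in a compact set, and the lattice is discrete\<close>
  have "finite A.small"
  proof -
    let ?Bp = "{x \<in> Cp. ?l (\<delta> ?cp x) \<le> 1}" and ?Bm = "{y \<in> Cm. ?l (\<delta> ?cm y) \<le> 1}"
    let ?Z = "{g \<in> carrier Gp. \<phi>p g ?cp \<in> ?Bp} \<times> {g \<in> carrier Gm. \<phi>m g ?cm \<in> ?Bm}"
    have "compactin ?X ?Z"
      using L.plus.bounded_displacement_compact[OF L.plus.ball_one_finite[OF assms(2) A.c0] _ A.c0]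
        L.minus.bounded_displacement_compact[OF L.minus.ball_one_finite[OF assms(2) A.d0] _ A.d0]
      by (simp add: compactin_Times)
    then have "finite (\<Gamma> \<inter> ?Z)"
      by (rule G.discrete_subgroup_Int_compact_finite[OF \<Gamma>_sub \<Gamma>_disc])
    moreover have "A.small \<subseteq> \<Gamma> \<inter> ?Z"
    proof
      fix \<gamma> assume \<gamma>: "\<gamma> \<in> A.small"
      then have \<gamma>\<Gamma>: "\<gamma> \<in> \<Gamma>" by (simp add: A.small_def K_carrier)
      then have "fst \<gamma> \<in> carrier Gp" "snd \<gamma> \<in> carrier Gm"
        using \<Gamma>_in by (auto simp: DirProd_def)
      then have "\<gamma> \<in> ?Z"
        using \<gamma> \<gamma>\<Gamma> assms(9)[OF \<gamma>\<Gamma> A.c0] assms(10)[OF \<gamma>\<Gamma> A.d0] A.c0 A.d0 A.a_closed A.b_closed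
        by (simp add: A.small_def mem_Times_iff)
      then show "\<gamma> \<in> \<Gamma> \<inter> ?Z" using \<gamma>\<Gamma> by blast
    qed
    ultimately show ?thesis using finite_subset by blast
  qed
  then obtain L2 where L2: "\<And>e. e \<in> A.small \<Longrightarrow> word_length K \<Sigma> e \<le> L2"
    using finite_nat_set_iff_bounded_le[of "word_length K \<Sigma> ` A.small"] by auto
  \<comment> \<open>the factor 3 is that of \<open>2 d\<^sub>- + d\<^sub>+\<close> with both displacements bounded by \<open>M\<close> times the length\<close>
  have upper: "word_length K \<Sigma> \<gamma> \<le> (3 * L2 * M) * word_length ?G \<Sigma>' \<gamma> + L2" if \<gamma>: "\<gamma> \<in> \<Gamma>" for \<gamma>
  proof -
    obtain xs where xs: "set xs \<subseteq> A.small" "list_mult K xs = \<gamma>" "length xs \<le> 2 * dm \<gamma> + dp \<gamma> + 1"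
      using A.small_word_bound[of \<gamma>] \<gamma> by (auto simp: K_carrier dp_eq dm_eq)
    have "word_length K \<Sigma> \<gamma> \<le> L2 * length xs"
      using R.word_length_list_mult_le[of \<Sigma> A.small L2 xs] xs assms(12,13) L2
      by (auto simp: K_carrier A.small_def)
    also have "\<dots> \<le> L2 * (3 * (M * word_length ?G \<Sigma>' \<gamma>) + 1)"
      using xs(3) displacement[of \<gamma>] \<gamma> \<Gamma>_in by (intro mult_left_mono) auto
    finally show ?thesis by (simp add: algebra_simps)
  qed

  have "finite (\<Sigma> \<union> m_inv K ` \<Sigma>)" using assms(11) by simp
  then obtain L1 where L1: "\<And>e. e \<in> \<Sigma> \<union> m_inv K ` \<Sigma> \<Longrightarrow> word_length ?G \<Sigma>' e \<le> L1"
    using finite_nat_set_iff_bounded_le[of "word_length ?G \<Sigma>' ` (\<Sigma> \<union> m_inv K ` \<Sigma>)"] by auto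
  have lower: "word_length ?G \<Sigma>' \<gamma> \<le> L1 * word_length K \<Sigma> \<gamma>" if \<gamma>: "\<gamma> \<in> \<Gamma>" for \<gamma>
  proof -
    obtain xs where xs: "set xs \<subseteq> \<Sigma> \<union> m_inv K ` \<Sigma>" "list_mult K xs = \<gamma>"
      "length xs = word_length K \<Sigma> \<gamma>"
      using R.obtain_shortest_word[of \<Sigma> \<gamma>] assms(12,13) \<gamma> by (auto simp: K_carrier)
    have "\<Sigma> \<union> m_inv K ` \<Sigma> \<subseteq> carrier K" using assms(12) R.inv_closed by (auto simp: K_carrier)
    then have "\<Sigma> \<union> m_inv K ` \<Sigma> \<subseteq> carrier ?G" unfolding K_carrier using \<Gamma>_in by (rule order_trans)
    then show ?thesis
      using G.word_length_list_mult_le[OF \<Sigma>'_in assms(15) L1 _ xs(1)] xs(2,3)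
      by (simp add: K_mult K_one)
  qed

  have "inv\<^bsub>?G\<^esub> x \<otimes>\<^bsub>?G\<^esub> y \<in> \<Gamma>" if "x \<in> \<Gamma>" "y \<in> \<Gamma>" for x y
    using that \<Gamma>_sub by (simp add: subgroup.m_closed subgroup.m_inv_closed)
  then show ?thesis
    unfolding word_dist_def
    by (intro quasi_isometric_embedding_of_linear_bounds[where ?L1.0 = L1 and ?L2.0 = "3 * L2 * M"
          and ?C2.0 = L2] \<Gamma>_in) (use upper lower K_inv in \<open>simp_all add: K_mult\<close>)
qed

end
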